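(* In the setting described in the context, assume that there exists $\hat{x}\in \mathbb{R}^d$ which is an asymptotically stable equilibrium for the ODE $\dot x =a(x)$, such that there exist $C,\delta>0$ with $$\|X(t,y)-\hat{x}\|\leqslant Ce^{-\delta t}\qquad \forall y\in\mathrm{supp}(v^0),\ t\geqslant0.$$ Moreover, assume that $\mathrm{supp}(v^0)\cup K_x$ is a compact set such that there exist $C',\delta'>0$ with $$\|X(t,y)-\hat{x}\|\leqslant C'e^{-\delta' t}\qquad \forall y\in\mathrm{supp}(v^0)\cup K_x,\ t\geqslant0,$$ that $$\bigcup_{s\geqslant0}X\big(s,\mathrm{supp}(v^0)\cup K_x\big)\cap K_y=\emptyset ,$$ and that there exist positive values $D$, $I^m$, $I^M$ such that $$R(x,I^m)\geqslant0,\qquad R(x,I^M)\leqslant0\qquad\text{and}\qquad \partial_IR(x,I)\leqslant-D,\qquad\forall x\in \mathrm{supp}(v^0).$$ Then $v$ converges (as $t\to+\infty$) to $\hat{\rho}\,\delta_{\hat{x}}$ in the weak sense in the space of Radon measures, where $\hat{\rho}$ is the unique solution of $$R(\hat{x},\psi_g(\hat{x},\hat{x})\hat{\rho})=0.$$ Consequently, $v^h_\varepsilon$ is an asymptotic preserving approximation of $v$.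
   Context: Subscripts on spaces indicate the variable ($x,y\in\mathbb{R}^d$, $I\in\mathbb{R}$). Let $k\geqslant1$ be an integer. All coefficients are time independent and the advection is local: $a=a(x)\in (W^{k+1,\infty}(\mathbb{R}^d))^d$; $R=R(x,I)\in\mathcal{C}(\mathbb{R}^d_x,W^{k,\infty}_{loc}(\mathbb{R}_I))\cap\mathcal{C}(\mathbb{R}_I,\mathcal{C}^k(\mathbb{R}^d_x)\cap W^{k,\infty}(\mathbb{R}^d_x))$; $\psi_g,\psi_d\in\mathcal{C}(\mathbb{R}^d_x,W^{1,\infty}(\mathbb{R}^d_y))\cap\mathcal{C}(\mathbb{R}^d_y,\mathcal{C}^k(\mathbb{R}^d_x)\cap W^{k,\infty}(\mathbb{R}^d_x))$, with $\psi_g\geqslant\underline{\psi_g}$ for some constant $\underline{\psi_g}>0$, and $\psi_g,\psi_d$ are assumed compactly supported as functions of the $y$ variable. $0\leqslant m=m(x,y,I)\in\mathcal{C}(\mathbb{R}^d_x\times\mathbb{R}^d_y,W^{k,\infty}(\mathbb{R}_I))\cap\mathcal{C}(\mathbb{R}^d_x\times\mathbb{R}_I,W^{k,\infty}(\mathbb{R}^d_y))\cap\mathcal{C}(\mathbb{R}^d_y\times\mathbb{R}_I,\mathcal{C}^k_c(\mathbb{R}^d_x))$ is globally Lipschitz with respect to the non-local variable: there is $\mu>0$ with $\sup_{x,y}\sum_{i=1}^k\sum_{|\alpha|=i}\sum_{j=1}^k|\partial^\alpha_x\partial^j_Im(x,y,I)-\partial^\alpha_x\partial^j_Im(x,y,J)|\leqslant\mu|I-J|$.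 The function $M(x):=\sup_{y,I}\sum_{i=1}^k\sum_{|\alpha|=i}\sum_{j=1}^k|\partial^\alpha_x\partial_I^jm(x,y,I)|$ has support in a compact set $\mathcal{K}$ and $\|M\|_{L^\infty}\leqslant\overline{M}<\infty$; $K:=|\mathcal{K}|\overline{M}$. The function $m$ is uniformly compactly supported in $x$ and in $y$: there are compact sets $K_x,K_y$ such that $\sup_{y,I}m(x,y,I)=0$ for all $x\notin K_x$ and $\sup_{x,I}m(x,y,I)=0$ for all $y\notin K_y$. There are constants $I^*,r^*\geqslant0$ with $R(x,I)+K<-r^*$ for all $x$ and all $I\geqslant I^*$. The initial datum is $0\leqslant v^0\in W^{k,1}(\mathbb{R}^d)$. $X(t,y)$ denotes the flow: $\partial_tX(t,y)=a(X(t,y))$, $X(0,y)=y$; $X(s,A)=\{X(s,y):y\in A\}$. $v$ denotes the non-negative weak solution, in $\mathcal{C}([0,T],W^{k,1}(\mathbb{R}^d))$ for every $T>0$, of $$\partial_tv+\nabla\cdot(a(x)v)=R(x,(I_gv)(t,x))v+\int_{\mathbb{R}^d}m(x,y,(I_dv)(t,x))v(t,y)\,dy,\quad v(0,\cdot)=v^0,$$ where $(I_lv)(t,x)=\int_{\mathbb{R}^d}\psi_l(x,y)v(t,y)\,dy$, $l\in\{g,d\}$; weak means that for every $T>0$ and $\phi\in\mathcal{C}^1_c([0,T)\times\mathbb{R}^d)$, $\int_0^T\int v\,[-\partial_t\phi-a\cdot\nabla\phi-R(x,I_gv)\phi-\int m(y,x,(I_dv)(t,y))\phi(t,y)dy]\,dx\,dt=\int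 v^0\phi(0,\cdot)\,dx$. Particle approximation. For $h>0$: a countable index set $\mathcal{J}_h\subset\mathbb{Z}^d$, pairwise disjoint sets $\Omega_i^0$ ($i\in\mathcal{J}_h$) with union $\mathbb{R}^d$ and masses (volumes) $w_i^0$, points $x_i^0\in\Omega_i^0$, and positive constants $c,C_0$ with $ch\leqslant|x^0_i-x^0_j|\leqslant C_0h$ for all $i\neq j$, $ch^d\leqslant w^0_i\leqslant C_0h^d$ for all $i$, and $\sum_iv^0(x_i^0)w_i^0<\infty$. The functions $x_i,w_i,\nu_i$ solve for $t\geqslant0$ $$\dot x_i=a(x_i),\quad \dot w_i=\operatorname{div}a(x_i)w_i,\quad \dot\nu_i=\big(-\operatorname{div}a(x_i)+R(x_i,I_g(t,x_i))\big)\nu_i+\sum_{j\in\mathcal{J}_h}w_j\nu_jm(x_i,x_j,I_d(t,x_i)),$$ with $I_l(t,x)=\sum_{j\in\mathcal{J}_h}\nu_j(t)w_j(t)\psi_l(x,x_j(t))$, $x_i(0)=x_i^0$, $w_i(0)=w_i^0$, $\nu_i(0)=v^0(x_i^0)$; $h$ is taken small enough that $\sum_{i\in\mathcal{J}_h}w_i(t)m(x_i(t),y,I_d(t,x_i(t)))<K+\frac{r^*}{2}$ on the time interval considered. With a cut-off function $\varphi\in\mathcal{C}_c(\mathbb{R}^d)$ such that $\int\varphi=1$ and $\int x^\alpha\varphi(x)dx=0$ for $1\leqslant|\alpha|\leqslant r-1$ ($r\geqslant1$ an integer), put $\varphi_\varepsilon=\varepsilon^{-d}\varphi(\cdot/\varepsilon)$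 and $v^h_\varepsilon(t,x)=\sum_{i\in\mathcal{J}_h}\nu_i(t)w_i(t)\varphi_\varepsilon(x-x_i(t))$. Weak convergence of finite Radon measures $\mu_t\rightharpoonup\mu$ means $\int\phi\,d\mu_t\to\int\phi\,d\mu$ for all $\phi\in\mathcal{C}_c(\mathbb{R}^d)$. Definition: $v^h_\varepsilon$ is an asymptotic preserving approximation of $v$ if for every $\varepsilon:(0,1]\to(0,\infty)$ with $\varepsilon(h)\to0$ as $h\to0$ and every $\phi\in\mathcal{C}_c(\mathbb{R}^d)$, $$\limsup_{t\to+\infty}\Big|\int_{\mathbb{R}^d}\phi(x)v^h_{\varepsilon(h)}(t,x)\,dx-\int_{\mathbb{R}^d}\phi(x)v(t,x)\,dx\Big|\underset{h\to0}{\longrightarrow}0.$$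
   Formalization: ψ_g need not be compactly supported in y; v⁰ is not a.e. 0; the R-conditions are also assumed at x̂; for the last claim v⁰ is continuous, |x_i⁰−x_j⁰|≤C₀h becomes "Ω_i⁰ lies within C₀h of x_i⁰", and (ν_i w_i) is continuous in time in ℓ¹. *)

theory Defs
  imports "HOL-Probability.Probability"
begin

definition supp :: "('a::topological_space \<Rightarrow> real) \<Rightarrow> 'a set"
  where "supp f = closure {x. f x \<noteq> 0}"

definition compactly_supported :: "('a::topological_space \<Rightarrow> real) \<Rightarrow> bool"
  where "compactly_supported f \<longleftrightarrow> compact (supp f)"

text \<open>Support of an almost-everywhere class: it does not depend on the representative, and it
  agrees with \<^const>\<open>supp\<close> on continuous functions.\<close>

definition ess_supp :: "('a::euclidean_space \<Rightarrow> real) \<Rightarrow> 'a set"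
  where "ess_supp f =
    {x. \<forall>U. open U \<and> x \<in> U \<longrightarrow> \<not> (AE y in lebesgue. y \<in> U \<longrightarrow> f y = 0)}"

definition partial :: "'a::euclidean_space \<Rightarrow> ('a \<Rightarrow> real) \<Rightarrow> 'a \<Rightarrow> real"
  where "partial b f = (\<lambda>x. frechet_derivative f (at x) b)"

primrec Ck :: "nat \<Rightarrow> ('a::euclidean_space \<Rightarrow> real) \<Rightarrow> bool" where
  "Ck 0 f \<longleftrightarrow> continuous_on UNIV f"
| "Ck (Suc k) f \<longleftrightarrow> (\<forall>x. f differentiable (at x)) \<and> (\<forall>b\<in>Basis. Ck k (partial b f))"

definition divergence :: "('a::euclidean_space \<Rightarrow> 'a) \<Rightarrow> 'a \<Rightarrow> real"
  where "divergence a x = (\<Sum>b\<in>Basis. frechet_derivative a (at x) b \<bullet> b)"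

text \<open>A multi-index assigns an exponent to every coordinate direction; it is set to zero off
  \<^const>\<open>Basis\<close> so that distinct functions are distinct multi-indices.\<close>

definition multi_index :: "('a::euclidean_space \<Rightarrow> nat) set"
  where "multi_index = {\<alpha>. \<forall>b. b \<notin> Basis \<longrightarrow> \<alpha> b = 0}"

definition mi_order :: "('a::euclidean_space \<Rightarrow> nat) \<Rightarrow> nat"
  where "mi_order \<alpha> = (\<Sum>b\<in>Basis. \<alpha> b)"

definition unit_index :: "'a::euclidean_space \<Rightarrow> 'a \<Rightarrow> nat"
  where "unit_index b = (\<lambda>c. if c = b then 1 else 0)"

definition monomial :: "('a::euclidean_space \<Rightarrow> nat) \<Rightarrow> 'a \<Rightarrow> real"
  where "monomial \<alpha> x = (\<Prod>b\<in>Basis. (x \<bullet> b) ^ \<alpha> b)"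

text \<open>The enumeration of the coordinate directions is irrelevant: iterated partial derivatives are
  only taken of functions of class \<open>C\<^sup>n\<close> with \<open>n\<close> the order of the multi-index.\<close>

definition basis_list :: "'a::euclidean_space list"
  where "basis_list = (SOME bs. distinct bs \<and> set bs = Basis)"

definition iter_partial :: "('a::euclidean_space \<Rightarrow> nat) \<Rightarrow> ('a \<Rightarrow> real) \<Rightarrow> 'a \<Rightarrow> real"
  where "iter_partial \<alpha> f = foldr (\<lambda>b g. (partial b ^^ \<alpha> b) g) basis_list f"

definition locally_integrable :: "('a::euclidean_space \<Rightarrow> real) \<Rightarrow> bool"
  where "locally_integrable f \<longleftrightarrow> (\<forall>C. compact C \<longrightarrow> set_integrable lebesgue C f)"

text \<open>As in Gilbarg and Trudinger, the test functions for a derivative of order \<open>n\<close> are those of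
  class \<open>C\<^sup>n\<close> with compact support.\<close>

definition weak_derivative ::
    "('a::euclidean_space \<Rightarrow> nat) \<Rightarrow> ('a \<Rightarrow> real) \<Rightarrow> ('a \<Rightarrow> real) \<Rightarrow> bool"
  where "weak_derivative \<alpha> f g \<longleftrightarrow> locally_integrable f \<and> locally_integrable g \<and>
    (\<forall>\<phi>. Ck (mi_order \<alpha>) \<phi> \<and> compactly_supported \<phi> \<longrightarrow>
      (LINT x|lebesgue. f x * iter_partial \<alpha> \<phi> x) =
        (- 1) ^ mi_order \<alpha> * (LINT x|lebesgue. g x * \<phi> x))"

text \<open>Weak derivatives are unique up to null sets; use this choice only almost everywhere.\<close>

definition wderiv :: "('a::euclidean_space \<Rightarrow> nat) \<Rightarrow> ('a \<Rightarrow> real) \<Rightarrow> 'a \<Rightarrow> real"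
  where "wderiv \<alpha> f = (SOME g. weak_derivative \<alpha> f g)"

definition in_Wk1 :: "nat \<Rightarrow> ('a::euclidean_space \<Rightarrow> real) \<Rightarrow> bool"
  where "in_Wk1 k f \<longleftrightarrow> (\<forall>\<alpha>\<in>multi_index. mi_order \<alpha> \<le> k \<longrightarrow>
    (\<exists>g. weak_derivative \<alpha> f g \<and> integrable lebesgue g))"

definition norm_Wk1 :: "nat \<Rightarrow> ('a::euclidean_space \<Rightarrow> real) \<Rightarrow> real"
  where "norm_Wk1 k f =
    (\<Sum>\<alpha>\<in>{\<alpha>\<in>multi_index. mi_order \<alpha> \<le> k}. LINT x|lebesgue. \<bar>wderiv \<alpha> f x\<bar>)"

text \<open>The set \<open>S\<close> is the whole space for \<open>W\<^bsup>k,\<infinity>\<^esup>\<close> and runs through the balls around the origin for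
  \<open>W\<^bsup>k,\<infinity>\<^esup>\<close> with the subscript ``loc''; the derivatives are those of the whole space in both cases.\<close>

definition in_Wkinf_on :: "'a::euclidean_space set \<Rightarrow> nat \<Rightarrow> ('a \<Rightarrow> real) \<Rightarrow> bool"
  where "in_Wkinf_on S k f \<longleftrightarrow> (\<forall>\<alpha>\<in>multi_index. mi_order \<alpha> \<le> k \<longrightarrow>
    (\<exists>g B. weak_derivative \<alpha> f g \<and> (AE x in lebesgue. x \<in> S \<longrightarrow> \<bar>g x\<bar> \<le> B)))"

definition norm_Linf_on :: "'a::euclidean_space set \<Rightarrow> ('a \<Rightarrow> real) \<Rightarrow> real"
  where "norm_Linf_on S f = Inf {B. 0 \<le> B \<and> (AE x in lebesgue. x \<in> S \<longrightarrow> \<bar>f x\<bar> \<le> B)}"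

definition norm_Wkinf_on :: "'a::euclidean_space set \<Rightarrow> nat \<Rightarrow> ('a \<Rightarrow> real) \<Rightarrow> real"
  where "norm_Wkinf_on S k f =
    (\<Sum>\<alpha>\<in>{\<alpha>\<in>multi_index. mi_order \<alpha> \<le> k}. norm_Linf_on S (wderiv \<alpha> f))"

definition continuous_into_Wkinf_on ::
    "'a::euclidean_space set \<Rightarrow> nat \<Rightarrow> ('b::topological_space \<Rightarrow> 'a \<Rightarrow> real) \<Rightarrow> bool"
  where "continuous_into_Wkinf_on S k u \<longleftrightarrow>
    (\<forall>z. in_Wkinf_on S k (u z)) \<and>
    (\<forall>z0. ((\<lambda>z. norm_Wkinf_on S k (\<lambda>y. u z y - u z0 y)) \<longlongrightarrow> 0) (at z0))"

definition continuous_into_Wkinf ::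
    "nat \<Rightarrow> ('b::topological_space \<Rightarrow> 'a::euclidean_space \<Rightarrow> real) \<Rightarrow> bool"
  where "continuous_into_Wkinf k u \<longleftrightarrow> continuous_into_Wkinf_on UNIV k u"

definition continuous_into_Wkinf_loc ::
    "nat \<Rightarrow> ('b::topological_space \<Rightarrow> 'a::euclidean_space \<Rightarrow> real) \<Rightarrow> bool"
  where "continuous_into_Wkinf_loc k u \<longleftrightarrow> (\<forall>r. continuous_into_Wkinf_on (cball 0 r) k u)"

text \<open>Elements of \<open>W\<^bsup>k+1,\<infinity>\<^esup>\<close> are identified with their continuous representative; for \<open>k \<ge> 1\<close> it is
  continuously differentiable, so that \<^const>\<open>divergence\<close> is meaningful.\<close>

definition velocity_regular :: "nat \<Rightarrow> ('a::euclidean_space \<Rightarrow> 'a) \<Rightarrow> bool"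
  where "velocity_regular k a \<longleftrightarrow>
    continuous_on UNIV a \<and> (\<forall>b\<in>Basis. in_Wkinf_on UNIV (k + 1) (\<lambda>x. a x \<bullet> b))"

definition growth_regular :: "nat \<Rightarrow> ('a::euclidean_space \<Rightarrow> real \<Rightarrow> real) \<Rightarrow> bool"
  where "growth_regular k R \<longleftrightarrow>
    continuous_into_Wkinf_loc k (\<lambda>x I. R x I) \<and>
    (\<forall>I. Ck k (\<lambda>x. R x I)) \<and>
    continuous_into_Wkinf k (\<lambda>I x. R x I)"

definition weight_regular :: "nat \<Rightarrow> ('a::euclidean_space \<Rightarrow> 'a \<Rightarrow> real) \<Rightarrow> bool"
  where "weight_regular k \<psi> \<longleftrightarrow>
    continuous_into_Wkinf 1 (\<lambda>x y. \<psi> x y) \<and>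
    (\<forall>y. Ck k (\<lambda>x. \<psi> x y)) \<and>
    continuous_into_Wkinf k (\<lambda>y x. \<psi> x y)"

text \<open>The last two conjuncts render \<open>C(\<real>\<^sup>d \<times> \<real>, C\<^sup>k\<^sub>c)\<close>: all the functions considered vanish outside a
  common compact set, where the topology of \<open>C\<^sup>k\<^sub>c\<close> is that of the \<open>W\<^bsup>k,\<infinity>\<^esup>\<close> norm.\<close>

definition mutation_regular ::
    "nat \<Rightarrow> ('a::euclidean_space \<Rightarrow> 'a \<Rightarrow> real \<Rightarrow> real) \<Rightarrow> bool"
  where "mutation_regular k m \<longleftrightarrow>
    continuous_into_Wkinf k (\<lambda>(x, y) I. m x y I) \<and>
    continuous_into_Wkinf k (\<lambda>(x, I) y. m x y I) \<and>
    (\<forall>y I. Ck k (\<lambda>x. m x y I) \<and> compactly_supported (\<lambda>x. m x y I)) \<and>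
    continuous_into_Wkinf k (\<lambda>(y, I) x. m x y I)"

text \<open>The multi-index on the product space that differentiates \<open>\<alpha>\<close> times in the first variable and
  \<open>j\<close> times in the second one.\<close>

definition mixed_index :: "('a::euclidean_space \<Rightarrow> nat) \<Rightarrow> nat \<Rightarrow> 'a \<times> real \<Rightarrow> nat"
  where "mixed_index \<alpha> j = (\<lambda>(b, s). if s = 0 then \<alpha> b else if b = 0 \<and> s = 1 then j else 0)"

text \<open>The family \<open>dm\<close> consists of representatives of the mixed derivatives of \<open>m\<close> with respect to \<open>x\<close>
  and \<open>I\<close>; a representative has to be named since suprema over points are taken below.\<close>

definition mixed_derivatives ::
    "nat \<Rightarrow> ('a::euclidean_space \<Rightarrow> 'a \<Rightarrow> real \<Rightarrow> real) \<Rightarrow>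
      (('a \<Rightarrow> nat) \<Rightarrow> nat \<Rightarrow> 'a \<Rightarrow> 'a \<Rightarrow> real \<Rightarrow> real) \<Rightarrow> bool"
  where "mixed_derivatives k m dm \<longleftrightarrow>
    (\<forall>\<alpha>\<in>multi_index. \<forall>j. 1 \<le> mi_order \<alpha> \<and> mi_order \<alpha> \<le> k \<and> 1 \<le> j \<and> j \<le> k \<longrightarrow>
      (\<forall>y. weak_derivative (mixed_index \<alpha> j) (\<lambda>(x, I). m x y I) (\<lambda>(x, I). dm \<alpha> j x y I)))"

definition mixed_sum ::
    "nat \<Rightarrow> (('a::euclidean_space \<Rightarrow> nat) \<Rightarrow> nat \<Rightarrow> real) \<Rightarrow> real"
  where "mixed_sum k F =
    (\<Sum>i=1..k. \<Sum>\<alpha>\<in>{\<alpha>\<in>multi_index. mi_order \<alpha> = i}. \<Sum>j=1..k. \<bar>F \<alpha> j\<bar>)"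

definition mixed_sup ::
    "nat \<Rightarrow> (('a::euclidean_space \<Rightarrow> nat) \<Rightarrow> nat \<Rightarrow> 'a \<Rightarrow> 'a \<Rightarrow> real \<Rightarrow> real) \<Rightarrow> 'a \<Rightarrow> ereal"
  where "mixed_sup k dm x = (SUP y. SUP I. ereal (mixed_sum k (\<lambda>\<alpha> j. dm \<alpha> j x y I)))"

definition is_flow :: "('a::euclidean_space \<Rightarrow> 'a) \<Rightarrow> (real \<Rightarrow> 'a \<Rightarrow> 'a) \<Rightarrow> bool"
  where "is_flow a X \<longleftrightarrow>
    (\<forall>y. X 0 y = y) \<and> (\<forall>t y. ((\<lambda>s. X s y) has_vector_derivative a (X t y)) (at t))"

definition asymptotically_stable_equilibrium ::
    "('a::euclidean_space \<Rightarrow> 'a) \<Rightarrow> (real \<Rightarrow> 'a \<Rightarrow> 'a) \<Rightarrow> 'a \<Rightarrow> bool"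
  where "asymptotically_stable_equilibrium a X xhat \<longleftrightarrow>
    a xhat = 0 \<and>
    (\<forall>e>0. \<exists>d>0. \<forall>y\<in>ball xhat d. \<forall>t\<ge>0. X t y \<in> ball xhat e) \<and>
    (\<exists>d>0. \<forall>y\<in>ball xhat d. ((\<lambda>t. X t y) \<longlongrightarrow> xhat) at_top)"

definition nonlocal ::
    "('a::euclidean_space \<Rightarrow> 'a \<Rightarrow> real) \<Rightarrow> (real \<Rightarrow> 'a \<Rightarrow> real) \<Rightarrow> real \<Rightarrow> 'a \<Rightarrow> real"
  where "nonlocal \<psi> v t x = (LINT y|lebesgue. \<psi> x y * v t y)"

text \<open>Functions of class \<open>C\<^sup>1\<close> with compact support in \<open>[0,T) \<times> \<real>\<^sup>d\<close>, given as restrictions of functions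
  on \<open>\<real> \<times> \<real>\<^sup>d\<close>; all of them arise in this way, by reflection in the time variable.\<close>

definition spacetime_test :: "real \<Rightarrow> (real \<times> 'a::euclidean_space \<Rightarrow> real) \<Rightarrow> bool"
  where "spacetime_test T \<phi> \<longleftrightarrow>
    Ck 1 \<phi> \<and> compactly_supported \<phi> \<and> supp \<phi> \<subseteq> {..<T} \<times> UNIV"

definition weak_solution ::
    "nat \<Rightarrow> ('a::euclidean_space \<Rightarrow> 'a) \<Rightarrow> ('a \<Rightarrow> real \<Rightarrow> real) \<Rightarrow> ('a \<Rightarrow> 'a \<Rightarrow> real) \<Rightarrow>
      ('a \<Rightarrow> 'a \<Rightarrow> real) \<Rightarrow> ('a \<Rightarrow> 'a \<Rightarrow> real \<Rightarrow> real) \<Rightarrow> ('a \<Rightarrow> real) \<Rightarrow> (real \<Rightarrow> 'a \<Rightarrow> real) \<Rightarrow> bool"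
  where "weak_solution k a R \<psi>g \<psi>d m v0 v \<longleftrightarrow>
    (\<forall>t\<ge>0. AE x in lebesgue. 0 \<le> v t x) \<and>
    (\<forall>T>0. (\<forall>t\<in>{0..T}. in_Wk1 k (v t)) \<and>
      (\<forall>t\<in>{0..T}. ((\<lambda>s. norm_Wk1 k (\<lambda>x. v s x - v t x)) \<longlongrightarrow> 0) (at t within {0..T}))) \<and>
    (\<forall>T>0. \<forall>\<phi>. spacetime_test T \<phi> \<longrightarrow>
      (LINT t:{0..T}|lebesgue. LINT x|lebesgue. v t x *
        (- frechet_derivative \<phi> (at (t, x)) (1, 0)
         - frechet_derivative \<phi> (at (t, x)) (0, a x)
         - R x (nonlocal \<psi>g v t x) * \<phi> (t, x)
         - (LINT y|lebesgue. m y x (nonlocal \<psi>d v t y) * \<phi> (t, y))))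
      = (LINT x|lebesgue. v0 x * \<phi> (0, x)))"

text \<open>The mesh size is \<open>h\<close>: particles are \<open>c h\<close>-separated, and each cell lies within distance
  \<open>C0 h\<close> of its particle. (An upper bound on the mutual distance of all pairs of particles would be
  incompatible with the cells covering the whole space.)\<close>

definition particle_mesh ::
    "real \<Rightarrow> real \<Rightarrow> real \<Rightarrow> 'i set \<Rightarrow> ('i \<Rightarrow> 'a::euclidean_space set) \<Rightarrow> ('i \<Rightarrow> 'a) \<Rightarrow> ('i \<Rightarrow> real) \<Rightarrow> bool"
  where "particle_mesh c C0 h J \<Omega> x0 w0 \<longleftrightarrow>
    disjoint_family_on \<Omega> J \<and> (\<Union>i\<in>J. \<Omega> i) = UNIV \<and>
    (\<forall>i\<in>J. \<Omega> i \<in> sets lebesgue \<and> emeasure lebesgue (\<Omega> i) = ennreal (w0 i) \<and> x0 i \<in> \<Omega> i) \<and>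
    (\<forall>i\<in>J. \<forall>j\<in>J. i \<noteq> j \<longrightarrow> c * h \<le> dist (x0 i) (x0 j)) \<and>
    (\<forall>i\<in>J. \<Omega> i \<subseteq> cball (x0 i) (C0 * h)) \<and>
    (\<forall>i\<in>J. c * h ^ DIM('a) \<le> w0 i \<and> w0 i \<le> C0 * h ^ DIM('a))"

definition discrete_nonlocal ::
    "('a::euclidean_space \<Rightarrow> 'a \<Rightarrow> real) \<Rightarrow> 'i set \<Rightarrow> ('i \<Rightarrow> real \<Rightarrow> 'a) \<Rightarrow> ('i \<Rightarrow> real \<Rightarrow> real) \<Rightarrow>
      ('i \<Rightarrow> real \<Rightarrow> real) \<Rightarrow> real \<Rightarrow> 'a \<Rightarrow> real"
  where "discrete_nonlocal \<psi> J x w \<nu> t z = (\<Sum>\<^sub>\<infinity>j\<in>J. \<nu> j t * w j t * \<psi> z (x j t))"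

text \<open>The infinite system is understood in \<open>\<ell>\<^sup>1\<close>: the family of products \<open>\<nu>\<^sub>i w\<^sub>i\<close> is a
  continuous function of time with values in \<open>\<ell>\<^sup>1(J)\<close>.\<close>

definition particle_solution ::
    "('a::euclidean_space \<Rightarrow> 'a) \<Rightarrow> ('a \<Rightarrow> real \<Rightarrow> real) \<Rightarrow> ('a \<Rightarrow> 'a \<Rightarrow> real) \<Rightarrow>
      ('a \<Rightarrow> 'a \<Rightarrow> real) \<Rightarrow> ('a \<Rightarrow> 'a \<Rightarrow> real \<Rightarrow> real) \<Rightarrow> ('a \<Rightarrow> real) \<Rightarrow>
      'i set \<Rightarrow> ('i \<Rightarrow> 'a) \<Rightarrow> ('i \<Rightarrow> real) \<Rightarrow>
      ('i \<Rightarrow> real \<Rightarrow> 'a) \<Rightarrow> ('i \<Rightarrow> real \<Rightarrow> real) \<Rightarrow> ('i \<Rightarrow> real \<Rightarrow> real) \<Rightarrow> bool"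
  where "particle_solution a R \<psi>g \<psi>d m v0 J x0 w0 x w \<nu> \<longleftrightarrow>
    (\<lambda>i. v0 (x0 i) * w0 i) summable_on J \<and>
    (\<forall>i\<in>J. x i 0 = x0 i \<and> w i 0 = w0 i \<and> \<nu> i 0 = v0 (x0 i)) \<and>
    (\<forall>t\<ge>0. (\<lambda>i. \<bar>\<nu> i t * w i t\<bar>) summable_on J) \<and>
    (\<forall>t\<ge>0. ((\<lambda>s. \<Sum>\<^sub>\<infinity>i\<in>J. \<bar>\<nu> i s * w i s - \<nu> i t * w i t\<bar>) \<longlongrightarrow> 0) (at t within {0..})) \<and>
    (\<forall>i\<in>J. \<forall>t\<ge>0.
      (x i has_vector_derivative a (x i t)) (at t within {0..}) \<and>
      (w i has_real_derivative divergence a (x i t) * w i t) (at t within {0..}) \<and>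
      (\<nu> i has_real_derivative
        (- divergence a (x i t) + R (x i t) (discrete_nonlocal \<psi>g J x w \<nu> t (x i t))) * \<nu> i t
        + (\<Sum>\<^sub>\<infinity>j\<in>J. w j t * \<nu> j t
            * m (x i t) (x j t) (discrete_nonlocal \<psi>d J x w \<nu> t (x i t))))
        (at t within {0..}))"

definition cutoff :: "nat \<Rightarrow> ('a::euclidean_space \<Rightarrow> real) \<Rightarrow> bool"
  where "cutoff r \<phi> \<longleftrightarrow>
    continuous_on UNIV \<phi> \<and> compactly_supported \<phi> \<and> (LINT x|lebesgue. \<phi> x) = 1 \<and>
    (\<forall>\<alpha>\<in>multi_index. 1 \<le> mi_order \<alpha> \<and> mi_order \<alpha> \<le> r - 1 \<longrightarrow>
      (LINT x|lebesgue. monomial \<alpha> x * \<phi> x) = 0)"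

definition rescaled :: "('a::euclidean_space \<Rightarrow> real) \<Rightarrow> real \<Rightarrow> 'a \<Rightarrow> real"
  where "rescaled \<phi> \<epsilon> x = \<phi> (x /\<^sub>R \<epsilon>) / \<epsilon> ^ DIM('a)"

definition particle_density ::
    "('a::euclidean_space \<Rightarrow> real) \<Rightarrow> 'i set \<Rightarrow> ('i \<Rightarrow> real \<Rightarrow> 'a) \<Rightarrow> ('i \<Rightarrow> real \<Rightarrow> real) \<Rightarrow>
      ('i \<Rightarrow> real \<Rightarrow> real) \<Rightarrow> real \<Rightarrow> real \<Rightarrow> 'a \<Rightarrow> real"
  where "particle_density \<phi> J x w \<nu> \<epsilon> t z =
    (\<Sum>\<^sub>\<infinity>i\<in>J. \<nu> i t * w i t * rescaled \<phi> \<epsilon> (z - x i t))"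

definition weakly_converges ::
    "(real \<Rightarrow> 'a::euclidean_space measure) \<Rightarrow> 'a measure \<Rightarrow> bool"
  where "weakly_converges \<mu> \<mu>' \<longleftrightarrow>
    (\<forall>\<phi>::'a \<Rightarrow> real. continuous_on UNIV \<phi> \<and> compactly_supported \<phi> \<longrightarrow>
      ((\<lambda>t. LINT x|\<mu> t. \<phi> x) \<longlongrightarrow> (LINT x|\<mu>'. \<phi> x)) at_top)"

text \<open>The arguments of \<open>V\<close> are \<open>h\<close>, \<open>\<epsilon>\<close>, \<open>t\<close> and \<open>x\<close>.\<close>

definition asymptotic_preserving ::
    "(real \<Rightarrow> real \<Rightarrow> real \<Rightarrow> 'a::euclidean_space \<Rightarrow> real) \<Rightarrow> (real \<Rightarrow> 'a \<Rightarrow> real) \<Rightarrow> bool"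
  where "asymptotic_preserving V v \<longleftrightarrow>
    (\<forall>\<epsilon>. (\<forall>h. 0 < h \<and> h \<le> 1 \<longrightarrow> 0 < \<epsilon> h) \<and> (\<epsilon> \<longlongrightarrow> 0) (at_right 0) \<longrightarrow>
      (\<forall>\<phi>. continuous_on UNIV \<phi> \<and> compactly_supported \<phi> \<longrightarrow>
        ((\<lambda>h. Limsup at_top (\<lambda>t. ereal
            \<bar>(LINT x|lebesgue. \<phi> x * V h (\<epsilon> h) t x) - (LINT x|lebesgue. \<phi> x * v t x)\<bar>))
          \<longlongrightarrow> 0) (at_right 0)))"

end

theory Submission
  imports Defs
begin

text \<open>A particle of trait \<open>y\<close> moves along \<open>X t y\<close>. No trajectory that starts in the support of \<open>v0\<close> or in
  \<open>Kx\<close>, where all mutants are born, ever visits \<open>Ky\<close>, the only traits that produce mutants. So no mass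
  can reach \<open>Ky\<close> and mutation never acts: the solution is transported by the flow and grows at
  the local rate \<open>R\<close>, and it stays supported in the image under \<open>X t\<close> of the support of \<open>v0\<close>, which
  shrinks to \<open>xhat\<close>. Once the support is close to \<open>xhat\<close>, the total mass \<open>\<rho>\<close> nearly solves the scalar
  equation \<open>\<rho>' = R xhat (\<psi>g xhat xhat * \<rho>) * \<rho>\<close>, whose right-hand side is, for \<open>\<rho> > 0\<close>, positive below
  a unique equilibrium and negative above it. Hence \<open>\<rho>\<close> tends to that equilibrium and the solution tends
  to the corresponding Dirac mass (\<open>logistic_limit\<close>, \<open>concentrating_family.concentration\<close>).

  The particle system has the same structure: its positions follow the same flow, the products of
  \<open>\<nu>\<close> and \<open>w\<close> are the masses of the particles, mutation is switched off for the same reason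
  (\<open>mutation_vanishes\<close>), and only the finitely many particles that start in the support of \<open>v0\<close> carry
  mass. So for each fixed \<open>h\<close> it tends to the same Dirac mass, and the only discrepancy left as time
  tends to infinity is the regularisation at scale \<open>\<epsilon>\<close>, which disappears as \<open>\<epsilon>\<close> tends to zero
  (\<open>particle_density_limit\<close>, \<open>scaled_average_limits\<close>).

  What takes effort is to follow characteristics in the weak formulation. The natural test
  functions \<open>\<eta> t * \<theta> (X (- t) x)\<close> are constant along characteristics up to the factor \<open>\<eta>\<close>. They are
  mollified in space, which makes them \<open>C\<^sup>1\<close> although only the Lipschitz continuity of the flow is used;
  the error that mollification causes in the transport operator is of the order of the
  mollification parameter (\<open>displacement_difference\<close>, \<open>test_transport\<close>). In the limit the pairing of \<open>v t\<close> with
  \<open>\<theta> (X (- t) x)\<close> solves an ordinary differential equation (\<open>F_deriv\<close>), from which Gronwall's inequality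
  gives the propagation of the support (\<open>no_mass_along_characteristic\<close>) and a cut-off equal to one on the support
  gives the equation for the total mass (\<open>total_mass\<close>).

  The Sobolev assumptions on the coefficients enter only through pointwise consequences: the
  velocity is Lipschitz, \<open>R\<close> and \<open>\<psi>g\<close> are jointly continuous, and \<open>R x\<close> decreases with slope at least \<open>D\<close>
  at \<open>xhat\<close>. All of them follow from the uniqueness of weak derivatives and from one mollification
  argument (\<open>weak_derivative_unique\<close>, \<open>increment_le_of_weak_derivative_le\<close>).\<close>

section \<open>Functions of class \<open>C\<^sup>n\<close>\<close>

lemma partial_eq:
  assumes "(f has_derivative f') (at x)"
  shows "partial b f x = f' b"
  using frechet_derivative_at[OF assms] by (simp add: partial_def)

lemma Ck_SucD: "Ck (Suc n) f \<Longrightarrow> Ck n f"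
proof (induction n arbitrary: f)
  case 0
  then show ?case
    by (auto intro!: continuous_at_imp_continuous_on differentiable_imp_continuous_within)
next
  case (Suc n)
  then show ?case by simp
qed

lemma Ck_le: "m \<le> n \<Longrightarrow> Ck n f \<Longrightarrow> Ck m f"
  by (induction n rule: dec_induct) (auto simp del: Ck.simps dest: Ck_SucD)

lemma Ck_continuous: "Ck n f \<Longrightarrow> continuous_on UNIV f"
  using Ck_le[of 0 n f] by simp

lemma Ck_const: "Ck n (\<lambda>x. c)"
proof (induction n arbitrary: c)
  case (Suc n)
  have "partial b (\<lambda>x::'a. c) = (\<lambda>x. 0)" for b
    by (rule ext, subst partial_eq[OF has_derivative_const]) simp
  then show ?case using Suc by simp
qed simp

lemma Ck_bounded_linear: "bounded_linear f \<Longrightarrow> Ck n f"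
proof (cases n)
  case 0
  then show "bounded_linear f \<Longrightarrow> ?thesis" by (simp add: linear_continuous_on)
next
  case (Suc m)
  assume f: "bounded_linear f"
  have "partial b f = (\<lambda>x. f b)" for b
    using partial_eq[OF bounded_linear.has_derivative[OF f has_derivative_ident]] by auto
  then show ?thesis using f Suc bounded_linear_imp_differentiable by (auto simp: Ck_const)
qed

lemma Ck_add: "Ck n f \<Longrightarrow> Ck n g \<Longrightarrow> Ck n (\<lambda>x. f x + g x)"
proof (induction n arbitrary: f g)
  case (Suc n)
  have "partial b (\<lambda>x. f x + g x) = (\<lambda>x. partial b f x + partial b g x)" for b
  proof
    fix x
    have "((\<lambda>x. f x + g x) has_derivative
      (\<lambda>h. frechet_derivative f (at x) h + frechet_derivative g (at x) h)) (at x)"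
      using Suc.prems by (intro has_derivative_add) (auto simp: frechet_derivative_works[symmetric])
    from partial_eq[OF this] show "partial b (\<lambda>x. f x + g x) x = partial b f x + partial b g x"
      by (simp add: partial_def)
  qed
  then show ?case using Suc by auto
qed (simp add: continuous_on_add)

lemma Ck_mult: "Ck n f \<Longrightarrow> Ck n g \<Longrightarrow> Ck n (\<lambda>x. f x * g x)"
proof (induction n arbitrary: f g)
  case (Suc n)
  have "partial b (\<lambda>x. f x * g x) = (\<lambda>x. f x * partial b g x + partial b f x * g x)" for b
  proof
    fix x
    have "((\<lambda>x. f x * g x) has_derivative
      (\<lambda>h. f x * frechet_derivative g (at x) h + frechet_derivative f (at x) h * g x)) (at x)"
      using Suc.prems by (intro has_derivative_mult) (auto simp: frechet_derivative_works[symmetric])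
    from partial_eq[OF this]
    show "partial b (\<lambda>x. f x * g x) x = f x * partial b g x + partial b f x * g x"
      by (simp add: partial_def)
  qed
  moreover have "Ck n f" "Ck n g" using Suc.prems by (blast dest: Ck_SucD)+
  ultimately show ?case using Suc.IH Suc.prems by (auto intro!: Ck_add differentiable_mult)
qed (simp add: continuous_on_mult)

lemma Ck_real_polynomial_function: "real_polynomial_function f \<Longrightarrow> Ck n f"
  by (induction rule: real_polynomial_function.induct)
    (blast intro: Ck_bounded_linear Ck_const, rule Ck_const, rule Ck_add, assumption+,
      rule Ck_mult, assumption+)

lemma DERIV_pos_part_power:
  "((\<lambda>u::real. max 0 u ^ (n + 2)) has_real_derivative real (n + 2) * max 0 u ^ (n + 1)) (at u)"
proof -
  consider "u > 0" | "u < 0" | "u = 0" by linarith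
  then show ?thesis
  proof cases
    case 1
    have "((\<lambda>u::real. u ^ (n + 2)) has_real_derivative real (n + 2) * u ^ (n + 1)) (at u)"
      using DERIV_pow[of "n + 2" u] by simp
    from has_field_derivative_transform_within_open[OF this, of "{0<..}"] 1
    show ?thesis by (auto simp: max_def)
  next
    case 2
    have "((\<lambda>u::real. 0) has_real_derivative 0) (at u)" by simp
    from has_field_derivative_transform_within_open[OF this, of "{..<0}"] 2
    show ?thesis by (auto simp: max_def)
  next
    case 3
    have "((\<lambda>y. (max 0 y ^ (n + 2) - max 0 0 ^ (n+2)) / (y - 0)) \<longlongrightarrow> (0::real)) (at 0)"
    proof (rule Lim_null_comparison)
      show "\<forall>\<^sub>F y in at 0. norm ((max 0 y ^ (n + 2) - max 0 0 ^ (n+2)) / (y - 0)) \<le> \<bar>y::real\<bar> ^ (n + 1)"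
      proof (intro always_eventually allI)
        fix y :: real
        show "norm ((max 0 y ^ (n + 2) - max 0 0 ^ (n + 2)) / (y - 0)) \<le> \<bar>y\<bar> ^ (n + 1)"
        proof (cases "y > 0")
          case False
          then have "norm ((max 0 y ^ (n + 2) - max 0 0 ^ (n + 2)) / (y - 0)) = 0" by simp
          then show ?thesis by (metis abs_ge_zero zero_le_power)
        next
          case True
          then have "max 0 y = y" "y ^ (n + 2) / y = y ^ (n + 1)" by simp_all
          then show ?thesis using True by simp
        qed
      qed
      have "((\<lambda>y::real. \<bar>y\<bar> ^ (n+1)) \<longlongrightarrow> \<bar>0\<bar> ^ (n+1)) (at 0)" by (intro tendsto_intros)
      then show "((\<lambda>y::real. \<bar>y\<bar> ^ (n+1)) \<longlongrightarrow> 0) (at 0)" by simp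
    qed
    then show ?thesis using 3 by (simp add: has_field_derivative_iff)
  qed
qed

lemma DERIV_pos_part_square: "((\<lambda>u::real. (max 0 u)\<^sup>2) has_real_derivative 2 * max 0 u) (at u)"
  using DERIV_pos_part_power[of 0 u] by (simp add: power2_eq_square)

lemma Ck_ball_bump: "Ck n (\<lambda>x::'a::euclidean_space. max 0 (r - x \<bullet> x) ^ Suc n)"
proof (induction n)
  case 0
  then show ?case by (auto intro!: continuous_intros)
next
  case (Suc n)
  have d: "((\<lambda>x::'a. max 0 (r - x \<bullet> x) ^ (n + 2)) has_derivative
      (\<lambda>h. real (n + 2) * max 0 (r - x \<bullet> x) ^ (n + 1) * (- 2 * (x \<bullet> h)))) (at x)" for x
    by (rule has_derivative_eq_rhs[OF has_derivative_compose[where f = "\<lambda>x. r - x \<bullet> x",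
          OF _ DERIV_pos_part_power[unfolded has_field_derivative_def]]])
      (auto intro!: derivative_eq_intros simp: inner_commute algebra_simps)
  then have "partial b (\<lambda>x::'a. max 0 (r - x \<bullet> x) ^ Suc (Suc n)) =
      (\<lambda>x. max 0 (r - x \<bullet> x) ^ Suc n * (real (n + 2) * (- 2) * (x \<bullet> b)))" for b
    using partial_eq[OF d] by (simp add: fun_eq_iff algebra_simps)
  moreover have "Ck n (\<lambda>x::'a. max 0 (r - x \<bullet> x) ^ Suc n * (real (n + 2) * (- 2) * (x \<bullet> b)))" for b
    by (intro Ck_mult Suc Ck_const Ck_bounded_linear bounded_linear_inner_left)
  ultimately show ?case using d unfolding Ck.simps
    by (auto simp: differentiable_def)
qed

text \<open>\<open>C\<^sup>1\<close> functions enter the proof through their gradient field.\<close>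

lemma Ck1_gradientI:
  assumes "\<And>x. (f has_derivative (\<lambda>h. h \<bullet> \<Gamma> x)) (at x)" "continuous_on UNIV \<Gamma>"
  shows "Ck 1 f"
proof -
  have "partial b f = (\<lambda>x. b \<bullet> \<Gamma> x)" for b
    using partial_eq[OF assms(1)] by auto
  then show ?thesis using assms by (auto simp: differentiable_def intro!: continuous_intros)
qed

lemma supp_bound: "closed C \<Longrightarrow> (\<And>x. f x \<noteq> 0 \<Longrightarrow> x \<in> C) \<Longrightarrow> supp f \<subseteq> C"
  unfolding supp_def by (rule closure_minimal) auto

lemma compactly_supportedI:
  fixes f :: "'a::t2_space \<Rightarrow> real"
  assumes "compact C" "\<And>x. f x \<noteq> 0 \<Longrightarrow> x \<in> C"
  shows "compactly_supported f"
  unfolding compactly_supported_def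
proof -
  have "supp f \<subseteq> C" using assms by (intro supp_bound compact_imp_closed)
  then have "C \<inter> supp f = supp f" by blast
  then show "compact (supp f)"
    using compact_Int_closed[OF assms(1), of "supp f"] by (simp add: supp_def)
qed

lemma supp_outside: "x \<notin> supp f \<Longrightarrow> f x = 0"
  unfolding supp_def using closure_subset[of "{x. f x \<noteq> 0}"] by blast

section \<open>Weak derivatives\<close>

lemma zero_multi_index: "(\<lambda>b. 0) \<in> multi_index" "mi_order (\<lambda>b. 0) = 0"
  by (simp_all add: multi_index_def mi_order_def)

lemma unit_multi_index:
  assumes "b \<in> Basis"
  shows "unit_index b \<in> multi_index" "mi_order (unit_index b) = 1"
  using assms by (auto simp: multi_index_def mi_order_def unit_index_def)

lemma finite_multi_index: "finite {\<alpha> \<in> multi_index. mi_order \<alpha> \<le> k}"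
proof (rule finite_subset)
  show "finite {\<alpha> :: 'a \<Rightarrow> nat. \<forall>b. (b \<in> Basis \<longrightarrow> \<alpha> b \<in> {..k}) \<and> (b \<notin> Basis \<longrightarrow> \<alpha> b = 0)}"
    by (rule finite_set_of_finite_funs) auto
  show "{\<alpha> \<in> multi_index. mi_order \<alpha> \<le> k} \<subseteq>
      {\<alpha> :: 'a \<Rightarrow> nat. \<forall>b. (b \<in> Basis \<longrightarrow> \<alpha> b \<in> {..k}) \<and> (b \<notin> Basis \<longrightarrow> \<alpha> b = 0)}"
    unfolding multi_index_def mi_order_def
    by (auto intro: order_trans[OF member_le_sum[of _ Basis]])
qed

lemma basis_list: "distinct (basis_list :: 'a::euclidean_space list)" "set basis_list = (Basis :: 'a set)"
proof -
  have "\<exists>bs. distinct bs \<and> set bs = (Basis :: 'a set)"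
    using finite_distinct_list[OF finite_Basis] by blast
  from someI_ex[OF this] show "distinct (basis_list :: 'a list)" "set basis_list = (Basis :: 'a set)"
    unfolding basis_list_def by blast+
qed

lemma iter_partial_zero: "iter_partial (\<lambda>b. 0) \<phi> = \<phi>"
proof -
  have "foldr (\<lambda>b g. (partial b ^^ 0) g) bs \<phi> = \<phi>" for bs
    by (induction bs) auto
  then show ?thesis by (simp add: iter_partial_def)
qed

lemma iter_partial_unit:
  assumes "b \<in> Basis"
  shows "iter_partial (unit_index b) \<phi> = partial b \<phi>"
proof -
  have "foldr (\<lambda>c g. (partial c ^^ unit_index b c) g) bs \<phi> = (if b \<in> set bs then partial b \<phi> else \<phi>)"
    if "distinct bs" for bs
    using that by (induction bs) (auto simp: unit_index_def)
  then show ?thesis using assms by (simp add: iter_partial_def basis_list)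
qed

lemma Ck_funpow_partial: "Ck (m + n) f \<Longrightarrow> b \<in> Basis \<Longrightarrow> Ck n ((partial b ^^ m) f)"
proof (induction m arbitrary: f)
  case (Suc m)
  then have "Ck (m + n) (partial b f)" by simp
  with Suc show ?case by (simp add: funpow_swap1)
qed simp

lemma Ck_iter_partial:
  fixes f :: "'a::euclidean_space \<Rightarrow> real"
  assumes "Ck (mi_order \<alpha>) f"
  shows "continuous_on UNIV (iter_partial \<alpha> f)"
proof -
  have "Ck n (foldr (\<lambda>b g. (partial b ^^ \<alpha> b) g) bs f)"
    if "Ck (n + sum_list (map \<alpha> bs)) f" "set bs \<subseteq> Basis" for bs n
    using that
  proof (induction bs arbitrary: n)
    case (Cons b bs)
    then have "Ck (\<alpha> b + n) (foldr (\<lambda>b g. (partial b ^^ \<alpha> b) g) bs f)"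
      using Cons.IH[of "\<alpha> b + n"] by (simp add: algebra_simps)
    then show ?case using Cons.prems by (simp add: Ck_funpow_partial)
  qed simp
  from this[of 0 "basis_list :: 'a list"] show ?thesis
    using assms basis_list[where 'a = 'a]
    by (simp add: iter_partial_def mi_order_def sum_list_distinct_conv_sum_set)
qed

lemma iter_partial_outside_supp:
  assumes "x \<notin> supp f"
  shows "iter_partial \<alpha> f x = 0"
proof -
  have partial: "\<forall>x. x \<notin> supp f \<longrightarrow> partial b g x = 0" if "\<forall>x. x \<notin> supp f \<longrightarrow> g x = 0" for b g
  proof (intro allI impI)
    fix x assume x: "x \<notin> supp f"
    have "((\<lambda>x. 0) has_derivative (\<lambda>h. 0)) (at x)" by simp
    then have "(g has_derivative (\<lambda>h. 0)) (at x)"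
      by (rule has_derivative_transform_within_open[of _ _ _ _ "- supp f"])
        (use x that in \<open>auto simp: supp_def\<close>)
    then show "partial b g x = 0" by (simp add: partial_eq)
  qed
  have pow: "\<forall>x. x \<notin> supp f \<longrightarrow> (partial b ^^ n) g x = 0" if "\<forall>x. x \<notin> supp f \<longrightarrow> g x = 0" for b g n
    using that by (induction n arbitrary: g) (simp_all add: funpow_swap1 partial)
  have "\<forall>x. x \<notin> supp f \<longrightarrow> foldr (\<lambda>b g. (partial b ^^ \<alpha> b) g) bs f x = 0" for bs
  proof (induction bs)
    case Nil
    then show ?case by (simp add: supp_outside)
  next
    case (Cons b bs)
    then show ?case using pow by simp
  qed
  then show ?thesis using assms by (simp add: iter_partial_def)
qed

lemma compactly_supported_iter_partial:
  fixes f :: "'a::euclidean_space \<Rightarrow> real"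
  shows "compactly_supported f \<Longrightarrow> compactly_supported (iter_partial \<alpha> f)"
  using compactly_supportedI[of "supp f" "iter_partial \<alpha> f"] iter_partial_outside_supp[of _ f \<alpha>]
  by (auto simp: compactly_supported_def)

lemma continuous_measurable_lebesgue:
  fixes f :: "'a::euclidean_space \<Rightarrow> 'b::euclidean_space"
  shows "continuous_on UNIV f \<Longrightarrow> f \<in> borel_measurable lebesgue"
  by (intro measurable_completion) (simp add: borel_measurable_continuous_onI)

lemma continuous_on_slice:
  assumes "continuous_on (S \<times> UNIV) (\<lambda>(t, x). f t x)" "t \<in> S"
  shows "continuous_on UNIV (f t)"
proof -
  have "(\<lambda>x. (t, x)) ` UNIV \<subseteq> S \<times> UNIV" using assms(2) by blast
  from continuous_on_compose2[OF assms(1) continuous_on_Pair[OF continuous_on_const continuous_on_id] this]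
  show ?thesis by simp
qed

lemmas continuous_on_slice_UNIV = continuous_on_slice[of UNIV, simplified]

lemma locally_integrable_continuous:
  fixes f :: "'a::euclidean_space \<Rightarrow> real"
  assumes "continuous_on UNIV f"
  shows "locally_integrable f"
  unfolding locally_integrable_def
proof (intro allI impI)
  fix C :: "'a set" assume C: "compact C"
  have "integrable lborel (\<lambda>x. indicator C x *\<^sub>R f x)"
    using borel_integrable_compact[OF C] assms continuous_on_subset by blast
  then show "set_integrable lebesgue C f"
    unfolding set_integrable_def
    by (subst integrable_completion) (auto dest: borel_measurable_integrable)
qed

lemma locally_integrable_diff:
  "locally_integrable f \<Longrightarrow> locally_integrable g \<Longrightarrow> locally_integrable (\<lambda>x. f x - g x)"
  by (auto simp: locally_integrable_def)

lemma locally_integrable_measurable: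
  fixes f :: "'a::euclidean_space \<Rightarrow> real"
  assumes "locally_integrable f"
  shows "f \<in> borel_measurable lebesgue"
proof (rule borel_measurable_LIMSEQ_real)
  show "(\<lambda>x. indicator (cball 0 (real n)) x * f x) \<in> borel_measurable lebesgue" for n
    using assms compact_cball[of 0 "real n"]
    unfolding locally_integrable_def set_integrable_def real_scaleR_def by blast
  show "(\<lambda>n. indicator (cball 0 (real n)) x * f x) \<longlonglongrightarrow> f x" for x
  proof (rule tendsto_eventually)
    obtain N where "norm x \<le> real N" using real_arch_simple by blast
    then show "\<forall>\<^sub>F n in sequentially. indicator (cball 0 (real n)) x * f x = f x"
      unfolding eventually_sequentially by (intro exI[of _ N]) (auto simp: indicator_def)
  qed
qed

lemma locally_integrable_mult:
  fixes f \<phi> :: "'a::euclidean_space \<Rightarrow> real"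
  assumes f: "locally_integrable f" and \<phi>: "continuous_on UNIV \<phi>" "compactly_supported \<phi>"
  shows "integrable lebesgue (\<lambda>x. f x * \<phi> x)"
proof -
  have C: "compact (supp \<phi>)" using \<phi> by (simp add: compactly_supported_def)
  then have "compact (\<phi> ` supp \<phi>)" using \<phi> continuous_on_subset by (blast intro: compact_continuous_image)
  then obtain B where B: "\<And>x. x \<in> supp \<phi> \<Longrightarrow> \<bar>\<phi> x\<bar> \<le> B"
    using compact_imp_bounded bounded_iff by (metis imageI real_norm_def)
  have "integrable lebesgue (\<lambda>x. B * (indicator (supp \<phi>) x *\<^sub>R f x))"
    using f C unfolding locally_integrable_def set_integrable_def by simp
  then show ?thesis
  proof (rule Bochner_Integration.integrable_bound)
    show "(\<lambda>x. f x * \<phi> x) \<in> borel_measurable lebesgue"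
      using locally_integrable_measurable[OF f] continuous_measurable_lebesgue[OF \<phi>(1)] by simp
    show "AE x in lebesgue. norm (f x * \<phi> x) \<le> norm (B * (indicator (supp \<phi>) x *\<^sub>R f x))"
    proof (rule AE_I2)
      fix x
      show "norm (f x * \<phi> x) \<le> norm (B * (indicator (supp \<phi>) x *\<^sub>R f x))"
      proof (cases "x \<in> supp \<phi>")
        case True
        then have "\<bar>\<phi> x\<bar> \<le> \<bar>B\<bar>" using B[of x] by linarith
        then show ?thesis using True
          by (simp add: abs_mult mult.commute mult_right_mono)
      qed (simp add: supp_outside)
    qed
  qed
qed

text \<open>The fundamental lemma of the calculus of variations is needed with test functions of class
  \<open>C\<^sup>n\<close> for every \<open>n\<close>: the norms of \<open>W\<^bsup>k,\<infinity>\<^esup>\<close> involve chosen weak derivatives of all orders up to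
  \<open>k\<close>, and the uniqueness that makes such a choice harmless is tested with \<open>C\<^sup>n\<close> functions
  only. A polynomial multiplied by a power of \<open>(r - \<bar>x\<bar>\<^sup>2)\<^sup>+\<close> is of class \<open>C\<^sup>n\<close>, and by the theorem
  of Stone and Weierstrass such products approximate every continuous function with compact
  support.\<close>

lemma integral_zero_against_continuous:
  fixes h :: "'a::euclidean_space \<Rightarrow> real"
  assumes h: "locally_integrable h"
    and zero: "\<And>\<phi>. Ck n \<phi> \<Longrightarrow> compactly_supported \<phi> \<Longrightarrow> (LINT x|lebesgue. h x * \<phi> x) = 0"
    and \<phi>: "continuous_on UNIV \<phi>" "compactly_supported \<phi>"
  shows "(LINT x|lebesgue. h x * \<phi> x) = 0"
proof -
  obtain r where r: "r > 0" "\<And>x. x \<in> supp \<phi> \<Longrightarrow> norm x \<le> r"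
    using compact_imp_bounded[of "supp \<phi>"] \<phi>(2) unfolding compactly_supported_def bounded_pos
    by blast
  define R2 where "R2 = (r + 1)\<^sup>2"
  define B where "B = (\<lambda>x::'a. max 0 (R2 - x \<bullet> x) ^ Suc n)"
  define \<delta> where "\<delta> = (R2 - r\<^sup>2) ^ Suc n"
  have "r\<^sup>2 < R2" using r by (simp add: R2_def power2_eq_square algebra_simps)
  then have \<delta>: "\<delta> > 0" by (simp add: \<delta>_def)
  have CkB: "Ck n B" unfolding B_def by (rule Ck_ball_bump)
  have contB: "continuous_on UNIV B" by (rule Ck_continuous[OF CkB])
  have B_ge: "\<delta> \<le> B x" if "x \<in> supp \<phi>" for x
  proof -
    have "x \<bullet> x \<le> r\<^sup>2"
      using r(2)[OF that] r(1) by (simp add: dot_square_norm power_mono)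
    then have "R2 - r\<^sup>2 \<le> max 0 (R2 - x \<bullet> x)" by simp
    then show ?thesis unfolding B_def \<delta>_def using \<open>r\<^sup>2 < R2\<close> by (intro power_mono) auto
  qed
  have B0: "B x = 0" if "x \<notin> cball 0 (r + 1)" for x
  proof -
    have "(r + 1)\<^sup>2 \<le> (norm x)\<^sup>2" using that r(1) by (intro power_mono) auto
    then have "R2 \<le> x \<bullet> x" by (simp add: R2_def dot_square_norm)
    then show ?thesis by (simp add: B_def)
  qed
  have B_nonneg: "0 \<le> B x" for x by (simp add: B_def)
  have B_le: "B x \<le> R2 ^ Suc n" for x
    unfolding B_def by (intro power_mono) (auto simp: R2_def)
  \<comment> \<open>The denominator is bounded away from zero, and it equals \<open>B\<close> on the support of \<open>\<phi>\<close>, so that \<open>\<phi> = \<psi> * B\<close>.\<close>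
  define \<psi> where "\<psi> = (\<lambda>x. \<phi> x / max (B x) \<delta>)"
  have cont\<psi>: "continuous_on UNIV \<psi>" unfolding \<psi>_def
    using \<delta> by (intro continuous_intros \<phi> contB) (auto simp: max_def)
  have \<phi>_eq: "\<phi> x = \<psi> x * B x" for x
    using B_ge[of x] \<delta> supp_outside[of x \<phi>] by (cases "x \<in> supp \<phi>") (auto simp: \<psi>_def max_def)
  define Q where "Q = (LINT x|lebesgue. \<bar>indicator (cball 0 (r + 1)) x * h x\<bar>)"
  have intQ: "integrable lebesgue (\<lambda>x. indicator (cball 0 (r + 1)) x * h x)"
    using h compact_cball[of "0::'a" "r + 1"]
    unfolding locally_integrable_def set_integrable_def real_scaleR_def by blast
  have Q: "Q \<ge> 0" unfolding Q_def by simp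
  have bound: "\<bar>LINT x|lebesgue. h x * \<phi> x\<bar> \<le> e * (R2 ^ Suc n * Q)" if e: "e > 0" for e
  proof -
    obtain p where p: "real_polynomial_function p" "\<And>x. x \<in> cball 0 (r + 1) \<Longrightarrow> \<bar>\<psi> x - p x\<bar> < e"
      using Stone_Weierstrass_real_polynomial_function[OF compact_cball _ e] cont\<psi>
        continuous_on_subset by (metis subset_UNIV)
    have Ckp: "Ck n (\<lambda>x. p x * B x)" by (intro Ck_mult Ck_real_polynomial_function p CkB)
    have csp: "compactly_supported (\<lambda>x. p x * B x)"
      by (rule compactly_supportedI[OF compact_cball[of 0 "r + 1"]]) (use B0 in force)
    have i1: "integrable lebesgue (\<lambda>x. h x * \<phi> x)" by (rule locally_integrable_mult[OF h \<phi>])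
    have i2: "integrable lebesgue (\<lambda>x. h x * (p x * B x))"
      by (rule locally_integrable_mult[OF h Ck_continuous[OF Ckp] csp])
    have "(LINT x|lebesgue. h x * \<phi> x) = (LINT x|lebesgue. h x * \<phi> x - h x * (p x * B x))"
      using i1 i2 zero[OF Ckp csp] by simp
    also have "\<bar>\<dots>\<bar> \<le> (LINT x|lebesgue. \<bar>h x * \<phi> x - h x * (p x * B x)\<bar>)"
      by (rule integral_abs_bound)
    also have "\<dots> \<le> (LINT x|lebesgue. e * R2 ^ Suc n * \<bar>indicator (cball 0 (r + 1)) x * h x\<bar>)"
    proof (rule integral_mono)
      show "integrable lebesgue (\<lambda>x. \<bar>h x * \<phi> x - h x * (p x * B x)\<bar>)" using i1 i2 by simp
      show "integrable lebesgue (\<lambda>x. e * R2 ^ Suc n * \<bar>indicator (cball 0 (r + 1)) x * h x\<bar>)"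
        using intQ by simp
      fix x
      have eq: "\<bar>h x * \<phi> x - h x * (p x * B x)\<bar> = \<bar>h x\<bar> * (\<bar>\<psi> x - p x\<bar> * B x)"
        unfolding \<phi>_eq using B_nonneg[of x]
        by (simp add: abs_mult[symmetric] algebra_simps)
          (metis B_nonneg abs_mult abs_of_nonneg mult.commute right_diff_distrib)
      show "\<bar>h x * \<phi> x - h x * (p x * B x)\<bar> \<le> e * R2 ^ Suc n * \<bar>indicator (cball 0 (r + 1)) x * h x\<bar>"
      proof (cases "x \<in> cball 0 (r + 1)")
        case True
        have "\<bar>\<psi> x - p x\<bar> * B x \<le> e * R2 ^ Suc n"
          using p(2)[OF True] B_le[of x] B_nonneg[of x] e by (intro mult_mono) auto
        from mult_left_mono[OF this, of "\<bar>h x\<bar>"] show ?thesis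
          unfolding eq using True by (simp add: mult.commute)
      next
        case False
        then show ?thesis unfolding eq using B0[OF False] by simp
      qed
    qed
    also have "\<dots> = e * (R2 ^ Suc n * Q)" by (simp add: Q_def)
    finally show ?thesis .
  qed
  have "R2 ^ Suc n * Q \<ge> 0" using Q by (simp add: R2_def)
  then have "\<bar>LINT x|lebesgue. h x * \<phi> x\<bar> \<le> 0 + e" if "e > 0" for e
  proof -
    define c where "c = R2 ^ Suc n * Q"
    have c: "c \<ge> 0" using \<open>R2 ^ Suc n * Q \<ge> 0\<close> by (simp add: c_def)
    have "\<bar>LINT x|lebesgue. h x * \<phi> x\<bar> \<le> e / (c + 1) * c"
      using bound[of "e / (c + 1)"] that c by (simp add: c_def del: power_Suc)
    also have "\<dots> \<le> e" using that c by (simp add: divide_simps)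
    finally show ?thesis by simp
  qed
  then have "\<bar>LINT x|lebesgue. h x * \<phi> x\<bar> \<le> 0" by (rule field_le_epsilon)
  then show ?thesis by simp
qed

text \<open>The indicator function of a compact set is the decreasing limit of continuous functions of the distance
  to the set, all supported in a common compact neighbourhood.\<close>

lemma integral_zero_on_compact:
  fixes h :: "'a::euclidean_space \<Rightarrow> real"
  assumes h: "locally_integrable h"
    and zero: "\<And>\<phi>. continuous_on UNIV \<phi> \<Longrightarrow> compactly_supported \<phi> \<Longrightarrow> (LINT x|lebesgue. h x * \<phi> x) = 0"
    and C: "compact C"
  shows "(LINT x|lebesgue. indicator C x * h x) = 0"
proof (cases "C = {}")
  case False
  define D where "D = {x. infdist x C \<le> 1}"
  define \<phi> where "\<phi> = (\<lambda>j x. max 0 (1 - real (Suc j) * infdist x C))"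
  have D: "compact D" unfolding D_def using compact_infdist_le[OF False C] by simp
  have cont: "continuous_on UNIV (\<phi> j)" for j
    unfolding \<phi>_def by (intro continuous_intros)
  have outside: "\<phi> j x = 0" if "x \<notin> D" for j x
  proof -
    have "1 * infdist x C \<le> real (Suc j) * infdist x C"
      by (intro mult_right_mono infdist_nonneg) auto
    moreover have "1 < infdist x C" using that by (simp add: D_def)
    ultimately have "1 - real (Suc j) * infdist x C \<le> 0" by linarith
    then show ?thesis unfolding \<phi>_def by (rule max_absorb1)
  qed
  have range: "0 \<le> \<phi> j x" "\<phi> j x \<le> 1" for j x
    using infdist_nonneg[of x C] by (simp_all add: \<phi>_def)
  have "(\<lambda>j. LINT x|lebesgue. h x * \<phi> j x) \<longlonglongrightarrow> (LINT x|lebesgue. indicator C x * h x)"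
  proof (rule integral_dominated_convergence[where w = "\<lambda>x. \<bar>indicator D x * h x\<bar>"])
    show "(\<lambda>x. indicator C x * h x) \<in> borel_measurable lebesgue"
      using h C borel_measurable_integrable
      unfolding locally_integrable_def set_integrable_def real_scaleR_def by blast
    show "(\<lambda>x. h x * \<phi> j x) \<in> borel_measurable lebesgue" for j
      using locally_integrable_measurable[OF h] continuous_measurable_lebesgue[OF cont] by simp
    show "integrable lebesgue (\<lambda>x. \<bar>indicator D x * h x\<bar>)"
      using h D unfolding locally_integrable_def set_integrable_def real_scaleR_def by simp
    show "AE x in lebesgue. norm (h x * \<phi> j x) \<le> \<bar>indicator D x * h x\<bar>" for j
    proof (rule AE_I2)
      fix x
      show "norm (h x * \<phi> j x) \<le> \<bar>indicator D x * h x\<bar>"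
        using range[of j x] outside[of x j]
        by (cases "x \<in> D") (simp_all add: abs_mult mult_left_le)
    qed
    show "AE x in lebesgue. (\<lambda>j. h x * \<phi> j x) \<longlonglongrightarrow> indicator C x * h x"
    proof (rule AE_I2)
      fix x
      show "(\<lambda>j. h x * \<phi> j x) \<longlonglongrightarrow> indicator C x * h x"
      proof (cases "x \<in> C")
        case True
        then show ?thesis by (simp add: \<phi>_def)
      next
        case False
        then have pos: "infdist x C > 0"
          using C \<open>C \<noteq> {}\<close> by (simp add: infdist_pos_not_in_closed compact_imp_closed)
        then obtain N where N: "1 < real N * infdist x C"
          using reals_Archimedean3 by metis
        have "\<phi> j x = 0" if "j \<ge> N" for j
        proof -
          have "real N * infdist x C \<le> real (Suc j) * infdist x C"
            using that pos by (intro mult_right_mono) auto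
          then have "1 - real (Suc j) * infdist x C \<le> 0" using N by linarith
          then show ?thesis unfolding \<phi>_def by (rule max_absorb1)
        qed
        then have "\<forall>\<^sub>F j in sequentially. h x * \<phi> j x = indicator C x * h x"
          using False unfolding eventually_sequentially by auto
        then show ?thesis by (rule tendsto_eventually)
      qed
    qed
  qed
  moreover have "(LINT x|lebesgue. h x * \<phi> j x) = 0" for j
    by (intro zero cont compactly_supportedI[OF D]) (use outside in blast)
  ultimately show ?thesis by (simp add: LIMSEQ_const_iff)
qed simp

text \<open>By inner regularity the part of each ball where \<open>h\<close> is positive is exhausted, up to arbitrarily small measure, by
  compact sets, each of which is null since \<open>h\<close> is positive on it and has integral zero over it.\<close>

lemma AE_nonpos_of_integral_zero_on_compact:
  fixes h :: "'a::euclidean_space \<Rightarrow> real"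
  assumes h: "locally_integrable h"
    and zero: "\<And>C. compact C \<Longrightarrow> (LINT x|lebesgue. indicator C x * h x) = 0"
  shows "AE x in lebesgue. h x \<le> 0"
proof -
  have null: "{x \<in> cball 0 r. 0 < h x} \<in> null_sets lebesgue" for r
  proof -
    define E where "E = {x \<in> cball 0 r. 0 < h x}"
    have E: "E \<in> sets lebesgue"
    proof -
      have "{x \<in> space lebesgue. 0 < h x} \<in> sets lebesgue"
        using locally_integrable_measurable[OF h] by measurable
      moreover have "E = cball 0 r \<inter> {x \<in> space lebesgue. 0 < h x}" by (auto simp: E_def)
      ultimately show ?thesis by (simp add: sets.Int)
    qed
    have small: "emeasure lebesgue E < ennreal e" if e: "e > 0" for e
    proof -
      obtain T where T: "closed T" "T \<subseteq> E" "E - T \<in> lmeasurable" "emeasure lebesgue (E - T) < ennreal e"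
        using sets_lebesgue_inner_closed[OF E e] by metis
      have "compact (cball 0 r \<inter> T)" by (intro compact_Int_closed compact_cball T)
      moreover have "cball 0 r \<inter> T = T" using T(2) by (auto simp: E_def)
      ultimately have cT: "compact T" by simp
      have int: "integrable lebesgue (\<lambda>x. indicator T x * h x)"
        using h cT unfolding locally_integrable_def set_integrable_def real_scaleR_def by blast
      have "AE x in lebesgue. 0 \<le> indicator T x * h x"
        using T(2) by (intro AE_I2) (auto simp: E_def indicator_def)
      then have "AE x in lebesgue. indicator T x * h x = 0"
        using zero[OF cT] integral_nonneg_eq_0_iff_AE[OF int] by blast
      then have "AE x in lebesgue. x \<notin> T"
        by eventually_elim (use T(2) in \<open>auto simp: E_def indicator_def\<close>)
      then have "emeasure lebesgue E = emeasure lebesgue (E - T)"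
        using E T(3) by (intro emeasure_eq_AE) (auto elim: eventually_mono)
      then show ?thesis using T(4) by simp
    qed
    have "emeasure lebesgue E = 0"
    proof (rule ccontr)
      assume "emeasure lebesgue E \<noteq> 0"
      moreover have "emeasure lebesgue E < \<infinity>" using small[of 1] by (simp add: less_top order_less_trans)
      ultimately have "0 < enn2real (emeasure lebesgue E)"
        by (simp add: enn2real_positive_iff less_top zero_less_iff_neq_zero)
      from small[OF this] show False using \<open>emeasure lebesgue E < \<infinity>\<close> by (simp add: less_top)
    qed
    then show ?thesis using E by (simp add: E_def null_sets_def)
  qed
  have "AE x in lebesgue. \<forall>n::nat. x \<notin> {x \<in> cball 0 (real n). 0 < h x}"
    unfolding AE_all_countable using null by (blast intro: AE_not_in)
  then show ?thesis
  proof eventually_elim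
    case (elim x)
    obtain n where "norm x \<le> real n" using real_arch_simple by blast
    then show ?case using elim by (auto simp: not_less)
  qed
qed

lemma fundamental_lemma:
  fixes h :: "'a::euclidean_space \<Rightarrow> real"
  assumes h: "locally_integrable h"
    and zero: "\<And>\<phi>. Ck n \<phi> \<Longrightarrow> compactly_supported \<phi> \<Longrightarrow> (LINT x|lebesgue. h x * \<phi> x) = 0"
  shows "AE x in lebesgue. h x = 0"
proof -
  have z: "(LINT x|lebesgue. indicator C x * h x) = 0" if "compact C" for C
    by (rule integral_zero_on_compact[OF h integral_zero_against_continuous[OF h zero] that])
  have h': "locally_integrable (\<lambda>x. - h x)"
    using h by (simp add: locally_integrable_def set_integrable_def)
  have "AE x in lebesgue. h x \<le> 0"
    by (rule AE_nonpos_of_integral_zero_on_compact[OF h]) (use z in blast)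
  moreover have "AE x in lebesgue. - h x \<le> 0"
    by (rule AE_nonpos_of_integral_zero_on_compact[OF h']) (use z in simp)
  ultimately show ?thesis by eventually_elim simp
qed

lemma weak_derivative_unique:
  assumes g: "weak_derivative \<alpha> f g" and g': "weak_derivative \<alpha> f g'"
  shows "AE x in lebesgue. g x = g' x"
proof -
  have li: "locally_integrable g" "locally_integrable g'"
    using g g' by (auto simp: weak_derivative_def)
  have "AE x in lebesgue. g x - g' x = 0"
  proof (rule fundamental_lemma[OF locally_integrable_diff[OF li]])
    fix \<phi> :: "'a \<Rightarrow> real" assume \<phi>: "Ck (mi_order \<alpha>) \<phi>" "compactly_supported \<phi>"
    have "(- 1) ^ mi_order \<alpha> * (LINT x|lebesgue. g x * \<phi> x) =
        (- 1) ^ mi_order \<alpha> * (LINT x|lebesgue. g' x * \<phi> x)"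
    proof -
      have "(LINT x|lebesgue. f x * iter_partial \<alpha> \<phi> x) =
          (- 1) ^ mi_order \<alpha> * (LINT x|lebesgue. g x * \<phi> x)"
        using g \<phi> unfolding weak_derivative_def by blast
      moreover have "(LINT x|lebesgue. f x * iter_partial \<alpha> \<phi> x) =
          (- 1) ^ mi_order \<alpha> * (LINT x|lebesgue. g' x * \<phi> x)"
        using g' \<phi> unfolding weak_derivative_def by blast
      ultimately show ?thesis by (rule trans[OF sym])
    qed
    then have "(LINT x|lebesgue. g x * \<phi> x) = (LINT x|lebesgue. g' x * \<phi> x)" by simp
    then show "(LINT x|lebesgue. (g x - g' x) * \<phi> x) = 0"
      using locally_integrable_mult[OF li(1) Ck_continuous[OF \<phi>(1)] \<phi>(2)]
        locally_integrable_mult[OF li(2) Ck_continuous[OF \<phi>(1)] \<phi>(2)]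
      by (simp add: left_diff_distrib)
  qed
  then show ?thesis by simp
qed

lemma weak_derivative_diff:
  assumes f: "weak_derivative \<alpha> f1 g1" "weak_derivative \<alpha> f2 g2"
  shows "weak_derivative \<alpha> (\<lambda>x. f1 x - f2 x) (\<lambda>x. g1 x - g2 x)"
  unfolding weak_derivative_def
proof (intro conjI allI impI)
  note li = f[unfolded weak_derivative_def]
  show "locally_integrable (\<lambda>x. f1 x - f2 x)" "locally_integrable (\<lambda>x. g1 x - g2 x)"
    using li by (auto intro: locally_integrable_diff)
  fix \<phi> :: "'a \<Rightarrow> real" assume \<phi>: "Ck (mi_order \<alpha>) \<phi> \<and> compactly_supported \<phi>"
  have i: "integrable lebesgue (\<lambda>x. f x * iter_partial \<alpha> \<phi> x)" if "locally_integrable f" for f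
    using \<phi> that by (intro locally_integrable_mult Ck_iter_partial compactly_supported_iter_partial) auto
  have j: "integrable lebesgue (\<lambda>x. f x * \<phi> x)" if "locally_integrable f" for f
    using \<phi> that by (intro locally_integrable_mult) (auto dest: Ck_continuous)
  show "(LINT x|lebesgue. (f1 x - f2 x) * iter_partial \<alpha> \<phi> x) =
      (- 1) ^ mi_order \<alpha> * (LINT x|lebesgue. (g1 x - g2 x) * \<phi> x)"
    using li \<phi> i[of f1] i[of f2] j[of g1] j[of g2] by (simp add: left_diff_distrib right_diff_distrib)
qed

lemma wderiv_AE: "weak_derivative \<alpha> f g \<Longrightarrow> AE x in lebesgue. wderiv \<alpha> f x = g x"
  unfolding wderiv_def using weak_derivative_unique someI[of "weak_derivative \<alpha> f"] by metis

lemma weak_derivative_wderiv: "weak_derivative \<alpha> f g \<Longrightarrow> weak_derivative \<alpha> f (wderiv \<alpha> f)"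
  unfolding wderiv_def by (rule someI[of "weak_derivative \<alpha> f"])

lemma weak_derivative_zero: "locally_integrable f \<Longrightarrow> weak_derivative (\<lambda>b. 0) f f"
  by (simp add: weak_derivative_def zero_multi_index iter_partial_zero)

lemma wderiv_zero: "locally_integrable f \<Longrightarrow> AE x in lebesgue. wderiv (\<lambda>b. 0) f x = f x"
  by (rule wderiv_AE[OF weak_derivative_zero])

text \<open>A null set has empty interior, so bounds that hold almost everywhere hold everywhere for continuous
  functions. This is how the essential suprema in the Sobolev norms turn into pointwise bounds.\<close>

lemma AE_le_continuous:
  fixes f :: "'a::euclidean_space \<Rightarrow> real"
  assumes "AE x in lebesgue. f x \<le> B" "continuous_on UNIV f"
  shows "f x \<le> B"
proof (rule ccontr)
  assume x: "\<not> f x \<le> B"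
  have "open {x. B < f x}" by (intro open_Collect_less continuous_intros assms)
  moreover have "{x. B < f x} \<in> null_sets lebesgue"
  proof -
    have "{x \<in> space lebesgue. \<not> f x \<le> B} \<in> null_sets lebesgue"
    proof (subst AE_iff_null[symmetric])
      show "{x \<in> space lebesgue. \<not> f x \<le> B} \<in> sets lebesgue"
        using continuous_measurable_lebesgue[OF assms(2)] by measurable
    qed (rule assms(1))
    then show ?thesis by (simp add: not_le)
  qed
  ultimately have "{x. B < f x} = {}"
    using open_not_negligible negligible_iff_null_sets by blast
  moreover have "x \<in> {x. B < f x}" using x by simp
  ultimately show False by simp
qed

lemma AE_abs_le_continuous:
  fixes f :: "'a::euclidean_space \<Rightarrow> real"
  assumes "AE x in lebesgue. \<bar>f x\<bar> \<le> B" "continuous_on UNIV f"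
  shows "\<bar>f x\<bar> \<le> B"
  by (rule AE_le_continuous[OF assms(1)]) (intro continuous_intros assms)

lemma norm_Linf_on_nonneg:
  assumes "0 \<le> B" "AE x in lebesgue. x \<in> S \<longrightarrow> \<bar>f x\<bar> \<le> B"
  shows "0 \<le> norm_Linf_on S f"
  unfolding norm_Linf_on_def by (rule cInf_greatest) (use assms in auto)

lemma norm_Linf_on_lessD:
  assumes "0 \<le> B" "AE x in lebesgue. x \<in> S \<longrightarrow> \<bar>f x\<bar> \<le> B" "norm_Linf_on S f < e"
  shows "AE x in lebesgue. x \<in> S \<longrightarrow> \<bar>f x\<bar> < e"
proof -
  have "{B. 0 \<le> B \<and> (AE x in lebesgue. x \<in> S \<longrightarrow> \<bar>f x\<bar> \<le> B)} \<noteq> {}" using assms by auto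
  from cInf_lessD[OF this, of e] obtain B' where "B' < e" "AE x in lebesgue. x \<in> S \<longrightarrow> \<bar>f x\<bar> \<le> B'"
    using assms(3) unfolding norm_Linf_on_def by blast
  from this(2) show ?thesis by eventually_elim (use \<open>B' < e\<close> in auto)
qed

lemma in_Wkinf_on_D:
  assumes "in_Wkinf_on S k f"
  shows "locally_integrable f" "\<exists>B. AE x in lebesgue. x \<in> S \<longrightarrow> \<bar>f x\<bar> \<le> B"
proof -
  obtain g B where g: "weak_derivative (\<lambda>b. 0) f g" "AE x in lebesgue. x \<in> S \<longrightarrow> \<bar>g x\<bar> \<le> B"
    using assms zero_multi_index unfolding in_Wkinf_on_def by (metis le0)
  then show li: "locally_integrable f" by (simp add: weak_derivative_def)
  have "AE x in lebesgue. f x = g x"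
    by (rule weak_derivative_unique[OF weak_derivative_zero[OF li] g(1)])
  with g(2) have "AE x in lebesgue. x \<in> S \<longrightarrow> \<bar>f x\<bar> \<le> B" by eventually_elim simp
  then show "\<exists>B. AE x in lebesgue. x \<in> S \<longrightarrow> \<bar>f x\<bar> \<le> B" by blast
qed

text \<open>Every summand of the \<open>W\<^bsup>k,\<infinity>\<^esup>\<close> norm of a difference is nonnegative because the difference has
  essentially bounded weak derivatives and the chosen ones agree with them almost everywhere. Hence
  the norm dominates the essential supremum of the difference itself.\<close>

lemma norm_Wkinf_on_diff_lessD:
  fixes u1 u2 :: "'a::euclidean_space \<Rightarrow> real"
  assumes u: "in_Wkinf_on S k u1" "in_Wkinf_on S k u2"
    and less: "norm_Wkinf_on S k (\<lambda>y. u1 y - u2 y) < e"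
  shows "AE y in lebesgue. y \<in> S \<longrightarrow> \<bar>u1 y - u2 y\<bar> < e"
proof -
  let ?f = "\<lambda>y. u1 y - u2 y"
  let ?A = "{\<alpha> :: 'a \<Rightarrow> nat. \<alpha> \<in> multi_index \<and> mi_order \<alpha> \<le> k}"
  have bdd: "\<exists>B\<ge>0. AE x in lebesgue. x \<in> S \<longrightarrow> \<bar>wderiv \<alpha> ?f x\<bar> \<le> B" if "\<alpha> \<in> ?A" for \<alpha>
  proof -
    obtain g1 B1 where 1: "weak_derivative \<alpha> u1 g1" "AE x in lebesgue. x \<in> S \<longrightarrow> \<bar>g1 x\<bar> \<le> B1"
      using u(1) \<open>\<alpha> \<in> ?A\<close> unfolding in_Wkinf_on_def by blast
    obtain g2 B2 where 2: "weak_derivative \<alpha> u2 g2" "AE x in lebesgue. x \<in> S \<longrightarrow> \<bar>g2 x\<bar> \<le> B2"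
      using u(2) \<open>\<alpha> \<in> ?A\<close> unfolding in_Wkinf_on_def by blast
    have "AE x in lebesgue. wderiv \<alpha> ?f x = g1 x - g2 x"
      by (rule wderiv_AE[OF weak_derivative_diff[OF 1(1) 2(1)]])
    with 1(2) 2(2) have "AE x in lebesgue. x \<in> S \<longrightarrow> \<bar>wderiv \<alpha> ?f x\<bar> \<le> \<bar>B1\<bar> + \<bar>B2\<bar>"
      by eventually_elim auto
    then show ?thesis by (intro exI[of _ "\<bar>B1\<bar> + \<bar>B2\<bar>"]) auto
  qed
  have zero: "(\<lambda>b. 0) \<in> ?A" by (simp add: zero_multi_index)
  have "norm_Linf_on S (wderiv (\<lambda>b. 0) ?f) \<le> norm_Wkinf_on S k ?f"
    unfolding norm_Wkinf_on_def
    by (rule member_le_sum[OF zero]) (use bdd norm_Linf_on_nonneg finite_multi_index in \<open>blast+\<close>)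
  with less have "norm_Linf_on S (wderiv (\<lambda>b. 0) ?f) < e" by simp
  with bdd[OF zero] have "AE x in lebesgue. x \<in> S \<longrightarrow> \<bar>wderiv (\<lambda>b. 0) ?f x\<bar> < e"
    using norm_Linf_on_lessD by blast
  moreover have "AE x in lebesgue. wderiv (\<lambda>b. 0) ?f x = ?f x"
    using u by (intro wderiv_zero locally_integrable_diff in_Wkinf_on_D(1))
  ultimately show ?thesis by eventually_elim simp
qed

lemma continuous_into_Wkinf_uniform:
  fixes u :: "'b::topological_space \<Rightarrow> 'a::euclidean_space \<Rightarrow> real"
  assumes u: "continuous_into_Wkinf k u" and cont: "\<And>z. continuous_on UNIV (u z)" and "e > 0"
  shows "\<forall>\<^sub>F z in nhds z0. \<forall>y. \<bar>u z y - u z0 y\<bar> \<le> e"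
proof -
  have "((\<lambda>z. norm_Wkinf_on UNIV k (\<lambda>y. u z y - u z0 y)) \<longlongrightarrow> 0) (at z0)"
    and W: "\<And>z. in_Wkinf_on UNIV k (u z)"
    using u unfolding continuous_into_Wkinf_def continuous_into_Wkinf_on_def by auto
  from order_tendstoD(2)[OF this(1) \<open>e > 0\<close>]
  have "\<forall>\<^sub>F z in at z0. \<forall>y. \<bar>u z y - u z0 y\<bar> \<le> e"
  proof eventually_elim
    case (elim z)
    have "AE y in lebesgue. \<bar>u z y - u z0 y\<bar> \<le> e"
      using norm_Wkinf_on_diff_lessD[OF W W elim] by (auto elim: eventually_mono)
    from AE_abs_le_continuous[OF this] show ?case by (auto intro!: continuous_intros cont)
  qed
  then show ?thesis
    using \<open>e > 0\<close> by (simp add: eventually_at_filter eventually_nhds_x_imp_x del: eventually_nhds)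
      (auto elim: eventually_mono)
qed

lemma in_Wkinf_continuous_bounded:
  fixes f :: "'a::euclidean_space \<Rightarrow> real"
  assumes "in_Wkinf_on UNIV k f" "continuous_on UNIV f"
  shows "\<exists>B. \<forall>x. \<bar>f x\<bar> \<le> B"
proof -
  obtain B where "AE x in lebesgue. \<bar>f x\<bar> \<le> B" using in_Wkinf_on_D(2)[OF assms(1)] by auto
  from AE_abs_le_continuous[OF this assms(2)] show ?thesis by blast
qed

lemma continuous_into_Wkinf_joint:
  fixes u :: "'b::metric_space \<Rightarrow> 'a::euclidean_space \<Rightarrow> real"
  assumes u: "continuous_into_Wkinf k u" and cont: "\<And>z. continuous_on UNIV (u z)"
  shows "continuous_on UNIV (\<lambda>(y, z). u z y)"
proof -
  have "isCont (\<lambda>(y, z). u z y) (y0, z0)" for y0 z0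
    unfolding isCont_def
  proof (rule tendstoI)
    fix e :: real assume e: "e > 0"
    have "\<forall>\<^sub>F z in nhds z0. \<forall>y. \<bar>u z y - u z0 y\<bar> \<le> e / 3"
      using e by (intro continuous_into_Wkinf_uniform[OF u cont]) simp
    moreover have "\<forall>\<^sub>F y in nhds y0. dist (u z0 y) (u z0 y0) < e / 3"
      using cont[of z0] e
      by (intro tendstoD)
        (simp_all add: continuous_on_eq_continuous_at isCont_def tendsto_at_iff_tendsto_nhds)
    ultimately have "\<forall>\<^sub>F p in nhds y0 \<times>\<^sub>F nhds z0. dist (u (snd p) (fst p)) (u z0 y0) < e"
    proof -
      assume a: "\<forall>\<^sub>F z in nhds z0. \<forall>y. \<bar>u z y - u z0 y\<bar> \<le> e / 3"
        and b: "\<forall>\<^sub>F y in nhds y0. dist (u z0 y) (u z0 y0) < e / 3"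
      show ?thesis unfolding eventually_prod_filter
      proof (intro exI conjI allI impI)
        show "\<forall>\<^sub>F y in nhds y0. dist (u z0 y) (u z0 y0) < e / 3" by (rule b)
        show "\<forall>\<^sub>F z in nhds z0. \<forall>y. \<bar>u z y - u z0 y\<bar> \<le> e / 3" by (rule a)
        fix y z assume "dist (u z0 y) (u z0 y0) < e / 3" "\<forall>y. \<bar>u z y - u z0 y\<bar> \<le> e / 3"
        then have "dist (u z0 y) (u z0 y0) < e / 3" "\<bar>u z y - u z0 y\<bar> \<le> e / 3" by auto
        then show "dist (u (snd (y, z)) (fst (y, z))) (u z0 y0) < e"
          using e unfolding dist_real_def fst_conv snd_conv by linarith
      qed
    qed
    then show "\<forall>\<^sub>F p in at (y0, z0). dist (case p of (y, z) \<Rightarrow> u z y) (case (y0, z0) of (y, z) \<Rightarrow> u z y) < e"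
      by (simp add: eventually_at_filter nhds_prod[symmetric] case_prod_unfold)
        (auto elim: eventually_mono)
  qed
  then show ?thesis by (auto simp: continuous_on_eq_continuous_at)
qed

lemma in_Wk1_D:
  assumes "in_Wk1 k f"
  shows "integrable lebesgue f" "locally_integrable f"
proof -
  obtain g where g: "weak_derivative (\<lambda>b. 0) f g" "integrable lebesgue g"
    using assms zero_multi_index unfolding in_Wk1_def by (metis le0)
  then show li: "locally_integrable f" by (simp add: weak_derivative_def)
  have "AE x in lebesgue. g x = f x"
    by (rule weak_derivative_unique[OF g(1) weak_derivative_zero[OF li]])
  then show "integrable lebesgue f"
    by (rule integrable_cong_AE_imp[OF g(2) locally_integrable_measurable[OF li]])
qed

lemma L1_norm_le_norm_Wk1:
  fixes f1 f2 :: "'a::euclidean_space \<Rightarrow> real"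
  assumes "in_Wk1 k f1" "in_Wk1 k f2"
  shows "(LINT x|lebesgue. \<bar>f1 x - f2 x\<bar>) \<le> norm_Wk1 k (\<lambda>x. f1 x - f2 x)"
proof -
  let ?f = "\<lambda>x. f1 x - f2 x"
  have li: "locally_integrable ?f" using assms by (intro locally_integrable_diff in_Wk1_D)
  have m: "wderiv (\<lambda>b. 0) ?f \<in> borel_measurable lebesgue"
    using weak_derivative_wderiv[OF weak_derivative_zero[OF li]]
    by (intro locally_integrable_measurable) (simp add: weak_derivative_def)
  have "(LINT x|lebesgue. \<bar>?f x\<bar>) = (LINT x|lebesgue. \<bar>wderiv (\<lambda>b. 0) ?f x\<bar>)"
    using m locally_integrable_measurable[OF li] wderiv_zero[OF li]
    by (intro integral_cong_AE) (auto elim: eventually_mono)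
  also have "\<dots> \<le> norm_Wk1 k ?f"
    unfolding norm_Wk1_def
    by (rule member_le_sum[of "\<lambda>b. 0" _ "\<lambda>\<alpha>. LINT x|lebesgue. \<bar>wderiv \<alpha> ?f x\<bar>"])
      (simp_all add: zero_multi_index finite_multi_index)
  finally show ?thesis .
qed

section \<open>Mollification\<close>

text \<open>A nondecreasing function of class \<open>C\<^sup>1\<close> that vanishes on \<open>s \<le> 0\<close> and equals one on \<open>s \<ge> 1\<close>.\<close>

definition ramp :: "real \<Rightarrow> real"
  where "ramp s = (max 0 (1 - (max 0 (1 - s))\<^sup>2))\<^sup>2"

definition ramp' :: "real \<Rightarrow> real"
  where "ramp' s = 4 * max 0 (1 - (max 0 (1 - s))\<^sup>2) * max 0 (1 - s)"

lemma DERIV_ramp: "(ramp has_real_derivative ramp' s) (at s)"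
proof -
  have "((\<lambda>s::real. 1 - (max 0 (1 - s))\<^sup>2) has_real_derivative 2 * max 0 (1 - s)) (at s)"
    by (rule derivative_eq_intros DERIV_chain2[OF DERIV_pos_part_square] refl | simp)+
  from DERIV_chain2[OF DERIV_pos_part_square this] show ?thesis
    by (simp add: ramp_def[abs_def] ramp'_def mult_ac)
qed

lemma continuous_on_ramp': "continuous_on UNIV ramp'"
  unfolding ramp'_def[abs_def] by (intro continuous_intros)

lemma ramp_range: "0 \<le> ramp s" "ramp s \<le> 1"
  by (auto simp: ramp_def intro!: power_le_one)

lemma ramp_eq_0: "s \<le> 0 \<Longrightarrow> ramp s = 0"
proof -
  assume "s \<le> 0"
  then have "1 \<le> (max 0 (1 - s))\<^sup>2" by (intro one_le_power) auto
  then show ?thesis by (simp add: ramp_def)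
qed

lemma ramp_eq_1: "1 \<le> s \<Longrightarrow> ramp s = 1"
  by (simp add: ramp_def)

lemma ramp_pos: "0 < s \<Longrightarrow> 0 < ramp s"
proof -
  assume "0 < s"
  then have "(max 0 (1 - s))\<^sup>2 < 1" by (intro power_less_one_iff[THEN iffD2]) auto
  then show ?thesis by (simp add: ramp_def)
qed

definition bump :: "'a::euclidean_space \<Rightarrow> real \<Rightarrow> 'a \<Rightarrow> real"
  where "bump y r x = ramp (r\<^sup>2 - (x - y) \<bullet> (x - y))"

definition bump_grad :: "'a::euclidean_space \<Rightarrow> real \<Rightarrow> 'a \<Rightarrow> 'a"
  where "bump_grad y r x = (- 2 * ramp' (r\<^sup>2 - (x - y) \<bullet> (x - y))) *\<^sub>R (x - y)"

lemma bump_has_derivative: "(bump y r has_derivative (\<lambda>h. h \<bullet> bump_grad y r x)) (at x)"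
proof -
  have "((\<lambda>x. r\<^sup>2 - (x - y) \<bullet> (x - y)) has_derivative (\<lambda>h. - 2 * (h \<bullet> (x - y)))) (at x)"
    by (auto intro!: derivative_eq_intros simp: inner_commute algebra_simps)
  from has_derivative_compose[OF this DERIV_ramp[unfolded has_field_derivative_def]]
  show ?thesis by (simp add: bump_def[abs_def] bump_grad_def algebra_simps)
qed

lemma continuous_on_bump_grad: "continuous_on UNIV (bump_grad y r)"
  unfolding bump_grad_def[abs_def]
  by (intro continuous_intros continuous_on_compose2[OF continuous_on_ramp']) auto

lemma continuous_on_bump: "continuous_on UNIV (bump y r)"
  using bump_has_derivative has_derivative_continuous_on[of UNIV "bump y r"]
  by (meson has_derivative_at_withinI)

lemma bump_range: "0 \<le> bump y r x" "bump y r x \<le> 1"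
  by (simp_all add: bump_def ramp_range)

lemma bump_pos: "x \<in> ball y r \<Longrightarrow> 0 < bump y r x"
proof -
  assume x: "x \<in> ball y r"
  have "(norm (x - y))\<^sup>2 < r\<^sup>2"
    using x by (intro power_strict_mono) (auto simp: dist_norm norm_minus_commute)
  then show ?thesis by (simp add: bump_def ramp_pos dot_square_norm)
qed

lemma bump_outside: "0 \<le> r \<Longrightarrow> x \<notin> ball y r \<Longrightarrow> bump y r x = 0"
proof -
  assume r: "0 \<le> r" and x: "x \<notin> ball y r"
  have "r\<^sup>2 \<le> (norm (x - y))\<^sup>2"
    using x r by (intro power_mono) (auto simp: dist_norm norm_minus_commute)
  then show ?thesis by (simp add: bump_def ramp_eq_0 dot_square_norm)
qed

lemma integrable_compact_support:
  fixes f :: "'a::euclidean_space \<Rightarrow> real"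
  assumes f: "continuous_on UNIV f" and C: "compact C" "\<And>z. z \<notin> C \<Longrightarrow> f z = 0"
  shows "integrable lebesgue f"
proof -
  have "integrable lebesgue (\<lambda>x. 1 * f x)"
    by (rule locally_integrable_mult[OF locally_integrable_continuous f
          compactly_supportedI[OF C(1)]]) (use C(2) in auto)
  then show ?thesis by simp
qed

lemma integral_cbox_eq_LINT:
  fixes f :: "'a::euclidean_space \<Rightarrow> real"
  assumes f: "continuous_on UNIV f" and Q: "\<And>z. z \<notin> cbox c d \<Longrightarrow> f z = 0"
  shows "integral (cbox c d) f = (LINT z|lebesgue. f z)"
proof -
  have i: "integrable lebesgue f" by (rule integrable_compact_support[OF f compact_cbox Q])
  have "integral (cbox c d) f = integral UNIV f"
    by (rule integral_spike_set) (use Q in \<open>auto intro: negligible_subset[OF negligible_empty]\<close>)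
  with integral_lebesgue[OF i] show ?thesis by simp
qed

lemma LINT_affine:
  fixes f :: "'a::euclidean_space \<Rightarrow> real"
  assumes f: "continuous_on UNIV f" and c: "c \<noteq> 0"
  shows "(LINT z|lebesgue. f z) = \<bar>c\<bar> ^ DIM('a) * (LINT z|lebesgue. f (t + c *\<^sub>R z))"
proof -
  have fc: "continuous_on UNIV (\<lambda>z. f (t + c *\<^sub>R z))"
    by (rule continuous_on_compose2[OF f]) (auto intro!: continuous_intros)
  note m = borel_measurable_continuous_onI[OF f] borel_measurable_continuous_onI[OF fc]
  have "(LINT z|lborel. f z) =
      (LINT z|density (distr lborel borel (\<lambda>z. t + c *\<^sub>R z)) (\<lambda>_. ennreal (\<bar>c\<bar> ^ DIM('a))). f z)"
    using lborel_affine[OF c, of t] by (simp add: ennreal_power)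
  also have "\<dots> = (LINT z|distr lborel borel (\<lambda>z. t + c *\<^sub>R z). \<bar>c\<bar> ^ DIM('a) * f z)"
    using m by (subst integral_density) auto
  also have "\<dots> = (LINT z|lborel. \<bar>c\<bar> ^ DIM('a) * f (t + c *\<^sub>R z))"
    using m by (subst integral_distr) auto
  finally show ?thesis using m by (simp add: integral_completion)
qed

lemma LINT_reflect:
  fixes f :: "'a::euclidean_space \<Rightarrow> real"
  assumes "continuous_on UNIV f"
  shows "(LINT z|lebesgue. f (x - z)) = (LINT z|lebesgue. f z)"
  using LINT_affine[OF assms, of "-1" x] by simp

definition bump_mass :: "real \<Rightarrow> 'a::euclidean_space itself \<Rightarrow> real"
  where "bump_mass \<epsilon> _ = (LINT x|lebesgue. bump (0::'a) \<epsilon> x)"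

definition mollifier :: "real \<Rightarrow> 'a::euclidean_space \<Rightarrow> real"
  where "mollifier \<epsilon> x = bump 0 \<epsilon> x / bump_mass \<epsilon> TYPE('a)"

definition mollifier_grad :: "real \<Rightarrow> 'a::euclidean_space \<Rightarrow> 'a"
  where "mollifier_grad \<epsilon> x = bump_grad 0 \<epsilon> x /\<^sub>R bump_mass \<epsilon> TYPE('a)"

lemma integrable_bump: "0 \<le> r \<Longrightarrow> integrable lebesgue (bump y r)"
  by (rule integrable_compact_support[OF continuous_on_bump compact_cball[of y r]])
    (auto intro: bump_outside)

lemma bump_mass_pos:
  assumes "\<epsilon> > 0"
  shows "bump_mass \<epsilon> TYPE('a::euclidean_space) > 0"
proof (rule ccontr)
  assume "\<not> ?thesis"
  moreover have "0 \<le> (LINT x|lebesgue. bump (0::'a) \<epsilon> x)" by (simp add: bump_range)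
  ultimately have "(LINT x|lebesgue. bump (0::'a) \<epsilon> x) = 0" by (simp add: bump_mass_def)
  then have "AE x in lebesgue. bump (0::'a) \<epsilon> x = 0"
    using integral_nonneg_eq_0_iff_AE[OF integrable_bump[of \<epsilon> "0::'a"]] assms
    by (simp add: bump_range)
  then have "AE x in lebesgue. bump (0::'a) \<epsilon> x \<le> 0" by eventually_elim simp
  from AE_le_continuous[OF this continuous_on_bump, of 0] bump_pos[of 0 "0::'a" \<epsilon>] assms
  show False by simp
qed

lemma mollifier_has_derivative:
  "(mollifier \<epsilon> has_derivative (\<lambda>h. h \<bullet> mollifier_grad \<epsilon> x)) (at (x::'a::euclidean_space))"
proof -
  have "((\<lambda>x. inverse (bump_mass \<epsilon> TYPE('a)) * bump 0 \<epsilon> x) has_derivative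
      (\<lambda>h. inverse (bump_mass \<epsilon> TYPE('a)) * (h \<bullet> bump_grad 0 \<epsilon> x))) (at x)"
    by (intro has_derivative_mult_right bump_has_derivative)
  then show ?thesis
    by (simp add: mollifier_def[abs_def] mollifier_grad_def divide_inverse mult.commute)
qed

lemma continuous_on_mollifier: "continuous_on UNIV (mollifier \<epsilon>)"
  unfolding mollifier_def[abs_def] divide_inverse by (intro continuous_intros continuous_on_bump)

lemma continuous_on_mollifier_grad: "continuous_on UNIV (mollifier_grad \<epsilon>)"
  unfolding mollifier_grad_def[abs_def] by (intro continuous_intros continuous_on_bump_grad)

lemma continuous_on_mollifier_compose [continuous_intros]:
  "continuous_on A f \<Longrightarrow> continuous_on A (\<lambda>p. mollifier \<epsilon> (f p))"
  "continuous_on A f \<Longrightarrow> continuous_on A (\<lambda>p. mollifier_grad \<epsilon> (f p))"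
  by (rule continuous_on_compose2[OF continuous_on_mollifier], simp_all)
    (rule continuous_on_compose2[OF continuous_on_mollifier_grad], simp_all)

lemma mollifier_nonneg: "0 \<le> mollifier \<epsilon> (x::'a::euclidean_space)"
  by (simp add: mollifier_def bump_range bump_mass_def)

lemma mollifier_outside: "0 \<le> \<epsilon> \<Longrightarrow> \<epsilon> \<le> norm x \<Longrightarrow> mollifier \<epsilon> x = 0"
  by (simp add: mollifier_def bump_outside)

lemma integrable_mollifier: "0 \<le> \<epsilon> \<Longrightarrow> integrable lebesgue (mollifier \<epsilon>)"
  unfolding mollifier_def[abs_def] by (simp add: integrable_bump)

lemma integral_mollifier:
  assumes "\<epsilon> > 0" shows "(LINT x|lebesgue. mollifier \<epsilon> (x::'a::euclidean_space)) = 1"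
  using bump_mass_pos[OF assms, where 'a = 'a]
  by (simp add: mollifier_def[abs_def] bump_mass_def)

lemma integrable_mollifier_mult:
  fixes f :: "'a::euclidean_space \<Rightarrow> real"
  assumes "\<epsilon> > 0" "continuous_on UNIV f"
  shows "integrable lebesgue (\<lambda>z. f z * mollifier \<epsilon> z)"
  by (rule integrable_compact_support[OF _ compact_cball[of 0 \<epsilon>]])
    (use assms in \<open>auto intro!: continuous_intros continuous_on_mollifier mollifier_outside\<close>)

lemma mollifier_average_bound:
  fixes f :: "'a::euclidean_space \<Rightarrow> real"
  assumes \<epsilon>: "\<epsilon> > 0" and f: "continuous_on UNIV f" and e: "\<And>z. norm z \<le> \<epsilon> \<Longrightarrow> \<bar>f z - c\<bar> \<le> e"
  shows "\<bar>(LINT z|lebesgue. f z * mollifier \<epsilon> z) - c\<bar> \<le> e"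
proof -
  note i = integrable_mollifier_mult[OF \<epsilon> f] integrable_mollifier[of \<epsilon>]
  have i2: "integrable lebesgue (\<lambda>z. (f z - c) * mollifier \<epsilon> z)"
    by (rule integrable_mollifier_mult[OF \<epsilon>]) (intro continuous_intros f)
  have "(LINT z|lebesgue. f z * mollifier \<epsilon> z) - c = (LINT z|lebesgue. (f z - c) * mollifier \<epsilon> z)"
  proof -
    have "(LINT z|lebesgue. f z * mollifier \<epsilon> z - c * mollifier \<epsilon> z) =
        (LINT z|lebesgue. f z * mollifier \<epsilon> z) - (LINT z|lebesgue. c * mollifier \<epsilon> (z::'a))"
      using i \<epsilon> by (intro Bochner_Integration.integral_diff) auto
    then show ?thesis using integral_mollifier[OF \<epsilon>, where 'a = 'a] by (simp add: left_diff_distrib)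
  qed
  also have "\<bar>\<dots>\<bar> \<le> (LINT z|lebesgue. \<bar>(f z - c) * mollifier \<epsilon> z\<bar>)" by (rule integral_abs_bound)
  also have "\<dots> \<le> (LINT z|lebesgue. e * mollifier \<epsilon> (z::'a))"
  proof (rule integral_mono)
    fix z :: 'a
    show "\<bar>(f z - c) * mollifier \<epsilon> z\<bar> \<le> e * mollifier \<epsilon> z"
    proof (cases "norm z \<le> \<epsilon>")
      case True
      then show ?thesis using e[OF True] mollifier_nonneg[of \<epsilon> z] by (simp add: abs_mult mult_right_mono)
    next
      case False
      then show ?thesis using \<epsilon> by (simp add: mollifier_outside)
    qed
  qed (use i i2 \<epsilon> in auto)
  also have "\<dots> = e" using integral_mollifier[OF \<epsilon>, where 'a = 'a] by simp
  finally show ?thesis .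
qed

text \<open>The mollification of \<open>f\<close> has the mollification of the weak derivative of \<open>f\<close> as its classical
  derivative, which inherits the bound.\<close>

lemma increment_le_of_weak_derivative_le:
  fixes f :: "'a::euclidean_space \<Rightarrow> real"
  assumes f: "continuous_on UNIV f" and g: "weak_derivative (unit_index b) f g"
    and b: "b \<in> Basis" and B: "AE x in lebesgue. g x \<le> B" and s: "0 \<le> s"
  shows "f (x + s *\<^sub>R b) - f x \<le> B * s"
proof -
  have mollified: "(LINT z|lebesgue. f (x + s *\<^sub>R b - z) * mollifier \<epsilon> z)
      - (LINT z|lebesgue. f (x - z) * mollifier \<epsilon> z) \<le> B * s" if \<epsilon>: "\<epsilon> > 0" for \<epsilon>
  proof -
    define y where "y = (\<lambda>\<sigma>. x + \<sigma> *\<^sub>R b)"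
    obtain c d where "cball x (s + \<epsilon>) \<subseteq> cbox c d"
      using bounded_subset_cbox_symmetric[OF bounded_cball] by metis
    have outside: "\<epsilon> \<le> norm (y \<sigma> - z)" if "\<sigma> \<in> {0..s}" "z \<notin> cbox c d" for \<sigma> z
    proof -
      have "z \<notin> cball x (s + \<epsilon>)" using that \<open>cball x (s + \<epsilon>) \<subseteq> cbox c d\<close> by blast
      then have "s + \<epsilon> < norm (x - z)" by (simp add: dist_norm)
      also have "x - z = (y \<sigma> - z) - \<sigma> *\<^sub>R b" by (simp add: y_def)
      also have "norm \<dots> \<le> norm (y \<sigma> - z) + norm (\<sigma> *\<^sub>R b)" by (rule norm_triangle_ineq4)
      also have "norm (\<sigma> *\<^sub>R b) \<le> s" using that b by simp
      finally show ?thesis by simp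
    qed
    define D where "D = (\<lambda>\<sigma>. integral (cbox c d) (\<lambda>z. f z * mollifier \<epsilon> (y \<sigma> - z)))"
    define D' where "D' = (\<lambda>\<sigma>. integral (cbox c d) (\<lambda>z. f z * (b \<bullet> mollifier_grad \<epsilon> (y \<sigma> - z))))"
    have cont_f: "continuous_on A (\<lambda>p. f (h p))" if "continuous_on A h" for h :: "'c::topological_space \<Rightarrow> 'a" and A
      using that by (rule continuous_on_compose2[OF f]) auto
    have der: "(D has_real_derivative D' \<sigma>) (at \<sigma> within {0..s})" if "\<sigma> \<in> {0..s}" for \<sigma>
      unfolding D_def D'_def
    proof (rule leibniz_rule_field_derivative[OF _ _ _ that])
      fix \<sigma> z
      have "((\<lambda>\<sigma>. y \<sigma> - z) has_derivative (\<lambda>h. h *\<^sub>R b)) (at \<sigma> within {0..s})"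
        unfolding y_def by (auto intro!: derivative_eq_intros)
      from has_derivative_compose[OF this mollifier_has_derivative]
      have "((\<lambda>\<sigma>. mollifier \<epsilon> (y \<sigma> - z)) has_real_derivative b \<bullet> mollifier_grad \<epsilon> (y \<sigma> - z)) (at \<sigma> within {0..s})"
        by (rule has_derivative_imp_has_field_derivative) (simp add: mult.commute)
      then show "((\<lambda>\<sigma>. f z * mollifier \<epsilon> (y \<sigma> - z)) has_real_derivative
          f z * (b \<bullet> mollifier_grad \<epsilon> (y \<sigma> - z))) (at \<sigma> within {0..s})"
        by (rule DERIV_cmult)
    next
      show "(\<lambda>z. f z * mollifier \<epsilon> (y \<sigma> - z)) integrable_on cbox c d" for \<sigma>
        by (intro integrable_continuous continuous_intros cont_f)
      show "continuous_on ({0..s} \<times> cbox c d) (\<lambda>(\<sigma>, z). f z * (b \<bullet> mollifier_grad \<epsilon> (y \<sigma> - z)))"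
        unfolding y_def case_prod_unfold by (intro continuous_intros cont_f)
    qed simp
    have D'_le: "D' \<sigma> \<le> B" if \<sigma>: "\<sigma> \<in> {0..s}" for \<sigma>
    proof -
      define \<phi> where "\<phi> = (\<lambda>z. mollifier \<epsilon> (y \<sigma> - z))"
      have d\<phi>: "(\<phi> has_derivative (\<lambda>h. h \<bullet> (- mollifier_grad \<epsilon> (y \<sigma> - z)))) (at z)" for z
      proof -
        have "((\<lambda>z. y \<sigma> - z) has_derivative (\<lambda>h. - h)) (at z)"
          by (auto intro!: derivative_eq_intros)
        from has_derivative_compose[OF this mollifier_has_derivative]
        show ?thesis by (simp add: \<phi>_def)
      qed
      have C1: "Ck 1 \<phi>" by (rule Ck1_gradientI[OF d\<phi>]) (intro continuous_intros)
      have cs: "compactly_supported \<phi>"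
        by (rule compactly_supportedI[OF compact_cbox[of c d]]) (use outside \<sigma> \<epsilon> in \<open>force simp: \<phi>_def mollifier_outside\<close>)
      have "D' \<sigma> = - integral (cbox c d) (\<lambda>z. f z * partial b \<phi> z)"
        unfolding D'_def partial_eq[OF d\<phi>] by simp
      also have "integral (cbox c d) (\<lambda>z. f z * partial b \<phi> z) = (LINT z|lebesgue. f z * partial b \<phi> z)"
      proof (rule integral_cbox_eq_LINT)
        show "continuous_on UNIV (\<lambda>z. f z * partial b \<phi> z)"
          unfolding partial_eq[OF d\<phi>] by (intro continuous_intros f)
        fix z assume "z \<notin> cbox c d"
        moreover have "supp \<phi> \<subseteq> cbox c d"
          by (rule supp_bound[OF closed_cbox]) (use outside \<sigma> \<epsilon> in \<open>force simp: \<phi>_def mollifier_outside\<close>)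
        ultimately have "iter_partial (unit_index b) \<phi> z = 0"
          by (intro iter_partial_outside_supp) auto
        then show "f z * partial b \<phi> z = 0" using b by (simp add: iter_partial_unit)
      qed
      also have "\<dots> = - (LINT z|lebesgue. g z * \<phi> z)"
        using g C1 cs b unfolding weak_derivative_def by (auto simp: unit_multi_index iter_partial_unit)
      also have "- (- (LINT z|lebesgue. g z * \<phi> z)) \<le> (LINT z|lebesgue. B * \<phi> z)"
        unfolding minus_minus
      proof (rule integral_mono_AE)
        show "integrable lebesgue (\<lambda>z. g z * \<phi> z)"
          using g C1 cs by (intro locally_integrable_mult Ck_continuous[OF C1]) (auto simp: weak_derivative_def)
        show "integrable lebesgue (\<lambda>z. B * \<phi> z)"
          using C1 cs by (intro locally_integrable_mult Ck_continuous[OF C1] locally_integrable_continuous) auto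
        show "AE z in lebesgue. g z * \<phi> z \<le> B * \<phi> z"
          using B by eventually_elim (auto simp: \<phi>_def intro: mult_right_mono mollifier_nonneg)
      qed
      also have "\<dots> = B"
        using integral_mollifier[OF \<epsilon>, where 'a = 'a] LINT_reflect[OF continuous_on_mollifier, of \<epsilon> "y \<sigma>"]
        by (simp add: \<phi>_def)
      finally show ?thesis by simp
    qed
    have "D s - D 0 \<le> B * s"
    proof -
      obtain \<sigma> where "\<sigma> \<in> {0..s}" "D s - D 0 = (s - 0) * D' \<sigma>"
      proof (cases "s = 0")
        case True then show ?thesis using that[of 0] by simp
      next
        case False
        then have "0 < s" using s by simp
        then obtain \<sigma> where "\<sigma> \<in> {0<..<s}" "D s - D 0 = D' \<sigma> * (s - 0)"
          using mvt_simple[of 0 s D "\<lambda>\<sigma> h. D' \<sigma> * h"] der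
          by (auto simp: has_field_derivative_def)
        then show ?thesis using that[of \<sigma>] by (auto simp: mult.commute)
      qed
      then show ?thesis using mult_left_mono[OF D'_le[of \<sigma>] s] by (simp add: mult.commute)
    qed
    moreover have "D \<sigma> = (LINT z|lebesgue. f (y \<sigma> - z) * mollifier \<epsilon> z)" if "\<sigma> \<in> {0..s}" for \<sigma>
    proof -
      have c: "continuous_on UNIV (\<lambda>z. f z * mollifier \<epsilon> (y \<sigma> - z))"
        by (intro continuous_intros f)
      have "D \<sigma> = (LINT z|lebesgue. f z * mollifier \<epsilon> (y \<sigma> - z))"
        unfolding D_def
        by (rule integral_cbox_eq_LINT[OF c]) (use outside[OF that] \<epsilon> in \<open>simp add: mollifier_outside\<close>)
      with LINT_reflect[OF c, of "y \<sigma>"] show ?thesis by simp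
    qed
    ultimately show ?thesis using s by (simp add: y_def)
  qed
  show ?thesis
  proof (rule field_le_epsilon)
    fix e :: real assume e: "e > 0"
    have "\<exists>d>0. \<forall>z. norm z \<le> d \<longrightarrow> \<bar>f (p - z) - f p\<bar> \<le> e / 2" for p
    proof -
      have "isCont f p" using f by (simp add: continuous_on_eq_continuous_at)
      then obtain d where d: "d > 0" "\<And>q. dist q p < d \<Longrightarrow> dist (f q) (f p) < e / 2"
        using e unfolding continuous_at_eps_delta by (meson half_gt_zero)
      have "\<bar>f (p - z) - f p\<bar> \<le> e / 2" if "norm z \<le> d / 2" for z
        using d(2)[of "p - z"] d(1) that by (simp add: dist_norm)
      then show ?thesis using d(1) by (intro exI[of _ "d / 2"]) auto
    qed
    then obtain d where d: "\<And>p. d p > 0" "\<And>p z. norm z \<le> d p \<Longrightarrow> \<bar>f (p - z) - f p\<bar> \<le> e / 2"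
      by metis
    define \<epsilon> where "\<epsilon> = min (d x) (d (x + s *\<^sub>R b))"
    have \<epsilon>: "\<epsilon> > 0" using d(1) by (simp add: \<epsilon>_def)
    have fc: "continuous_on UNIV (\<lambda>z. f (p - z))" for p
      by (rule continuous_on_compose2[OF f]) (auto intro: continuous_intros)
    have "\<bar>(LINT z|lebesgue. f (x - z) * mollifier \<epsilon> z) - f x\<bar> \<le> e / 2"
      by (rule mollifier_average_bound[OF \<epsilon> fc]) (use d(2) in \<open>auto simp: \<epsilon>_def\<close>)
    moreover have "\<bar>(LINT z|lebesgue. f (x + s *\<^sub>R b - z) * mollifier \<epsilon> z) - f (x + s *\<^sub>R b)\<bar> \<le> e / 2"
      by (rule mollifier_average_bound[OF \<epsilon> fc]) (use d(2) in \<open>auto simp: \<epsilon>_def\<close>)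
    ultimately show "f (x + s *\<^sub>R b) - f x \<le> B * s + e"
      using mollified[OF \<epsilon>] by linarith
  qed
qed

section \<open>The coefficients\<close>

text \<open>The increment between two points is estimated along a path that changes one coordinate at a time.\<close>

lemma lipschitz_of_bounded_weak_partials:
  fixes f :: "'a::euclidean_space \<Rightarrow> real"
  assumes f: "continuous_on UNIV f"
    and wd: "\<And>c. c \<in> Basis \<Longrightarrow> \<exists>g B. weak_derivative (unit_index c) f g \<and> (AE x in lebesgue. \<bar>g x\<bar> \<le> B)"
  shows "\<exists>L\<ge>0. \<forall>x y. \<bar>f x - f y\<bar> \<le> L * norm (x - y)"
proof -
  obtain g B where gB: "\<And>c. c \<in> Basis \<Longrightarrow> weak_derivative (unit_index c) f (g c)"
      "\<And>c. c \<in> Basis \<Longrightarrow> AE x in lebesgue. \<bar>g c x\<bar> \<le> B c"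
    using wd by metis
  have step: "\<bar>f (x + s *\<^sub>R c) - f x\<bar> \<le> \<bar>B c\<bar> * \<bar>s\<bar>" if c: "c \<in> Basis" for c x s
  proof -
    have up: "f (x + s *\<^sub>R c) - f x \<le> \<bar>B c\<bar> * s" if "0 \<le> s" for x s
      by (rule increment_le_of_weak_derivative_le[OF f gB(1)[OF c] c _ that])
        (use gB(2)[OF c] in \<open>auto elim: eventually_mono\<close>)
    have wd0: "weak_derivative (unit_index c) (\<lambda>x::'a. 0) (\<lambda>x. 0)"
      by (simp add: weak_derivative_def locally_integrable_continuous)
    have down: "(0 - f (x + s *\<^sub>R c)) - (0 - f x) \<le> \<bar>B c\<bar> * s" if "0 \<le> s" for x s
      by (rule increment_le_of_weak_derivative_le[OF _ weak_derivative_diff[OF wd0 gB(1)[OF c]] c _ that])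
        (use gB(2)[OF c] in \<open>auto elim: eventually_mono intro: continuous_intros f\<close>)
    show ?thesis
    proof (cases "0 \<le> s")
      case True
      then show ?thesis using up[of s x] down[of s x] by (simp add: abs_le_iff)
    next
      case False
      then show ?thesis using up[of "- s" "x + s *\<^sub>R c"] down[of "- s" "x + s *\<^sub>R c"] by (simp add: abs_le_iff)
    qed
  qed
  have walk: "\<bar>f (x + (\<Sum>c\<in>A. (h \<bullet> c) *\<^sub>R c)) - f x\<bar> \<le> (\<Sum>c\<in>A. \<bar>B c\<bar> * \<bar>h \<bullet> c\<bar>)" if "A \<subseteq> Basis" for A x h
    using finite_subset[OF that finite_Basis] that
  proof (induction A)
    case (insert c A)
    have "\<bar>f ((x + (\<Sum>c\<in>A. (h \<bullet> c) *\<^sub>R c)) + (h \<bullet> c) *\<^sub>R c) - f (x + (\<Sum>c\<in>A. (h \<bullet> c) *\<^sub>R c))\<bar> \<le> \<bar>B c\<bar> * \<bar>h \<bullet> c\<bar>"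
      using insert by (intro step) auto
    moreover have "(x + (\<Sum>c\<in>A. (h \<bullet> c) *\<^sub>R c)) + (h \<bullet> c) *\<^sub>R c = x + (\<Sum>c\<in>insert c A. (h \<bullet> c) *\<^sub>R c)"
      using insert by (simp add: algebra_simps)
    ultimately show ?case using insert by simp
  qed simp
  show ?thesis
  proof (intro exI[of _ "\<Sum>c\<in>Basis. \<bar>B c\<bar>"] conjI allI)
    show "0 \<le> (\<Sum>c\<in>Basis. \<bar>B c\<bar>)" by (simp add: sum_nonneg)
    fix x y
    have "\<bar>f x - f y\<bar> \<le> (\<Sum>c\<in>Basis. \<bar>B c\<bar> * \<bar>(x - y) \<bullet> c\<bar>)"
      using walk[of Basis y "x - y"] by (simp add: euclidean_representation)
    also have "\<dots> \<le> (\<Sum>c\<in>Basis. \<bar>B c\<bar> * norm (x - y))"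
      by (intro sum_mono mult_left_mono Basis_le_norm) auto
    finally show "\<bar>f x - f y\<bar> \<le> (\<Sum>c\<in>Basis. \<bar>B c\<bar>) * norm (x - y)" by (simp add: sum_distrib_right)
  qed
qed

lemma velocity_regular_lipschitz:
  fixes a :: "'a::euclidean_space \<Rightarrow> 'a"
  assumes "velocity_regular k a"
  shows "\<exists>L>0. \<forall>x y. norm (a x - a y) \<le> L * norm (x - y)"
proof -
  have "\<exists>L\<ge>0. \<forall>x y. \<bar>a x \<bullet> b - a y \<bullet> b\<bar> \<le> L * norm (x - y)" if b: "b \<in> Basis" for b
  proof (rule lipschitz_of_bounded_weak_partials)
    show "continuous_on UNIV (\<lambda>x. a x \<bullet> b)"
      using assms unfolding velocity_regular_def by (auto intro: continuous_intros)
    fix c :: 'a assume "c \<in> Basis"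
    then show "\<exists>g B. weak_derivative (unit_index c) (\<lambda>x. a x \<bullet> b) g \<and> (AE x in lebesgue. \<bar>g x\<bar> \<le> B)"
      using assms b unit_multi_index[of c] unfolding velocity_regular_def in_Wkinf_on_def by force
  qed
  then obtain L where L: "\<And>b. b \<in> Basis \<Longrightarrow> 0 \<le> L b"
      "\<And>b x y. b \<in> Basis \<Longrightarrow> \<bar>a x \<bullet> b - a y \<bullet> b\<bar> \<le> L b * norm (x - y)"
    by metis
  have nn: "0 \<le> (\<Sum>b\<in>Basis. L b)" by (simp add: L sum_nonneg)
  show ?thesis
  proof (intro exI[of _ "(\<Sum>b\<in>Basis. L b) + 1"] conjI allI)
    show "0 < (\<Sum>b\<in>Basis. L b) + 1" using nn by simp
    fix x y
    have "norm (a x - a y) \<le> (\<Sum>b\<in>Basis. \<bar>(a x - a y) \<bullet> b\<bar>)" by (rule norm_le_l1)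
    also have "\<dots> \<le> (\<Sum>b\<in>Basis. L b * norm (x - y))"
      by (intro sum_mono) (use L in \<open>simp add: inner_diff_left\<close>)
    also have "\<dots> \<le> ((\<Sum>b\<in>Basis. L b) + 1) * norm (x - y)" by (simp add: sum_distrib_right distrib_right)
    finally show "norm (a x - a y) \<le> ((\<Sum>b\<in>Basis. L b) + 1) * norm (x - y)" .
  qed
qed

lemma growth_regular_continuous:
  assumes "growth_regular k R"
  shows "continuous_on UNIV (\<lambda>(x, I). R x I)"
  using assms continuous_into_Wkinf_joint[of k "\<lambda>I x. R x I"] Ck_continuous
  unfolding growth_regular_def by blast

text \<open>The derivative of \<open>R x\<close> is a chosen representative, so its bound carries no pointwise information by
  itself; it becomes one on the increments of the continuous function \<open>R x\<close>.\<close>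

lemma growth_regular_increment:
  fixes R :: "'a::euclidean_space \<Rightarrow> real \<Rightarrow> real"
  assumes R: "growth_regular k R" and k: "1 \<le> k"
    and D: "AE I in lebesgue. wderiv (unit_index 1) (R x) I \<le> - D" and s: "0 \<le> s"
  shows "R x (I + s) - R x I \<le> - D * s"
proof -
  have "in_Wkinf_on (cball 0 0) k (R x)"
    using R unfolding growth_regular_def continuous_into_Wkinf_loc_def continuous_into_Wkinf_on_def by blast
  then obtain g where "weak_derivative (unit_index 1) (R x) g"
    using unit_multi_index[of "1::real"] k unfolding in_Wkinf_on_def by force
  note wd = weak_derivative_wderiv[OF this]
  have "continuous_on UNIV (R x)"
    by (rule continuous_on_slice_UNIV[OF growth_regular_continuous[OF R]])
  from increment_le_of_weak_derivative_le[OF this wd _ D s, of I] show ?thesis by simp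
qed

lemma weight_regular_continuous:
  assumes "weight_regular k \<psi>"
  shows "continuous_on UNIV (\<lambda>(x, y). \<psi> x y)" "continuous_on UNIV (\<psi> x)"
proof -
  show c: "continuous_on UNIV (\<lambda>(x, y). \<psi> x y)"
    using assms continuous_into_Wkinf_joint[of k "\<lambda>y x. \<psi> x y"] Ck_continuous
    unfolding weight_regular_def by blast
  show "continuous_on UNIV (\<psi> x)" by (rule continuous_on_slice_UNIV[OF c])
qed

lemma weight_regular_uniform:
  assumes "weight_regular k \<psi>" "e > 0"
  shows "\<forall>\<^sub>F x in nhds x0. \<forall>y. \<bar>\<psi> x y - \<psi> x0 y\<bar> \<le> e"
  using assms weight_regular_continuous(2)[OF assms(1)]
  by (intro continuous_into_Wkinf_uniform[of 1]) (auto simp: weight_regular_def)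

lemma weight_regular_bounded:
  assumes "weight_regular k \<psi>"
  shows "\<exists>B. \<forall>y. \<bar>\<psi> x y\<bar> \<le> B"
  using assms weight_regular_continuous(2)[OF assms]
  by (intro in_Wkinf_continuous_bounded[of 1])
    (auto simp: weight_regular_def continuous_into_Wkinf_def continuous_into_Wkinf_on_def)

section \<open>The flow\<close>

lemma gronwall:
  fixes f f' :: "real \<Rightarrow> real"
  assumes T: "0 \<le> T" and d: "\<And>t. t \<in> {0..T} \<Longrightarrow> (f has_real_derivative f' t) (at t within {0..T})"
    and le: "\<And>t. t \<in> {0..T} \<Longrightarrow> f' t \<le> B * f t"
  shows "f T \<le> f 0 * exp (B * T)"
proof (cases "T = 0")
  case False
  then have "0 < T" using T by simp
  define g where "g = (\<lambda>t. f t * exp (- B * t))"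
  have "(g has_derivative (\<lambda>h. (f' t * exp (- B * t) - B * f t * exp (- B * t)) * h)) (at t within {0..T})"
    if "t \<in> {0..T}" for t
    unfolding g_def
    by (rule has_derivative_eq_rhs[OF has_derivative_mult[OF
          d[OF that, unfolded has_field_derivative_def]]])
      (auto intro!: derivative_eq_intros simp: algebra_simps)
  then obtain t where t: "t \<in> {0<..<T}"
      "g T - g 0 = (f' t * exp (- B * t) - B * f t * exp (- B * t)) * (T - 0)"
    using mvt_simple[OF \<open>0 < T\<close>, of g "\<lambda>t h. (f' t * exp (- B * t) - B * f t * exp (- B * t)) * h"] by auto
  have "(f' t - B * f t) * exp (- B * t) \<le> 0"
    using le[of t] t(1) by (intro mult_nonpos_nonneg) auto
  then have "(f' t * exp (- B * t) - B * f t * exp (- B * t)) * (T - 0) \<le> 0"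
    using T by (intro mult_nonpos_nonneg) (auto simp: algebra_simps)
  then have "g T \<le> g 0" using t(2) by simp
  then have "f T * exp (- B * T) * exp (B * T) \<le> f 0 * exp (B * T)"
    by (intro mult_right_mono) (auto simp: g_def)
  then show ?thesis by (simp add: mult.assoc flip: exp_add)
qed simp

lemma lipschitz_solutions_close:
  fixes x y :: "real \<Rightarrow> 'a::euclidean_space"
  assumes L: "\<And>p q. norm (a p - a q) \<le> L * norm (p - q)"
    and x: "\<And>t. 0 \<le> t \<Longrightarrow> (x has_vector_derivative a (x t)) (at t within {0..})"
    and y: "\<And>t. 0 \<le> t \<Longrightarrow> (y has_vector_derivative a (y t)) (at t within {0..})"
    and t: "0 \<le> t"
  shows "norm (x t - y t) \<le> exp (L * t) * norm (x 0 - y 0)"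
proof -
  define f where "f = (\<lambda>s. (x s - y s) \<bullet> (x s - y s))"
  have "f t \<le> f 0 * exp ((2 * L) * t)"
  proof (rule gronwall[OF t])
    fix s assume s: "s \<in> {0..t}"
    have "((\<lambda>s. x s - y s) has_vector_derivative a (x s) - a (y s)) (at s within {0..t})"
      using s by (intro has_vector_derivative_diff has_vector_derivative_within_subset[OF x]
          has_vector_derivative_within_subset[OF y]) auto
    from has_derivative_inner[OF this[unfolded has_vector_derivative_def] this[unfolded has_vector_derivative_def]]
    show "(f has_real_derivative 2 * ((x s - y s) \<bullet> (a (x s) - a (y s)))) (at s within {0..t})"
      unfolding f_def has_field_derivative_def
      by (rule has_derivative_eq_rhs) (auto simp: inner_commute algebra_simps)
    have "(x s - y s) \<bullet> (a (x s) - a (y s)) \<le> norm (x s - y s) * norm (a (x s) - a (y s))"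
      by (rule norm_cauchy_schwarz)
    also have "\<dots> \<le> norm (x s - y s) * (L * norm (x s - y s))" by (intro mult_left_mono L) simp
    finally show "2 * ((x s - y s) \<bullet> (a (x s) - a (y s))) \<le> (2 * L) * f s"
      by (simp add: f_def power2_norm_eq_inner[symmetric] power2_eq_square mult_ac)
  qed
  then have "(norm (x t - y t))\<^sup>2 \<le> (exp (L * t) * norm (x 0 - y 0))\<^sup>2"
    by (simp add: f_def power2_norm_eq_inner power_mult_distrib exp_double[symmetric] mult_ac)
  then show ?thesis by (rule power2_le_imp_le) simp
qed

locale lipschitz_flow =
  fixes a :: "'a::euclidean_space \<Rightarrow> 'a" and X :: "real \<Rightarrow> 'a \<Rightarrow> 'a" and L :: real
  assumes L_pos: "0 < L" and lipschitz: "\<And>p q. norm (a p - a q) \<le> L * norm (p - q)"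
    and flow: "is_flow a X"
begin

lemma X_0 [simp]: "X 0 y = y"
  using flow by (simp add: is_flow_def)

lemma X_deriv: "((\<lambda>s. X s y) has_vector_derivative a (X t y)) (at t within S)"
  using flow by (auto simp: is_flow_def intro: has_vector_derivative_at_within)

lemma X_deriv_shift: "((\<lambda>s. X (r + c * s) y) has_vector_derivative c *\<^sub>R a (X (r + c * t) y)) (at t within S)"
proof -
  have "((\<lambda>s. r + c * s) has_vector_derivative c) (at t within S)"
    by (auto intro!: derivative_eq_intros simp: has_real_derivative_iff_has_vector_derivative[symmetric])
  from vector_diff_chain_within[OF this X_deriv[of y "r + c * t"]]
  show ?thesis by (simp add: o_def)
qed

lemma continuous_a: "continuous_on UNIV a"
  using lipschitz L_pos by (intro lipschitz_on_continuous_on[of L] lipschitz_onI) (auto simp: dist_norm)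

text \<open>The sign \<open>c\<close> makes Gronwall's inequality, which runs forward in time, available for both time directions;
  the Lipschitz estimate and the group law are instances.\<close>

lemma shifts_close:
  assumes t: "0 \<le> t" and c: "c = 1 \<or> c = -1"
  shows "norm (X (r + c * t) y - X (q + c * t) z) \<le> exp (L * t) * norm (X r y - X q z)"
proof -
  have lip: "norm (c *\<^sub>R a u - c *\<^sub>R a w) \<le> L * norm (u - w)" for u w
  proof -
    have "norm (c *\<^sub>R a u - c *\<^sub>R a w) = norm (a u - a w)"
      using c by (auto simp: norm_minus_commute)
    then show ?thesis using lipschitz[of u w] by simp
  qed
  show ?thesis
    using lipschitz_solutions_close[of "\<lambda>u. c *\<^sub>R a u" L "\<lambda>s. X (r + c * s) y" "\<lambda>s. X (q + c * s) z" t]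
      lip X_deriv_shift t by simp
qed

lemma X_lipschitz: "norm (X t x - X t y) \<le> exp (L * \<bar>t\<bar>) * norm (x - y)"
  using shifts_close[of t 1 0 x 0 y] shifts_close[of "- t" "-1" 0 x 0 y] by (cases "0 \<le> t") auto

lemma X_add: "X (t + s) y = X t (X s y)"
  using shifts_close[of t 1 s y 0 "X s y"] shifts_close[of "- t" "-1" s y 0 "X s y"]
  by (cases "0 \<le> t") (auto simp: add.commute)

lemma X_inverse [simp]: "X (- t) (X t y) = y" "X t (X (- t) y) = y"
  by (simp_all flip: X_add)

lemma solution_eq_X:
  assumes "\<And>t. 0 \<le> t \<Longrightarrow> (x has_vector_derivative a (x t)) (at t within {0..})" "0 \<le> t"
  shows "x t = X t (x 0)"
  using lipschitz_solutions_close[OF lipschitz assms(1) X_deriv assms(2), of "x 0"] by simp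

lemma continuous_X: "continuous_on UNIV (\<lambda>p. X (fst p) (snd p))"
proof -
  have "((\<lambda>p. X (fst p) (snd p)) \<longlongrightarrow> X t0 y0) (at (t0, y0))" for t0 y0
  proof (rule LIM_zero_cancel)
    have cX: "isCont (\<lambda>t. X t y0) t0"
      using X_deriv[of y0 t0 UNIV] has_vector_derivative_continuous by blast
    have "((\<lambda>p. exp (L * \<bar>fst p\<bar>) * norm (snd p - y0) + norm (X (fst p) y0 - X t0 y0)) \<longlongrightarrow>
        exp (L * \<bar>t0\<bar>) * norm (y0 - y0) + norm (X t0 y0 - X t0 y0)) (at (t0, y0))"
      by (intro tendsto_intros isCont_tendsto_compose[OF cX] tendsto_fst[of _ "(t0, y0)", simplified]
          tendsto_snd[of _ "(t0, y0)", simplified])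
    then have lim: "((\<lambda>p. exp (L * \<bar>fst p\<bar>) * norm (snd p - y0) + norm (X (fst p) y0 - X t0 y0)) \<longlongrightarrow> 0) (at (t0, y0))"
      by simp
    show "((\<lambda>p. X (fst p) (snd p) - X t0 y0) \<longlongrightarrow> 0) (at (t0, y0))"
    proof (rule Lim_null_comparison[OF always_eventually lim], rule allI)
      fix p
      have "norm (X (fst p) (snd p) - X t0 y0) \<le>
          norm (X (fst p) (snd p) - X (fst p) y0) + norm (X (fst p) y0 - X t0 y0)"
        using norm_triangle_ineq[of "X (fst p) (snd p) - X (fst p) y0" "X (fst p) y0 - X t0 y0"] by simp
      then show "norm (X (fst p) (snd p) - X t0 y0) \<le>
          exp (L * \<bar>fst p\<bar>) * norm (snd p - y0) + norm (X (fst p) y0 - X t0 y0)"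
        using X_lipschitz[of "fst p" "snd p" y0] by linarith
    qed
  qed
  then show ?thesis by (auto simp: continuous_on_eq_continuous_at isCont_def)
qed

lemma continuous_on_X [continuous_intros]:
  "continuous_on S f \<Longrightarrow> continuous_on S g \<Longrightarrow> continuous_on S (\<lambda>p. X (f p) (g p))"
  using continuous_on_compose2[OF continuous_X, of S "\<lambda>p. (f p, g p)"] by (simp add: continuous_on_Pair)

lemma compact_X_image: "compact I \<Longrightarrow> compact C \<Longrightarrow> compact ((\<lambda>p. X (fst p) (snd p)) ` (I \<times> C))"
  by (intro compact_continuous_image compact_Times continuous_on_subset[OF continuous_X]) auto

text \<open>Nearby points are displaced over a short time by nearly the same vector: the difference is of
  order \<open>s \<bar>z\<bar>\<close>, not merely of order \<open>s\<close>. This is what makes mollification commute with the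
  transport operator up to an error that vanishes with the mollification parameter.\<close>

lemma displacement_difference:
  assumes s: "0 \<le> s" "s \<le> 1"
  shows "norm (X s (x - z) - (X s x - z)) \<le> s * (L * exp L) * norm z"
proof (cases "s = 0")
  case False
  then have "0 < s" using s by simp
  have "norm ((X s (x - z) - X s x) - (X 0 (x - z) - X 0 x)) \<le> (L * exp L * norm z) * s - (L * exp L * norm z) * 0"
  proof (rule differentiable_bound_general[OF \<open>0 < s\<close>])
    fix \<sigma> assume \<sigma>: "0 < \<sigma>" "\<sigma> < s"
    show "((\<lambda>\<sigma>. X \<sigma> (x - z) - X \<sigma> x) has_vector_derivative a (X \<sigma> (x - z)) - a (X \<sigma> x)) (at \<sigma>)"
      by (intro has_vector_derivative_diff X_deriv)
    show "((\<lambda>\<sigma>. (L * exp L * norm z) * \<sigma>) has_vector_derivative L * exp L * norm z) (at \<sigma>)"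
      by (auto intro!: derivative_eq_intros simp: has_real_derivative_iff_has_vector_derivative[symmetric])
    have "norm (a (X \<sigma> (x - z)) - a (X \<sigma> x)) \<le> L * (exp (L * \<bar>\<sigma>\<bar>) * norm ((x - z) - x))"
      using lipschitz X_lipschitz L_pos by (meson mult_left_mono order_trans less_imp_le)
    also have "\<dots> \<le> L * (exp L * norm z)"
      using L_pos \<sigma> s by (auto intro!: mult_left_mono mult_right_mono simp: mult_le_cancel_left1)
    finally show "norm (a (X \<sigma> (x - z)) - a (X \<sigma> x)) \<le> L * exp L * norm z" by (simp add: mult.assoc)
  qed (intro continuous_intros)+
  then show ?thesis by (simp add: algebra_simps)
qed simp

end

section \<open>Continuity of pairings\<close>

lemma integrable_mult_bounded:
  fixes f g :: "'a \<Rightarrow> real"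
  assumes f: "integrable M f" and g: "g \<in> borel_measurable M" and B: "\<And>x. \<bar>g x\<bar> \<le> B"
  shows "integrable M (\<lambda>x. f x * g x)"
proof (rule Bochner_Integration.integrable_bound)
  show "integrable M (\<lambda>x. B * f x)" using f by simp
  have "\<bar>g x\<bar> \<le> \<bar>B\<bar>" for x using B[of x] by linarith
  then have "\<bar>f x\<bar> * \<bar>g x\<bar> \<le> \<bar>B\<bar> * \<bar>f x\<bar>" for x
    by (metis abs_ge_zero mult.commute mult_right_mono)
  then show "AE x in M. norm (f x * g x) \<le> norm (B * f x)" by (simp add: abs_mult)
qed (use f g in measurable)

lemma compact_abs_bound:
  fixes f :: "'b::topological_space \<Rightarrow> real"
  assumes "compact K" "continuous_on K f"
  obtains B where "B > 0" "\<And>x. x \<in> K \<Longrightarrow> \<bar>f x\<bar> \<le> B"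
  using compact_imp_bounded[OF compact_continuous_image[OF assms(2,1)]] unfolding bounded_pos by auto

lemma bounded_compact_support:
  fixes f :: "'a::topological_space \<Rightarrow> real"
  assumes "continuous_on UNIV f" "compact K" "\<And>x. x \<notin> K \<Longrightarrow> f x = 0"
  obtains B where "B > 0" "\<And>x. \<bar>f x\<bar> \<le> B"
proof -
  obtain B where B: "B > 0" "\<And>x. x \<in> K \<Longrightarrow> \<bar>f x\<bar> \<le> B"
    using compact_abs_bound[OF assms(2) continuous_on_subset[OF assms(1) subset_UNIV]] by blast
  then have "\<bar>f x\<bar> \<le> B" for x using assms(3)[of x] by (cases "x \<in> K") auto
  with B(1) show ?thesis by (rule that)
qed

lemma integrable_mult_compact_support:
  fixes u f :: "'a::euclidean_space \<Rightarrow> real"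
  assumes u: "integrable lebesgue u" and f: "continuous_on UNIV f" "compact K" "\<And>x. x \<notin> K \<Longrightarrow> f x = 0"
  shows "integrable lebesgue (\<lambda>x. u x * f x)"
proof -
  obtain B where "\<And>x. \<bar>f x\<bar> \<le> B" using bounded_compact_support[OF f] by blast
  then show ?thesis by (rule integrable_mult_bounded[OF u continuous_measurable_lebesgue[OF f(1)]])
qed

text \<open>The combination of topologies that the solution offers: it is continuous in time with values in
  \<open>L\<^sup>1\<close>, so that it can be paired with anything that varies continuously in the uniform norm.\<close>

lemma pairing_tendsto:
  fixes V :: "'p \<Rightarrow> 'a \<Rightarrow> real" and G :: "'p \<Rightarrow> 'a \<Rightarrow> real"
  assumes V: "\<forall>\<^sub>F p in F. integrable M (V p)" and V0: "integrable M V0"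
    and VV0: "((\<lambda>p. LINT x|M. \<bar>V p x - V0 x\<bar>) \<longlongrightarrow> 0) F"
    and G: "\<forall>\<^sub>F p in F. G p \<in> borel_measurable M" and G0: "G0 \<in> borel_measurable M"
    and B: "\<And>x. \<bar>G0 x\<bar> \<le> B"
    and GG0: "\<And>e. e > 0 \<Longrightarrow> \<forall>\<^sub>F p in F. \<forall>x. \<bar>G p x - G0 x\<bar> \<le> e"
  shows "((\<lambda>p. LINT x|M. V p x * G p x) \<longlongrightarrow> (LINT x|M. V0 x * G0 x)) F"
proof (rule tendstoI)
  fix e :: real assume e: "e > 0"
  define N where "N = (LINT x|M. \<bar>V0 x\<bar>)"
  have N: "0 \<le> N" by (simp add: N_def)
  have B0: "0 \<le> B" using B[of undefined] by linarith
  define e1 where "e1 = min 1 (e / (2 * (N + 1)))"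
  have e1: "0 < e1" "e1 \<le> 1" "e1 * N < e / 2"
  proof -
    show "0 < e1" "e1 \<le> 1" using e N by (auto simp: e1_def)
    have "e1 * N \<le> e / (2 * (N + 1)) * N" by (intro mult_right_mono) (auto simp: e1_def N)
    also have "\<dots> < e / 2" using e N by (simp add: field_simps)
    finally show "e1 * N < e / 2" .
  qed
  have "\<forall>\<^sub>F p in F. (LINT x|M. \<bar>V p x - V0 x\<bar>) < e / (2 * (B + 1))"
    using order_tendstoD(2)[OF VV0, of "e / (2 * (B + 1))"] e B0 by simp
  with V G GG0[OF e1(1)]
  show "\<forall>\<^sub>F p in F. dist (LINT x|M. V p x * G p x) (LINT x|M. V0 x * G0 x) < e"
  proof eventually_elim
    case (elim p)
    have Gp: "\<bar>G p x\<bar> \<le> B + 1" for x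
      using elim(3) B[of x] e1(2) by (smt (verit))
    have i1: "integrable M (\<lambda>x. V p x * G p x)" by (rule integrable_mult_bounded[OF elim(1,2) Gp])
    have i2: "integrable M (\<lambda>x. V0 x * G0 x)" by (rule integrable_mult_bounded[OF V0 G0 B])
    have iD: "integrable M (\<lambda>x. \<bar>V p x - V0 x\<bar>)" using elim(1) V0 by simp
    have "(LINT x|M. V p x * G p x) - (LINT x|M. V0 x * G0 x) = (LINT x|M. V p x * G p x - V0 x * G0 x)"
      using i1 i2 by simp
    also have "\<bar>\<dots>\<bar> \<le> (LINT x|M. \<bar>V p x * G p x - V0 x * G0 x\<bar>)" by (rule integral_abs_bound)
    also have "\<dots> \<le> (LINT x|M. (B + 1) * \<bar>V p x - V0 x\<bar> + e1 * \<bar>V0 x\<bar>)"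
    proof (rule integral_mono)
      fix x
      have "V p x * G p x - V0 x * G0 x = G p x * (V p x - V0 x) + (G p x - G0 x) * V0 x"
        by (simp add: algebra_simps)
      also have "\<bar>\<dots>\<bar> \<le> \<bar>G p x * (V p x - V0 x)\<bar> + \<bar>(G p x - G0 x) * V0 x\<bar>"
        by (rule abs_triangle_ineq)
      also have "\<dots> \<le> (B + 1) * \<bar>V p x - V0 x\<bar> + e1 * \<bar>V0 x\<bar>"
        unfolding abs_mult using elim(3) Gp by (intro add_mono mult_right_mono) auto
      finally show "\<bar>V p x * G p x - V0 x * G0 x\<bar> \<le> (B + 1) * \<bar>V p x - V0 x\<bar> + e1 * \<bar>V0 x\<bar>" .
    qed (use i1 i2 iD V0 in auto)
    also have "\<dots> = (B + 1) * (LINT x|M. \<bar>V p x - V0 x\<bar>) + e1 * N"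
      using iD V0 by (simp add: N_def)
    also have "\<dots> < (B + 1) * (e / (2 * (B + 1))) + e / 2"
      using elim(4) e1(3) B0 by (intro add_strict_mono mult_strict_left_mono) auto
    also have "\<dots> = e" using B0 by (simp add: field_simps)
    finally show ?case by (simp add: dist_real_def)
  qed
qed

lemma pairing_continuous_on:
  fixes v g :: "real \<Rightarrow> 'a::euclidean_space \<Rightarrow> real"
  assumes v: "\<And>t. t \<in> S \<Longrightarrow> integrable lebesgue (v t)"
    and L1: "\<And>t. t \<in> S \<Longrightarrow> ((\<lambda>s. LINT x|lebesgue. \<bar>v s x - v t x\<bar>) \<longlongrightarrow> 0) (at t within S)"
    and S: "compact S"
    and g: "continuous_on (S \<times> UNIV) (\<lambda>(t, x). g t x)"
    and C: "compact C" "\<And>t x. t \<in> S \<Longrightarrow> x \<notin> C \<Longrightarrow> g t x = 0"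
  shows "continuous_on S (\<lambda>t. LINT x|lebesgue. v t x * g t x)"
  unfolding continuous_on_def
proof
  fix t assume t: "t \<in> S"
  have gx: "g s \<in> borel_measurable lebesgue" if "s \<in> S" for s
    by (rule continuous_measurable_lebesgue[OF continuous_on_slice[OF g that]])
  have SC: "compact (S \<times> C)" by (intro compact_Times S C)
  have gSC: "continuous_on (S \<times> C) (\<lambda>(t, x). g t x)" by (rule continuous_on_subset[OF g]) auto
  have ev_S: "\<forall>\<^sub>F s in at t within S. s \<in> S" by (simp add: eventually_at_filter)
  obtain B where B: "\<And>x. \<bar>g t x\<bar> \<le> B"
    using bounded_compact_support[OF continuous_on_slice[OF g t] C(1) C(2)[OF t]] by blast
  show "((\<lambda>t. LINT x|lebesgue. v t x * g t x) \<longlongrightarrow> (LINT x|lebesgue. v t x * g t x)) (at t within S)"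
  proof (rule pairing_tendsto[OF _ v[OF t] L1[OF t] _ gx[OF t] B])
    show "\<forall>\<^sub>F s in at t within S. integrable lebesgue (v s)"
      using ev_S by eventually_elim (rule v)
    show "\<forall>\<^sub>F s in at t within S. g s \<in> borel_measurable lebesgue"
      using ev_S by eventually_elim (rule gx)
    fix e :: real assume e: "e > 0"
    obtain d where d: "d > 0"
      "\<And>p q. p \<in> S \<times> C \<Longrightarrow> q \<in> S \<times> C \<Longrightarrow> dist q p < d \<Longrightarrow>
        dist ((\<lambda>(t, x). g t x) q) ((\<lambda>(t, x). g t x) p) < e"
      using compact_uniformly_continuous[OF gSC SC] e unfolding uniformly_continuous_on_def by metis
    have "\<forall>\<^sub>F s in at t within S. dist s t < d"
      using d(1) unfolding eventually_at by (intro exI[of _ d]) auto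
    with ev_S show "\<forall>\<^sub>F s in at t within S. \<forall>x. \<bar>g s x - g t x\<bar> \<le> e"
    proof eventually_elim
      case (elim s)
      show ?case
      proof
        fix x
        show "\<bar>g s x - g t x\<bar> \<le> e"
        proof (cases "x \<in> C")
          case True
          have "dist (s, x) (t, x) < d" using elim(2) by (simp add: dist_Pair_Pair)
          then show ?thesis using d(2)[of "(t, x)" "(s, x)"] True elim(1) t by (simp add: dist_real_def)
        next
          case False
          then show ?thesis using C(2) elim(1) t e by simp
        qed
      qed
    qed
  qed
qed

section \<open>Test functions transported by the flow\<close>

text \<open>The gradient vanishes outside \<open>C\<close>, because \<open>f\<close> vanishes on an open set there, and is bounded on \<open>C\<close>.\<close>

lemma bounded_lipschitz_of_compact_gradient:
  fixes f :: "'a::euclidean_space \<Rightarrow> real"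
  assumes d: "\<And>x. (f has_derivative (\<lambda>h. h \<bullet> \<Gamma> x)) (at x)" and \<Gamma>: "continuous_on UNIV \<Gamma>"
    and C: "compact C" "\<And>x. x \<notin> C \<Longrightarrow> f x = 0"
  obtains B where "B > 0" "\<And>x. \<bar>f x\<bar> \<le> B" "\<And>x y. \<bar>f x - f y\<bar> \<le> B * norm (x - y)"
proof -
  have f: "continuous_on UNIV f" using Ck_continuous[OF Ck1_gradientI[OF d \<Gamma>]] .
  have "bounded (f ` C)" "bounded (\<Gamma> ` C)"
    using f \<Gamma> C(1) continuous_on_subset by (blast intro!: compact_imp_bounded compact_continuous_image)+
  then obtain B1 B2 where B: "B1 > 0" "\<And>x. x \<in> C \<Longrightarrow> norm (f x) \<le> B1" "B2 > 0" "\<And>x. x \<in> C \<Longrightarrow> norm (\<Gamma> x) \<le> B2"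
    unfolding bounded_pos by (metis imageI)
  have grad: "norm (\<Gamma> x) \<le> B2" for x
  proof (cases "x \<in> C")
    case False
    have "((\<lambda>x. 0) has_derivative (\<lambda>h. 0)) (at x)" by simp
    then have "(f has_derivative (\<lambda>h. 0)) (at x)"
      by (rule has_derivative_transform_within_open[of _ _ _ _ "- C"])
        (use False C in \<open>auto simp: compact_imp_closed\<close>)
    then have "(\<lambda>h. h \<bullet> \<Gamma> x) = (\<lambda>h. 0)" using d[of x] has_derivative_unique by blast
    then have "\<Gamma> x \<bullet> \<Gamma> x = 0" by metis
    then show ?thesis using B(3) by simp
  qed (use B in auto)
  have "norm (f x - f y) \<le> B2 * norm (x - y)" for x y
  proof (rule differentiable_bound[of UNIV f "\<lambda>x h. h \<bullet> \<Gamma> x"])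
    show "onorm (\<lambda>h. h \<bullet> \<Gamma> x) \<le> B2" for x
    proof (rule onorm_le)
      fix h
      have "norm (h \<bullet> \<Gamma> x) \<le> norm h * norm (\<Gamma> x)" using Cauchy_Schwarz_ineq2 by simp
      also have "\<dots> \<le> B2 * norm h" using mult_left_mono[OF grad[of x] norm_ge_zero[of h]] by (simp add: mult.commute)
      finally show "norm (h \<bullet> \<Gamma> x) \<le> B2 * norm h" .
    qed
  qed (use d in auto)
  moreover have "B2 * norm (x - y) \<le> max B1 B2 * norm (x - y)" for x y :: 'a
    by (intro mult_right_mono) auto
  ultimately have "\<bar>f x - f y\<bar> \<le> max B1 B2 * norm (x - y)" for x y
    by (metis order_trans real_norm_def)
  moreover have "\<bar>f x\<bar> \<le> max B1 B2" for x
    using B(1) B(2)[of x] C(2)[of x] by (cases "x \<in> C") auto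
  ultimately show ?thesis using that[of "max B1 B2"] B by simp
qed

lemma abs_deriv_le_of_increment:
  fixes g :: "real \<Rightarrow> real"
  assumes g: "(g has_real_derivative D) (at 0)" and K: "\<And>s. 0 < s \<Longrightarrow> s \<le> 1 \<Longrightarrow> \<bar>g s - g 0\<bar> \<le> K * s"
  shows "\<bar>D\<bar> \<le> K"
proof -
  have "((\<lambda>s. (g s - g 0) / (s - 0)) \<longlongrightarrow> D) (at_right 0)"
    using g by (auto simp: has_field_derivative_iff intro: tendsto_mono[OF at_le])
  then have "((\<lambda>s. \<bar>(g s - g 0) / (s - 0)\<bar>) \<longlongrightarrow> \<bar>D\<bar>) (at_right 0)" by (rule tendsto_rabs)
  then show ?thesis
  proof (rule tendsto_upperbound)
    show "\<forall>\<^sub>F s in at_right 0. \<bar>(g s - g 0) / (s - 0)\<bar> \<le> K"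
      unfolding eventually_at_right_field
      by (intro exI[of _ 1]) (use K in \<open>auto simp: divide_simps mult.commute\<close>)
  qed simp
qed

locale transported_test = lipschitz_flow a X L
  for a :: "'a::euclidean_space \<Rightarrow> 'a" and X :: "real \<Rightarrow> 'a \<Rightarrow> 'a" and L :: real +
  fixes \<theta> :: "'a \<Rightarrow> real" and d\<theta> :: "'a \<Rightarrow> 'a" and C :: "'a set" and M :: real
  assumes \<theta>_deriv: "\<And>x. (\<theta> has_derivative (\<lambda>h. h \<bullet> d\<theta> x)) (at x)"
    and d\<theta>_cont: "continuous_on UNIV d\<theta>"
    and C: "compact C" and \<theta>_out: "\<And>x. x \<notin> C \<Longrightarrow> \<theta> x = 0"
    and M: "0 < M" "\<And>x. \<bar>\<theta> x\<bar> \<le> M" "\<And>x y. \<bar>\<theta> x - \<theta> y\<bar> \<le> M * norm (x - y)"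
begin

lemma \<theta>_cont: "continuous_on UNIV \<theta>"
  using Ck_continuous[OF Ck1_gradientI[OF \<theta>_deriv d\<theta>_cont]] .

lemma continuous_on_\<theta> [continuous_intros]: "continuous_on S f \<Longrightarrow> continuous_on S (\<lambda>p. \<theta> (f p))"
  by (rule continuous_on_compose2[OF \<theta>_cont]) auto

lemma continuous_on_d\<theta> [continuous_intros]: "continuous_on S f \<Longrightarrow> continuous_on S (\<lambda>p. d\<theta> (f p))"
  by (rule continuous_on_compose2[OF d\<theta>_cont]) auto

lemma continuous_on_a [continuous_intros]: "continuous_on S f \<Longrightarrow> continuous_on S (\<lambda>p. a (f p))"
  by (rule continuous_on_compose2[OF continuous_a]) auto

lemma \<theta>_X_deriv:
  "((\<lambda>t. \<theta> (X (- t) z)) has_real_derivative - (a (X (- t) z) \<bullet> d\<theta> (X (- t) z))) (at t)"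
proof -
  have "((\<lambda>t. X (- t) z) has_derivative (\<lambda>h. h *\<^sub>R (- a (X (- t) z)))) (at t)"
    using X_deriv_shift[of 0 "-1" z t UNIV] by (simp add: has_vector_derivative_def)
  from has_derivative_compose[OF this \<theta>_deriv] show ?thesis
    by (rule has_derivative_imp_has_field_derivative) (simp add: mult.commute)
qed

text \<open>This compact set contains the supports of all functions \<open>\<theta> (X (- t) x)\<close> of \<open>x\<close> with \<open>t\<close> in the interval.\<close>

definition swept :: "real \<Rightarrow> real \<Rightarrow> 'a set"
  where "swept t1 t2 = (\<lambda>p. X (fst p) (snd p)) ` ({t1..t2} \<times> C)"

lemma compact_swept: "compact (swept t1 t2)"
  unfolding swept_def by (intro compact_X_image C) simp

lemma swept_memI: "t \<in> {t1..t2} \<Longrightarrow> \<theta> (X (- t) z) \<noteq> 0 \<Longrightarrow> z \<in> swept t1 t2"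
  unfolding swept_def using \<theta>_out[of "X (- t) z"]
  by (intro image_eqI[of _ _ "(t, X (- t) z)"]) auto

lemma \<theta>_X_out: "t \<in> {t1..t2} \<Longrightarrow> z \<notin> swept t1 t2 \<Longrightarrow> \<theta> (X (- t) z) = 0"
  using swept_memI by blast

end

locale timed_test = transported_test a X L \<theta> d\<theta> C M
  for a :: "'a::euclidean_space \<Rightarrow> 'a" and X :: "real \<Rightarrow> 'a \<Rightarrow> 'a" and L :: real
    and \<theta> :: "'a \<Rightarrow> real" and d\<theta> :: "'a \<Rightarrow> 'a" and C :: "'a set" and M :: real +
  fixes \<eta> \<eta>' :: "real \<Rightarrow> real" and T1 T2 :: real and E :: real
  assumes \<eta>_deriv: "\<And>t. (\<eta> has_real_derivative \<eta>' t) (at t)" and \<eta>'_cont: "continuous_on UNIV \<eta>'"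
    and T12: "T1 \<le> 0" "0 \<le> T2" and \<eta>_out: "\<And>t. t \<notin> {T1..T2} \<Longrightarrow> \<eta> t = 0"
    and E: "0 < E" "\<And>t. \<bar>\<eta> t\<bar> \<le> E" "\<And>s t. \<bar>\<eta> s - \<eta> t\<bar> \<le> E * \<bar>s - t\<bar>"
begin

lemma continuous_on_\<eta> [continuous_intros]: "continuous_on S f \<Longrightarrow> continuous_on S (\<lambda>p. \<eta> (f p))"
  by (rule continuous_on_compose2[of UNIV \<eta>]) (use \<eta>_deriv DERIV_continuous_on in blast)+

lemma continuous_on_\<eta>' [continuous_intros]: "continuous_on S f \<Longrightarrow> continuous_on S (\<lambda>p. \<eta>' (f p))"
  by (rule continuous_on_compose2[OF \<eta>'_cont]) auto

definition h :: "real \<Rightarrow> 'a \<Rightarrow> real"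
  where "h t z = \<eta> t * \<theta> (X (- t) z)"

definition h' :: "real \<Rightarrow> 'a \<Rightarrow> real"
  where "h' t z = \<eta>' t * \<theta> (X (- t) z) - \<eta> t * (a (X (- t) z) \<bullet> d\<theta> (X (- t) z))"

lemma h_deriv: "((\<lambda>t. h t z) has_real_derivative h' t z) (at t)"
  unfolding h_def[abs_def] h'_def
  by (rule DERIV_cong[OF DERIV_mult[OF \<eta>_deriv \<theta>_X_deriv]]) simp

lemma h_cont [continuous_intros]:
  "continuous_on S f \<Longrightarrow> continuous_on S g \<Longrightarrow> continuous_on S (\<lambda>p. h (f p) (g p))"
  unfolding h_def by (intro continuous_intros)

lemma h'_cont [continuous_intros]:
  "continuous_on S f \<Longrightarrow> continuous_on S g \<Longrightarrow> continuous_on S (\<lambda>p. h' (f p) (g p))"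
  unfolding h'_def by (intro continuous_intros)

lemma h_out: "z \<notin> swept T1 T2 \<Longrightarrow> h t z = 0"
  unfolding h_def using \<theta>_X_out[of t T1 T2 z] \<eta>_out[of t] by (cases "t \<in> {T1..T2}") auto

text \<open>Mollifying \<open>h\<close> in space makes it a \<open>C\<^sup>1\<close> function while using no more than the Lipschitz continuity of the
  flow in the initial point.\<close>

definition test :: "real \<Rightarrow> real \<times> 'a \<Rightarrow> real"
  where "test \<epsilon> p = (LINT z|lebesgue. h (fst p) (snd p - z) * mollifier \<epsilon> z)"

text \<open>By the Leibniz rule, after moving the mollifier to \<open>snd p - z\<close>: the spatial derivatives then fall on
  the mollifier, and the time derivative on \<open>\<eta>\<close> and on the trajectory through \<open>z\<close>.\<close>

lemma test_C1:
  assumes \<epsilon>: "\<epsilon> > 0"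
  obtains \<Gamma> where "\<And>p. (test \<epsilon> has_derivative (\<lambda>k. k \<bullet> \<Gamma> p)) (at p)" "continuous_on UNIV \<Gamma>"
proof -
  obtain c d where Q: "swept T1 T2 \<subseteq> cbox c d"
    using bounded_subset_cbox_symmetric[OF compact_imp_bounded[OF compact_swept]] by metis
  define G where "G = (\<lambda>p z. (h' (fst p) z * mollifier \<epsilon> (snd p - z), h (fst p) z *\<^sub>R mollifier_grad \<epsilon> (snd p - z)))"
  have test_eq: "test \<epsilon> p = integral (cbox c d) (\<lambda>z. h (fst p) z * mollifier \<epsilon> (snd p - z))" for p
  proof -
    have c: "continuous_on UNIV (\<lambda>z. h (fst p) z * mollifier \<epsilon> (snd p - z))"
      by (intro continuous_intros)
    have "integral (cbox c d) (\<lambda>z. h (fst p) z * mollifier \<epsilon> (snd p - z)) =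
        (LINT z|lebesgue. h (fst p) z * mollifier \<epsilon> (snd p - z))"
      by (rule integral_cbox_eq_LINT[OF c]) (use h_out Q in auto)
    also have "\<dots> = test \<epsilon> p"
      using LINT_reflect[OF c, of "snd p"] by (simp add: test_def)
    finally show ?thesis by simp
  qed
  have G_cont: "continuous_on (UNIV \<times> cbox c d) (\<lambda>(p, z). G p z)"
    unfolding G_def case_prod_unfold by (intro continuous_intros)
  have G_int: "G p integrable_on cbox c d" for p
    unfolding G_def by (intro integrable_continuous continuous_intros)
  have der: "((\<lambda>p. h (fst p) z * mollifier \<epsilon> (snd p - z)) has_derivative blinfun_inner_left (G p z)) (at p within UNIV)" for p z
  proof -
    have 1: "((\<lambda>p. h (fst p) z) has_derivative (\<lambda>k. h' (fst p) z * fst k)) (at p)" for p :: "real \<times> 'a"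
      by (rule has_derivative_compose[OF _ h_deriv[unfolded has_field_derivative_def]])
        (auto intro!: derivative_eq_intros)
    have 2: "((\<lambda>p. mollifier \<epsilon> (snd p - z)) has_derivative (\<lambda>k. snd k \<bullet> mollifier_grad \<epsilon> (snd p - z))) (at p)"
      for p :: "real \<times> 'a"
      by (rule has_derivative_compose[OF _ mollifier_has_derivative]) (auto intro!: derivative_eq_intros)
    show ?thesis
      by (rule has_derivative_eq_rhs[OF has_derivative_mult[OF 1 2]])
        (auto simp: G_def inner_prod_def algebra_simps blinfun_inner_left.rep_eq)
  qed
  show ?thesis
  proof
    show "continuous_on UNIV (\<lambda>p. integral (cbox c d) (G p))"
      by (rule integral_continuous_on_param[OF G_cont])
    fix p
    have bl: "(\<lambda>z. blinfun_inner_left (G p z)) integrable_on cbox c d"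
      unfolding G_def by (intro integrable_continuous bounded_linear.continuous_on[OF bounded_linear_blinfun_inner_left]
          continuous_intros)
    have "((\<lambda>p. integral (cbox c d) (\<lambda>z. h (fst p) z * mollifier \<epsilon> (snd p - z))) has_derivative
        blinfun_apply (integral (cbox c d) (\<lambda>z. blinfun_inner_left (G p z)))) (at p within UNIV)"
    proof (rule leibniz_rule[OF der])
      show "(\<lambda>z. h (fst p) z * mollifier \<epsilon> (snd p - z)) integrable_on cbox c d" for p
        by (intro integrable_continuous continuous_intros)
      show "continuous_on (UNIV \<times> cbox c d) (\<lambda>(p, z). blinfun_inner_left (G p z))"
        using bounded_linear.continuous_on[OF bounded_linear_blinfun_inner_left G_cont]
        by (simp add: case_prod_unfold)
    qed auto
    moreover have "blinfun_apply (integral (cbox c d) (\<lambda>z. blinfun_inner_left (G p z))) k = k \<bullet> integral (cbox c d) (G p)" for k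
    proof -
      have "blinfun_apply (integral (cbox c d) (\<lambda>z. blinfun_inner_left (G p z))) k =
          integral (cbox c d) (\<lambda>z. k \<bullet> G p z)"
        using integral_linear[OF bl blinfun.bounded_linear_left[of k]]
        by (simp add: o_def blinfun_inner_left.rep_eq)
      also have "\<dots> = k \<bullet> integral (cbox c d) (G p)"
        using integral_linear[OF G_int bounded_linear_inner_right[of k]] by (simp add: o_def)
      finally show ?thesis .
    qed
    then have "blinfun_apply (integral (cbox c d) (\<lambda>z. blinfun_inner_left (G p z))) =
        (\<lambda>k. k \<bullet> integral (cbox c d) (G p))" ..
    ultimately show "(test \<epsilon> has_derivative (\<lambda>k. k \<bullet> integral (cbox c d) (G p))) (at p)"
      by (simp add: test_eq[abs_def])
  qed
qed

lemma test_out: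
  assumes \<epsilon>: "\<epsilon> > 0" and ne: "test \<epsilon> (t, x) \<noteq> 0"
  shows "t \<in> {T1..T2}" "\<exists>z\<in>cball x \<epsilon>. \<theta> (X (- t) z) \<noteq> 0"
proof -
  have "\<exists>z. h t (x - z) * mollifier \<epsilon> z \<noteq> 0"
  proof (rule ccontr)
    assume "\<nexists>z. h t (x - z) * mollifier \<epsilon> z \<noteq> 0"
    then have "(\<lambda>z. h t (x - z) * mollifier \<epsilon> z) = (\<lambda>z. 0)" by auto
    then have "test \<epsilon> (t, x) = 0" by (simp add: test_def)
    then show False using ne by simp
  qed
  then obtain z where z: "h t (x - z) \<noteq> 0" "mollifier \<epsilon> z \<noteq> 0" by auto
  have "norm z < \<epsilon>" using z(2) mollifier_outside[of \<epsilon> z] \<epsilon> by fastforce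
  then show "\<exists>z\<in>cball x \<epsilon>. \<theta> (X (- t) z) \<noteq> 0"
    using z(1) by (intro bexI[of _ "x - z"]) (auto simp: h_def dist_norm)
  show "t \<in> {T1..T2}" using z(1) \<eta>_out by (auto simp: h_def)
qed

definition spread :: "'a set"
  where "spread = {u + w |u w. u \<in> swept T1 T2 \<and> w \<in> cball 0 1}"

lemma compact_spread: "compact spread"
  unfolding spread_def by (rule compact_sums[OF compact_swept compact_cball])

lemma test_out_spread:
  assumes \<epsilon>: "\<epsilon> > 0" "\<epsilon> \<le> 1" and ne: "test \<epsilon> (t, x) \<noteq> 0"
  shows "x \<in> spread"
proof -
  obtain z where z: "z \<in> cball x \<epsilon>" "\<theta> (X (- t) z) \<noteq> 0" using test_out(2)[OF \<epsilon>(1) ne] by blast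
  have "z \<in> swept T1 T2" by (rule swept_memI[OF test_out(1)[OF \<epsilon>(1) ne] z(2)])
  moreover have "x - z \<in> cball 0 1" using z(1) \<epsilon> by (simp add: dist_norm norm_minus_commute)
  moreover have "x = z + (x - z)" by simp
  ultimately show ?thesis unfolding spread_def by blast
qed

lemma test_close:
  assumes \<epsilon>: "\<epsilon> > 0" and t: "0 \<le> t" "t \<le> T"
  shows "\<bar>test \<epsilon> (t, x) - \<eta> t * \<theta> (X (- t) x)\<bar> \<le> E * M * exp (L * T) * \<epsilon>"
  unfolding test_def fst_conv snd_conv
proof (rule mollifier_average_bound[OF \<epsilon>])
  show "continuous_on UNIV (\<lambda>z. h t (x - z))" by (intro continuous_intros)
  fix z :: 'a assume z: "norm z \<le> \<epsilon>"
  have "\<bar>\<theta> (X (- t) (x - z)) - \<theta> (X (- t) x)\<bar> \<le> M * norm (X (- t) (x - z) - X (- t) x)" by (rule M)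
  also have "\<dots> \<le> M * (exp (L * \<bar>- t\<bar>) * norm ((x - z) - x))" using M(1) by (intro mult_left_mono X_lipschitz) auto
  also have "\<dots> \<le> M * (exp (L * T) * \<epsilon>)"
    using M(1) z t L_pos by (intro mult_left_mono mult_mono) auto
  finally have *: "\<bar>\<theta> (X (- t) (x - z)) - \<theta> (X (- t) x)\<bar> \<le> M * (exp (L * T) * \<epsilon>)" .
  have "\<bar>h t (x - z) - \<eta> t * \<theta> (X (- t) x)\<bar> = \<bar>\<eta> t\<bar> * \<bar>\<theta> (X (- t) (x - z)) - \<theta> (X (- t) x)\<bar>"
    by (simp add: h_def abs_mult[symmetric] right_diff_distrib)
  also have "\<dots> \<le> E * (M * (exp (L * T) * \<epsilon>))" by (intro mult_mono * E) (use E in auto)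
  finally show "\<bar>h t (x - z) - \<eta> t * \<theta> (X (- t) x)\<bar> \<le> E * M * exp (L * T) * \<epsilon>" by (simp add: mult.assoc)
qed

text \<open>Along a characteristic \<open>s \<mapsto> (t + s, X s x)\<close> the unmollified function changes through \<open>\<eta>\<close> only. The
  mollified one averages over the characteristics through \<open>x - z\<close>, which drift away from the
  translated characteristic by \<open>O(s \<bar>z\<bar>)\<close>.\<close>

lemma test_transport:
  assumes \<epsilon>: "\<epsilon> > 0" and t: "0 \<le> t" "t \<le> T"
    and \<Gamma>: "(test \<epsilon> has_derivative (\<lambda>k. k \<bullet> \<Gamma>)) (at (t, x))"
  shows "\<bar>(1, a x) \<bullet> \<Gamma> - \<eta>' t * \<theta> (X (- t) x)\<bar> \<le> (E * M * exp (L * (T + 1)) * (L * exp L + 1)) * \<epsilon>"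
proof (rule abs_deriv_le_of_increment)
  define g where "g = (\<lambda>s. test \<epsilon> (t + s, X s x) - \<eta> (t + s) * \<theta> (X (- t) x))"
  have 1: "((\<lambda>s. (t + s, X s x)) has_derivative (\<lambda>k. k *\<^sub>R (1, a x))) (at 0)"
    using X_deriv[of x 0 UNIV] unfolding has_vector_derivative_def
    by (auto intro!: derivative_eq_intros)
  have 2: "((\<lambda>s. test \<epsilon> (t + s, X s x)) has_real_derivative (1, a x) \<bullet> \<Gamma>) (at 0)"
    using has_derivative_compose[OF 1, of "test \<epsilon>" "\<lambda>k. k \<bullet> \<Gamma>"] \<Gamma>
    by (intro has_derivative_imp_has_field_derivative) (auto simp: mult.commute inner_prod_def algebra_simps)
  have 3: "((\<lambda>s. \<eta> (t + s) * \<theta> (X (- t) x)) has_real_derivative \<eta>' t * \<theta> (X (- t) x)) (at 0)"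
    using DERIV_shift[of \<eta> "\<eta>' t" 0 t] \<eta>_deriv[of t] by (intro DERIV_cmult_right) (simp add: add.commute)
  show "(g has_real_derivative (1, a x) \<bullet> \<Gamma> - \<eta>' t * \<theta> (X (- t) x)) (at 0)"
    unfolding g_def by (rule DERIV_diff[OF 2 3])
  fix s :: real assume s: "0 < s" "s \<le> 1"
  define c where "c = (\<eta> (t + s) - \<eta> t) * \<theta> (X (- t) x)"
  define e where "e = (E * M * exp (L * (T + 1)) * (L * exp L + 1)) * \<epsilon> * s"
  have i: "integrable lebesgue (\<lambda>z. h (t + s) (X s x - z) * mollifier \<epsilon> z)"
    "integrable lebesgue (\<lambda>z. h t (x - z) * mollifier \<epsilon> z)"
    by (intro integrable_mollifier_mult \<epsilon> continuous_intros)+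
  have "g s - g 0 = (LINT z|lebesgue. (h (t + s) (X s x - z) - h t (x - z)) * mollifier \<epsilon> z) - c"
    using i by (simp add: g_def test_def c_def left_diff_distrib)
  also have "\<bar>\<dots>\<bar> \<le> e"
  proof (rule mollifier_average_bound[OF \<epsilon>])
    show "continuous_on UNIV (\<lambda>z. h (t + s) (X s x - z) - h t (x - z))" by (intro continuous_intros)
    fix z :: 'a assume z: "norm z \<le> \<epsilon>"
    define A where "A = \<theta> (X (- (t + s)) (X s x - z)) - \<theta> (X (- (t + s)) (X s (x - z)))"
    define B where "B = \<theta> (X (- t) (x - z)) - \<theta> (X (- t) x)"
    have "X (- (t + s)) (X s (x - z)) = X (- t) (x - z)"
      using X_add[of "- (t + s)" s "x - z"] by simp
    then have eq: "h (t + s) (X s x - z) - h t (x - z) - c = \<eta> (t + s) * A + (\<eta> (t + s) - \<eta> t) * B"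
      by (simp add: h_def c_def A_def B_def algebra_simps)
    have "\<bar>A\<bar> \<le> M * norm (X (- (t + s)) (X s x - z) - X (- (t + s)) (X s (x - z)))"
      unfolding A_def by (rule M)
    also have "\<dots> \<le> M * (exp (L * \<bar>- (t + s)\<bar>) * norm ((X s x - z) - X s (x - z)))"
      using M(1) by (intro mult_left_mono X_lipschitz) auto
    also have "\<dots> \<le> M * (exp (L * (T + 1)) * (s * (L * exp L) * \<epsilon>))"
    proof (intro mult_left_mono mult_mono)
      show "norm ((X s x - z) - X s (x - z)) \<le> s * (L * exp L) * \<epsilon>"
      proof -
        have "norm ((X s x - z) - X s (x - z)) \<le> s * (L * exp L) * norm z"
          using displacement_difference[of s x z] s by (simp add: norm_minus_commute)
        also have "\<dots> \<le> s * (L * exp L) * \<epsilon>" using z s L_pos by (intro mult_left_mono) auto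
        finally show ?thesis .
      qed
    qed (use M(1) t s L_pos in auto)
    finally have A: "\<bar>A\<bar> \<le> M * (exp (L * (T + 1)) * (s * (L * exp L) * \<epsilon>))" .
    have "\<bar>B\<bar> \<le> M * norm (X (- t) (x - z) - X (- t) x)" unfolding B_def by (rule M)
    also have "\<dots> \<le> M * (exp (L * \<bar>- t\<bar>) * norm ((x - z) - x))"
      using M(1) by (intro mult_left_mono X_lipschitz) auto
    also have "\<dots> \<le> M * (exp (L * (T + 1)) * \<epsilon>)"
      using M(1) t z L_pos by (intro mult_left_mono mult_mono) auto
    finally have B: "\<bar>B\<bar> \<le> M * (exp (L * (T + 1)) * \<epsilon>)" .
    have "\<bar>\<eta> (t + s) * A + (\<eta> (t + s) - \<eta> t) * B\<bar> \<le> \<bar>\<eta> (t + s)\<bar> * \<bar>A\<bar> + \<bar>\<eta> (t + s) - \<eta> t\<bar> * \<bar>B\<bar>"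
      by (metis abs_mult abs_triangle_ineq)
    also have "\<dots> \<le> E * (M * (exp (L * (T + 1)) * (s * (L * exp L) * \<epsilon>))) + (E * s) * (M * (exp (L * (T + 1)) * \<epsilon>))"
    proof (intro add_mono mult_mono A B E(2))
      show "\<bar>\<eta> (t + s) - \<eta> t\<bar> \<le> E * s" using E(3)[of "t + s" t] s by simp
    qed (use E(1) s in auto)
    also have "\<dots> = e" by (simp add: e_def algebra_simps)
    finally show "\<bar>h (t + s) (X s x - z) - h t (x - z) - c\<bar> \<le> e" unfolding eq .
  qed
  finally show "\<bar>g s - g 0\<bar> \<le> (E * M * exp (L * (T + 1)) * (L * exp L + 1)) * \<epsilon> * s" by (simp add: e_def)
qed

end

section \<open>The weak equation along the flow\<close>

text \<open>The equation \<open>\<partial>\<^sub>t v + div (a v) = c v\<close>, known only for test functions that vanish on \<open>N\<close>. Trajectories from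
  the support \<open>C\<close> of \<open>\<theta>\<close> avoid \<open>N\<close>, so that the transported test functions are admissible. \<open>F\<close> and \<open>P\<close> below
  are the mass of \<open>v t\<close> weighted by the transported \<open>\<theta>\<close>, and its production rate.\<close>

locale transport_problem = transported_test a X L \<theta> d\<theta> C M
  for a :: "'a::euclidean_space \<Rightarrow> 'a" and X :: "real \<Rightarrow> 'a \<Rightarrow> 'a" and L :: real
    and \<theta> :: "'a \<Rightarrow> real" and d\<theta> :: "'a \<Rightarrow> 'a" and C :: "'a set" and M :: real +
  fixes v :: "real \<Rightarrow> 'a \<Rightarrow> real" and v0 :: "'a \<Rightarrow> real" and c :: "real \<Rightarrow> 'a \<Rightarrow> real"
    and T :: real and N :: "'a set"
  assumes T: "0 < T"
    and v_int: "\<And>t. t \<in> {0..T} \<Longrightarrow> integrable lebesgue (v t)"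
    and v_L1: "\<And>t. t \<in> {0..T} \<Longrightarrow> ((\<lambda>s. LINT x|lebesgue. \<bar>v s x - v t x\<bar>) \<longlongrightarrow> 0) (at t within {0..T})"
    and v0_int: "integrable lebesgue v0"
    and c_cont: "continuous_on ({0..T} \<times> UNIV) (\<lambda>(t, x). c t x)"
    and N: "compact N" "\<And>t y. t \<in> {0..T} \<Longrightarrow> y \<in> C \<Longrightarrow> X t y \<notin> N"
    and weak: "\<And>\<phi>. spacetime_test T \<phi> \<Longrightarrow> (\<And>t y. t \<in> {0..T} \<Longrightarrow> y \<in> N \<Longrightarrow> \<phi> (t, y) = 0) \<Longrightarrow>
      (LINT t:{0..T}|lebesgue. LINT x|lebesgue. v t x *
        (- frechet_derivative \<phi> (at (t, x)) (1, 0) - frechet_derivative \<phi> (at (t, x)) (0, a x)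
         - c t x * \<phi> (t, x))) = (LINT x|lebesgue. v0 x * \<phi> (0, x))"
begin

definition F :: "real \<Rightarrow> real"
  where "F t = (LINT x|lebesgue. v t x * \<theta> (X (- t) x))"

definition P :: "real \<Rightarrow> real"
  where "P t = (LINT x|lebesgue. v t x * (c t x * \<theta> (X (- t) x)))"

lemma c_compose: "continuous_on S f \<Longrightarrow> continuous_on S g \<Longrightarrow> f ` S \<subseteq> {0..T} \<Longrightarrow>
    continuous_on S (\<lambda>p. c (f p) (g p))"
  using continuous_on_compose2[OF c_cont, of S "\<lambda>p. (f p, g p)"] by (auto intro: continuous_on_Pair)

lemma F_cont: "continuous_on {0..T} F"
  unfolding F_def[abs_def]
proof (rule pairing_continuous_on[OF v_int v_L1 _ _ compact_swept[of 0 T]])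
  show "continuous_on ({0..T} \<times> UNIV) (\<lambda>(t, x). \<theta> (X (- t) x))"
    unfolding case_prod_unfold by (intro continuous_intros)
qed (auto intro: \<theta>_X_out)

lemma P_cont: "continuous_on {0..T} P"
  unfolding P_def[abs_def]
proof (rule pairing_continuous_on[OF v_int v_L1 _ _ compact_swept[of 0 T]])
  show "continuous_on ({0..T} \<times> UNIV) (\<lambda>(t, x). c t x * \<theta> (X (- t) x))"
    unfolding case_prod_unfold by (intro continuous_intros c_compose) auto
qed (auto intro: \<theta>_X_out)

lemma mass_bounded: "\<exists>V. \<forall>t\<in>{0..T}. (LINT x|lebesgue. \<bar>v t x\<bar>) \<le> V"
proof -
  have "continuous_on {0..T} (\<lambda>t. LINT x|lebesgue. \<bar>v t x\<bar>)"
    unfolding continuous_on_def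
  proof
    fix t assume t: "t \<in> {0..T}"
    show "((\<lambda>t. LINT x|lebesgue. \<bar>v t x\<bar>) \<longlongrightarrow> (LINT x|lebesgue. \<bar>v t x\<bar>)) (at t within {0..T})"
    proof (rule LIM_zero_cancel, rule Lim_null_comparison[OF _ v_L1[OF t]])
      have "\<forall>\<^sub>F s in at t within {0..T}. s \<in> {0..T}" by (simp add: eventually_at_filter)
      then show "\<forall>\<^sub>F s in at t within {0..T}.
          norm ((LINT x|lebesgue. \<bar>v s x\<bar>) - (LINT x|lebesgue. \<bar>v t x\<bar>)) \<le> (LINT x|lebesgue. \<bar>v s x - v t x\<bar>)"
      proof eventually_elim
        case (elim s)
        note i = v_int[OF elim] v_int[OF t]
        have "norm (LINT x|lebesgue. \<bar>v s x\<bar> - \<bar>v t x\<bar>) \<le> (LINT x|lebesgue. norm (\<bar>v s x\<bar> - \<bar>v t x\<bar>))"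
          by (rule integral_norm_bound)
        also have "\<dots> \<le> (LINT x|lebesgue. \<bar>v s x - v t x\<bar>)"
          using i by (intro integral_mono) (auto intro: abs_triangle_ineq3)
        finally show ?case using i by simp
      qed
    qed
  qed
  then have "bounded ((\<lambda>t. LINT x|lebesgue. \<bar>v t x\<bar>) ` {0..T})"
    by (intro compact_imp_bounded compact_continuous_image) auto
  then show ?thesis unfolding bounded_iff by (force intro: order_trans[OF abs_ge_self])
qed

lemma pairing_diff_le:
  fixes u f g :: "'a \<Rightarrow> real"
  assumes u: "integrable lebesgue u" and f: "continuous_on UNIV f" "compact K" "\<And>x. x \<notin> K \<Longrightarrow> f x = 0"
    and g: "continuous_on UNIV g" "compact K'" "\<And>x. x \<notin> K' \<Longrightarrow> g x = 0"
    and le: "\<And>x. \<bar>f x - g x\<bar> \<le> e"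
  shows "\<bar>(LINT x|lebesgue. u x * f x) - (LINT x|lebesgue. u x * g x)\<bar> \<le> e * (LINT x|lebesgue. \<bar>u x\<bar>)"
proof -
  note i = integrable_mult_compact_support[OF u]
  have "(LINT x|lebesgue. u x * f x) - (LINT x|lebesgue. u x * g x) = (LINT x|lebesgue. u x * f x - u x * g x)"
    using i[OF f] i[OF g] by simp
  also have "\<bar>\<dots>\<bar> \<le> (LINT x|lebesgue. \<bar>u x * f x - u x * g x\<bar>)" by (rule integral_abs_bound)
  also have "\<dots> \<le> (LINT x|lebesgue. e * \<bar>u x\<bar>)"
  proof (rule integral_mono)
    fix x
    have "\<bar>u x * f x - u x * g x\<bar> = \<bar>u x\<bar> * \<bar>f x - g x\<bar>" by (simp add: abs_mult[symmetric] right_diff_distrib)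
    also have "\<dots> \<le> \<bar>u x\<bar> * e" by (intro mult_left_mono le) simp
    finally show "\<bar>u x * f x - u x * g x\<bar> \<le> e * \<bar>u x\<bar>" by (simp add: mult.commute)
  qed (use i[OF f] i[OF g] u in auto)
  finally show "\<bar>(LINT x|lebesgue. u x * f x) - (LINT x|lebesgue. u x * g x)\<bar> \<le> e * (LINT x|lebesgue. \<bar>u x\<bar>)" by simp
qed

text \<open>The mollified test function is inserted into the weak equation and the mollification parameter
  tends to zero; all errors are of the order of the parameter, uniformly on the support.\<close>

lemma weak_along_flow:
  assumes \<eta>: "\<And>t. (\<eta> has_real_derivative \<eta>' t) (at t)" "continuous_on UNIV \<eta>'"
    and TT: "T1 \<le> 0" "0 \<le> T2" "T2 < T" and out: "\<And>t. t \<notin> {T1..T2} \<Longrightarrow> \<eta> t = 0"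
  shows "integral {0..T} (\<lambda>t. - \<eta>' t * F t - \<eta> t * P t) = \<eta> 0 * (LINT x|lebesgue. v0 x * \<theta> x)"
proof -
  obtain E where E: "E > 0" "\<And>t. \<bar>\<eta> t\<bar> \<le> E" "\<And>s t. \<bar>\<eta> s - \<eta> t\<bar> \<le> E * norm (s - t)"
  proof (rule bounded_lipschitz_of_compact_gradient[of \<eta> \<eta>' "{T1..T2}"])
    show "(\<eta> has_derivative (\<lambda>h. h \<bullet> \<eta>' t)) (at t)" for t
      by (rule has_derivative_eq_rhs[OF \<eta>(1)[unfolded has_field_derivative_def]])
        (simp add: fun_eq_iff mult.commute)
  qed (use \<eta> out in auto)
  interpret timed_test a X L \<theta> d\<theta> C M \<eta> \<eta>' T1 T2 E
    by unfold_locales (use \<eta> TT out E in auto)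
  define K1 where "K1 = E * M * exp (L * T)"
  define K2 where "K2 = E * M * exp (L * (T + 1)) * (L * exp L + 1)"
  have K: "0 \<le> K1" "0 \<le> K2" using E M L_pos by (auto simp: K1_def K2_def)
  have "continuous_on ({0..T} \<times> spread) (\<lambda>(t, x). c t x)" by (rule continuous_on_subset[OF c_cont]) auto
  from compact_abs_bound[OF compact_Times[OF compact_Icc compact_spread] this]
  obtain cB where cB: "cB > 0" "\<And>t x. t \<in> {0..T} \<Longrightarrow> x \<in> spread \<Longrightarrow> \<bar>c t x\<bar> \<le> cB"
    by (metis SigmaI case_prod_conv)
  obtain V where V: "\<And>t. t \<in> {0..T} \<Longrightarrow> (LINT x|lebesgue. \<bar>v t x\<bar>) \<le> V" using mass_bounded by blast
  \<comment> \<open>Mollification at a scale below \<open>\<delta>\<close> does not spread the test function onto \<open>N\<close>.\<close>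
  have "swept 0 T \<inter> N = {}" using N(2) by (auto simp: swept_def)
  then obtain \<delta> where \<delta>: "\<delta> > 0" "\<And>x y. x \<in> swept 0 T \<Longrightarrow> y \<in> N \<Longrightarrow> \<delta> \<le> dist x y"
    using separate_compact_closed[OF compact_swept compact_imp_closed[OF N(1)]] by metis
  define K where "K = (K2 + cB * K1) * V * T + K1 * (LINT x|lebesgue. \<bar>v0 x\<bar>)"
  let ?W = "\<lambda>t. LINT x|lebesgue. v t x * (- \<eta>' t * \<theta> (X (- t) x) - c t x * h t x)"
  let ?A = "\<eta> 0 * (LINT x|lebesgue. v0 x * \<theta> x)"
  have h_spread: "h t x = 0" if "x \<notin> spread" for t x
  proof -
    have "x \<notin> swept T1 T2" using that unfolding spread_def by force
    then show ?thesis by (rule h_out)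
  qed
  have swept_out: "\<theta> (X (- t) x) = 0" if "t \<in> {0..T}" "x \<notin> spread \<union> swept 0 T" for t x
    using that by (intro \<theta>_X_out[of t 0 T]) auto
  have W_cont: "continuous_on {0..T} ?W"
  proof (rule pairing_continuous_on[OF v_int v_L1 _ _ compact_Un[OF compact_spread compact_swept[of 0 T]]])
    show "continuous_on ({0..T} \<times> UNIV) (\<lambda>(t, x). - \<eta>' t * \<theta> (X (- t) x) - c t x * h t x)"
      unfolding case_prod_unfold by (intro continuous_intros c_compose) auto
    show "- \<eta>' t * \<theta> (X (- t) x) - c t x * h t x = 0" if "t \<in> {0..T}" "x \<notin> spread \<union> swept 0 T" for t x
      using swept_out[OF that] h_spread[of x t] that by simp
  qed auto
  have close: "\<bar>integral {0..T} ?W - ?A\<bar> \<le> K * \<epsilon>" if \<epsilon>: "0 < \<epsilon>" "\<epsilon> \<le> 1" "\<epsilon> < \<delta>" for \<epsilon>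
  proof -
    obtain \<Gamma> where \<Gamma>: "\<And>p. (test \<epsilon> has_derivative (\<lambda>k. k \<bullet> \<Gamma> p)) (at p)" "continuous_on UNIV \<Gamma>"
      using test_C1[OF \<epsilon>(1)] by blast
    have fd: "frechet_derivative (test \<epsilon>) (at p) = (\<lambda>k. k \<bullet> \<Gamma> p)" for p
      using frechet_derivative_at[OF \<Gamma>(1)] by simp
    have box: "test \<epsilon> p \<noteq> 0 \<Longrightarrow> p \<in> {T1..T2} \<times> spread" for p
      using test_out(1)[OF \<epsilon>(1)] test_out_spread[OF \<epsilon>(1,2)] by (cases p) blast
    have st: "spacetime_test T (test \<epsilon>)"
      unfolding spacetime_test_def
    proof (intro conjI)
      show "Ck 1 (test \<epsilon>)" by (rule Ck1_gradientI[OF \<Gamma>])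
      show "compactly_supported (test \<epsilon>)"
        by (rule compactly_supportedI[of "{T1..T2} \<times> spread"]) (use box compact_spread in \<open>auto intro: compact_Times\<close>)
      have "supp (test \<epsilon>) \<subseteq> {T1..T2} \<times> spread"
        by (rule supp_bound) (use box compact_spread in \<open>auto intro: closed_Times compact_imp_closed\<close>)
      then show "supp (test \<epsilon>) \<subseteq> {..<T} \<times> UNIV" using TT(3) by fastforce
    qed
    have tN: "test \<epsilon> (t, y) = 0" if "t \<in> {0..T}" "y \<in> N" for t y
    proof (rule ccontr)
      assume "test \<epsilon> (t, y) \<noteq> 0"
      then obtain z where "z \<in> cball y \<epsilon>" "\<theta> (X (- t) z) \<noteq> 0" using test_out(2)[OF \<epsilon>(1)] by blast
      then show False using \<delta>(2)[OF swept_memI[OF that(1)] that(2)] \<epsilon>(3)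
        by (force simp: dist_commute)
    qed
    have \<Gamma>_out: "\<Gamma> (t, x) = 0" if "x \<notin> spread" for t x
    proof -
      have "((\<lambda>x. 0) has_derivative (\<lambda>k. 0)) (at (t, x))" by simp
      then have "(test \<epsilon> has_derivative (\<lambda>k. 0)) (at (t, x))"
        by (rule has_derivative_transform_within_open[of _ _ _ _ "UNIV \<times> - spread"])
          (use that box compact_imp_closed[OF compact_spread] in \<open>force intro: open_Times\<close>)+
      then have "(\<lambda>k. k \<bullet> \<Gamma> (t, x)) = (\<lambda>k. 0)" using \<Gamma>(1) has_derivative_unique by blast
      then have "\<Gamma> (t, x) \<bullet> \<Gamma> (t, x) = 0" by metis
      then show ?thesis by simp
    qed
    let ?g = "\<lambda>t x. - ((1, a x) \<bullet> \<Gamma> (t, x)) - c t x * test \<epsilon> (t, x)"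
    let ?U = "\<lambda>t. LINT x|lebesgue. v t x * ?g t x"
    have test_cont: "continuous_on S f \<Longrightarrow> continuous_on S (\<lambda>p. test \<epsilon> (f p))" for S :: "(real \<times> 'a) set" and f
      by (rule continuous_on_compose2[OF Ck_continuous[OF Ck1_gradientI[OF \<Gamma>]]]) auto
    have \<Gamma>_cont: "continuous_on S f \<Longrightarrow> continuous_on S (\<lambda>p. \<Gamma> (f p))" for S :: "(real \<times> 'a) set" and f
      by (rule continuous_on_compose2[OF \<Gamma>(2)]) auto
    have g_cont: "continuous_on ({0..T} \<times> UNIV) (\<lambda>(t, x). ?g t x)"
      unfolding case_prod_unfold by (intro continuous_intros c_compose \<Gamma>_cont test_cont) auto
    have g_out: "?g t x = 0" if "x \<notin> spread" for t x
      using \<Gamma>_out[OF that] box[of "(t, x)"] that by (auto simp: inner_prod_def)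
    have g0_cont: "continuous_on ({0..T} \<times> UNIV) (\<lambda>(t, x). - \<eta>' t * \<theta> (X (- t) x) - c t x * h t x)"
      unfolding case_prod_unfold by (intro continuous_intros c_compose) auto
    have U_cont: "continuous_on {0..T} ?U"
      by (rule pairing_continuous_on[OF v_int v_L1 _ g_cont compact_spread]) (use g_out in auto)
    have g_close: "\<bar>?g t x - (- \<eta>' t * \<theta> (X (- t) x) - c t x * h t x)\<bar> \<le> (K2 + cB * K1) * \<epsilon>" if t: "t \<in> {0..T}" for t x
    proof -
      have 1: "\<bar>(1, a x) \<bullet> \<Gamma> (t, x) - \<eta>' t * \<theta> (X (- t) x)\<bar> \<le> K2 * \<epsilon>"
        unfolding K2_def by (rule test_transport[OF \<epsilon>(1) _ _ \<Gamma>(1)]) (use t in auto)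
      have 2: "\<bar>c t x * (test \<epsilon> (t, x) - h t x)\<bar> \<le> cB * (K1 * \<epsilon>)"
      proof (cases "x \<in> spread")
        case True
        have "\<bar>test \<epsilon> (t, x) - h t x\<bar> \<le> K1 * \<epsilon>"
          using test_close[OF \<epsilon>(1), of t T x] t by (simp add: K1_def h_def)
        then show ?thesis unfolding abs_mult using cB(2)[OF t True] cB(1) by (intro mult_mono) auto
      next
        case False
        then have "test \<epsilon> (t, x) - h t x = 0" using box[of "(t, x)"] h_spread[OF False, of t] by auto
        then show ?thesis using cB(1) K \<epsilon> by (simp del: mult_eq_0_iff)
      qed
      have "?g t x - (- \<eta>' t * \<theta> (X (- t) x) - c t x * h t x) =
          - ((1, a x) \<bullet> \<Gamma> (t, x) - \<eta>' t * \<theta> (X (- t) x)) - c t x * (test \<epsilon> (t, x) - h t x)"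
        by (simp add: algebra_simps)
      also have "\<bar>\<dots>\<bar> \<le> K2 * \<epsilon> + cB * (K1 * \<epsilon>)" using 1 2 by linarith
      finally show ?thesis by (simp add: algebra_simps)
    qed
    have "norm (integral {0..T} (\<lambda>t. ?U t - ?W t)) \<le> ((K2 + cB * K1) * \<epsilon> * V) * (T - 0)"
    proof (rule integral_bound)
      show "continuous_on {0..T} (\<lambda>t. ?U t - ?W t)" by (intro continuous_intros U_cont W_cont)
      fix t assume t: "t \<in> {0..T}"
      have "\<bar>?U t - ?W t\<bar> \<le> (K2 + cB * K1) * \<epsilon> * (LINT x|lebesgue. \<bar>v t x\<bar>)"
      proof (rule pairing_diff_le[where f = "?g t" and g = "\<lambda>x. - \<eta>' t * \<theta> (X (- t) x) - c t x * h t x",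
            OF v_int[OF t] continuous_on_slice[OF g_cont t] compact_spread g_out continuous_on_slice[OF g0_cont t]
            compact_Un[OF compact_spread compact_swept[of 0 T]] _ g_close[OF t]])
        show "- \<eta>' t * \<theta> (X (- t) x) - c t x * h t x = 0" if "x \<notin> spread \<union> swept 0 T" for x
          using swept_out[OF t that] h_spread[of x t] that by simp
      qed
      also have "\<dots> \<le> (K2 + cB * K1) * \<epsilon> * V" using V[OF t] K cB \<epsilon> by (intro mult_left_mono) auto
      finally show "norm (?U t - ?W t) \<le> (K2 + cB * K1) * \<epsilon> * V" by simp
    qed (use T in auto)
    then have 1: "\<bar>integral {0..T} ?U - integral {0..T} ?W\<bar> \<le> (K2 + cB * K1) * V * T * \<epsilon>"
      using integrable_continuous_real[OF U_cont] integrable_continuous_real[OF W_cont]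
      by (simp add: integral_diff mult_ac)
    have "(LINT t:{0..T}|lebesgue. ?U t) = (LINT x|lebesgue. v0 x * test \<epsilon> (0, x))"
    proof -
      have "(1, a x) \<bullet> \<Gamma> (t, x) = (1, 0) \<bullet> \<Gamma> (t, x) + (0, a x) \<bullet> \<Gamma> (t, x)" for t x
        by (simp add: inner_prod_def)
      then show ?thesis using weak[OF st tN] by (simp add: fd algebra_simps)
    qed
    moreover have "(LINT t:{0..T}|lebesgue. ?U t) = integral {0..T} ?U"
      by (intro set_lebesgue_integral_eq_integral absolutely_integrable_continuous_real U_cont)
    ultimately have 2: "integral {0..T} ?U = (LINT x|lebesgue. v0 x * test \<epsilon> (0, x))" by simp
    have 3: "\<bar>(LINT x|lebesgue. v0 x * test \<epsilon> (0, x)) - (LINT x|lebesgue. v0 x * (\<eta> 0 * \<theta> x))\<bar>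
        \<le> K1 * \<epsilon> * (LINT x|lebesgue. \<bar>v0 x\<bar>)"
    proof (rule pairing_diff_le[where f = "\<lambda>x. test \<epsilon> (0, x)" and g = "\<lambda>x. \<eta> 0 * \<theta> x", OF v0_int _ compact_spread _ _ C])
      show "continuous_on UNIV (\<lambda>x. test \<epsilon> (0, x))"
        by (rule continuous_on_compose2[OF Ck_continuous[OF Ck1_gradientI[OF \<Gamma>]]]) (auto intro: continuous_intros)
      show "test \<epsilon> (0, x) = 0" if "x \<notin> spread" for x using box[of "(0, x)"] that by auto
      show "continuous_on UNIV (\<lambda>x. \<eta> 0 * \<theta> x)" by (intro continuous_intros)
      show "\<eta> 0 * \<theta> x = 0" if "x \<notin> C" for x using \<theta>_out[OF that] by simp
      show "\<bar>test \<epsilon> (0, x) - \<eta> 0 * \<theta> x\<bar> \<le> K1 * \<epsilon>" for x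
        using test_close[OF \<epsilon>(1), of 0 T x] T by (simp add: K1_def)
    qed
    have 4: "(LINT x|lebesgue. v0 x * (\<eta> 0 * \<theta> x)) = ?A"
    proof -
      have "(LINT x|lebesgue. v0 x * (\<eta> 0 * \<theta> x)) = (LINT x|lebesgue. \<eta> 0 * (v0 x * \<theta> x))"
        by (simp add: mult_ac)
      then show ?thesis by simp
    qed
    have "\<bar>integral {0..T} ?W - ?A\<bar> \<le> (K2 + cB * K1) * V * T * \<epsilon> + K1 * \<epsilon> * (LINT x|lebesgue. \<bar>v0 x\<bar>)"
      using 1 2 3 4 by linarith
    then show ?thesis by (simp add: K_def algebra_simps)
  qed
  have "\<bar>integral {0..T} ?W - ?A\<bar> \<le> 0 + e" if e: "e > 0" for e
  proof -
    define q where "q = e / (\<bar>K\<bar> + 1)"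
    have q: "q > 0" using e by (simp add: q_def add_nonneg_pos)
    define \<epsilon> where "\<epsilon> = min (min 1 (\<delta> / 2)) q"
    have \<epsilon>: "0 < \<epsilon>" "\<epsilon> \<le> 1" "\<epsilon> < \<delta>" "\<epsilon> \<le> q"
      using q \<delta>(1) unfolding \<epsilon>_def by linarith+
    have "K * \<epsilon> \<le> \<bar>K\<bar> * q" using \<epsilon> by (intro mult_mono) auto
    also have "\<dots> \<le> e" using e by (simp add: q_def field_simps)
    finally show ?thesis using close[OF \<epsilon>(1-3)] by simp
  qed
  then have "\<bar>integral {0..T} ?W - ?A\<bar> \<le> 0" by (rule field_le_epsilon)
  moreover have "?W t = - \<eta>' t * F t - \<eta> t * P t" if t: "t \<in> {0..T}" for t
  proof -
    have i: "integrable lebesgue (\<lambda>x. v t x * \<theta> (X (- t) x))"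
      using M(2) by (intro integrable_mult_bounded[OF v_int[OF t]] continuous_measurable_lebesgue continuous_intros)
    have "continuous_on UNIV (\<lambda>x. c t x * \<theta> (X (- t) x))"
      by (intro continuous_intros continuous_on_slice[OF c_cont t])
    then have j: "integrable lebesgue (\<lambda>x. v t x * (c t x * \<theta> (X (- t) x)))"
      by (rule integrable_mult_compact_support[OF v_int[OF t] _ compact_swept[of 0 T]])
        (simp add: \<theta>_X_out[OF t])
    have "?W t = (LINT x|lebesgue. - \<eta>' t * (v t x * \<theta> (X (- t) x)) - \<eta> t * (v t x * (c t x * \<theta> (X (- t) x))))"
      by (simp add: h_def algebra_simps)
    also have "\<dots> = (LINT x|lebesgue. - \<eta>' t * (v t x * \<theta> (X (- t) x)))
        - (LINT x|lebesgue. \<eta> t * (v t x * (c t x * \<theta> (X (- t) x))))"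
      using i j by (intro Bochner_Integration.integral_diff integrable_mult_right) auto
    finally show ?thesis by (simp add: F_def P_def)
  qed
  then have "integral {0..T} ?W = integral {0..T} (\<lambda>t. - \<eta>' t * F t - \<eta> t * P t)"
    by (intro Henstock_Kurzweil_Integration.integral_cong) simp
  ultimately show ?thesis by simp
qed

text \<open>The lemma of du Bois-Reymond in time: the deviation \<open>D\<close> from the integrated equation is orthogonal
  to every admissible \<open>\<eta>'\<close>, in particular to \<open>D\<close> itself times a nonnegative weight.\<close>

lemma F_eq_integral:
  assumes t: "t \<in> {0..<T}"
  shows "F t = (LINT x|lebesgue. v0 x * \<theta> x) + integral {0..t} P"
proof -
  define A where "A = (LINT x|lebesgue. v0 x * \<theta> x)"
  define H where "H = (\<lambda>t. integral {0..t} P)"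
  define D where "D = (\<lambda>t. F t - A - H t)"
  have H_deriv: "(H has_real_derivative P s) (at s within {0..T})" if "s \<in> {0..T}" for s
    unfolding H_def by (rule integral_has_real_derivative[OF P_cont that])
  have H_cont: "continuous_on {0..T} H" by (rule DERIV_continuous_on[OF H_deriv])
  have D_cont: "continuous_on {0..T} D" unfolding D_def by (intro continuous_intros F_cont H_cont)
  define T' where "T' = (t + T) / 2"
  have T': "0 \<le> T'" "t < T'" "T' < T" using t by (auto simp: T'_def)
  \<comment> \<open>The clamp extends \<open>D\<close> to all times. The weight makes \<open>\<zeta>\<close> vanish after \<open>T'\<close>, so that its primitive
    \<open>N1\<close> can be chosen to vanish there as well; the ramp then cuts \<open>N1\<close> off at negative times.\<close>
  define \<zeta> where "\<zeta> = (\<lambda>s. D (max 0 (min T s)) * max 0 (T' - s))"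
  have \<zeta>_cont: "continuous_on UNIV \<zeta>"
    unfolding \<zeta>_def
    by (intro continuous_intros continuous_on_compose2[OF D_cont]) (use T in auto)
  obtain N0 where N0: "\<And>s. (N0 has_real_derivative \<zeta> s) (at s)"
    using einterval_antiderivative[of "- \<infinity>" \<infinity> \<zeta>] \<zeta>_cont
    by (auto simp: continuous_on_eq_continuous_at has_real_derivative_iff_has_vector_derivative)
  define N1 where "N1 = (\<lambda>s. N0 s - N0 T')"
  have N1: "(N1 has_real_derivative \<zeta> s) (at s)" for s
    unfolding N1_def using DERIV_diff[OF N0 DERIV_const[of "N0 T'"], of s] by simp
  have N1_0: "N1 s = 0" if "T' \<le> s" for s
  proof (cases "s = T'")
    case False
    then have "T' < s" using that by simp
    from MVT2[OF this, of N1 \<zeta>] N1 obtain z where "T' < z" "N1 s - N1 T' = (s - T') * \<zeta> z" by blast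
    then show ?thesis by (simp add: N1_def \<zeta>_def)
  qed (simp add: N1_def)
  define \<eta> where "\<eta> = (\<lambda>s. ramp (s + 1) * N1 s)"
  define \<eta>' where "\<eta>' = (\<lambda>s. ramp' (s + 1) * N1 s + \<zeta> s * ramp (s + 1))"
  have ramp1: "((\<lambda>s. ramp (s + 1)) has_real_derivative ramp' (s + 1)) (at s)" for s
    using DERIV_ramp[of "s + 1"] DERIV_shift[of ramp "ramp' (s + 1)" s 1] by simp
  have \<eta>: "(\<eta> has_real_derivative \<eta>' s) (at s)" for s
    unfolding \<eta>_def \<eta>'_def by (rule DERIV_mult[OF ramp1 N1])
  have \<eta>'_cont: "continuous_on UNIV \<eta>'"
  proof -
    have "continuous_on UNIV N1" by (rule DERIV_continuous_on[OF N1])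
    moreover have "continuous_on UNIV (\<lambda>s. ramp (s + 1))" by (rule DERIV_continuous_on[OF ramp1])
    moreover have "continuous_on UNIV (\<lambda>s. ramp' (s + 1))"
      by (rule continuous_on_compose2[OF continuous_on_ramp']) (auto intro: continuous_intros)
    ultimately show ?thesis unfolding \<eta>'_def by (intro continuous_intros \<zeta>_cont)
  qed
  have out: "\<eta> s = 0" if "s \<notin> {-1..T'}" for s
    using that N1_0[of s] by (auto simp: \<eta>_def ramp_eq_0)
  have on: "\<eta>' s = \<zeta> s" "\<eta> s = N1 s" if "0 \<le> s" for s
    using that by (simp_all add: \<eta>'_def \<eta>_def ramp'_def ramp_eq_1)
  have "integral {0..T} (\<lambda>s. - \<eta>' s * F s - \<eta> s * P s) = \<eta> 0 * A"
    unfolding A_def by (rule weak_along_flow[OF \<eta> \<eta>'_cont _ T'(1,3) out]) auto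
  also have "integral {0..T} (\<lambda>s. - \<eta>' s * F s - \<eta> s * P s) = integral {0..T} (\<lambda>s. - \<zeta> s * F s - N1 s * P s)"
    by (intro Henstock_Kurzweil_Integration.integral_cong) (simp add: on)
  finally have 1: "integral {0..T} (\<lambda>s. - \<zeta> s * F s - N1 s * P s) = N1 0 * A" by (simp add: on)
  have 2: "((\<lambda>s. \<zeta> s * (H s + A) + N1 s * P s) has_integral (N1 T * (H T + A) - N1 0 * (H 0 + A))) {0..T}"
  proof (rule fundamental_theorem_of_calculus)
    fix s assume s: "s \<in> {0..T}"
    have "((\<lambda>s. N1 s * (H s + A)) has_real_derivative \<zeta> s * (H s + A) + (P s + 0) * N1 s) (at s within {0..T})"
      by (intro DERIV_mult DERIV_add H_deriv s DERIV_const has_field_derivative_at_within[OF N1])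
    then show "((\<lambda>s. N1 s * (H s + A)) has_vector_derivative \<zeta> s * (H s + A) + N1 s * P s) (at s within {0..T})"
      by (simp add: has_real_derivative_iff_has_vector_derivative mult.commute)
  qed (use T in simp)
  have N1_cont: "continuous_on {0..T} N1" by (rule continuous_on_subset[OF DERIV_continuous_on[OF N1] subset_UNIV])
  have \<zeta>_cont': "continuous_on {0..T} \<zeta>" using \<zeta>_cont continuous_on_subset by blast
  have c1: "(\<lambda>s. - \<zeta> s * F s - N1 s * P s) integrable_on {0..T}"
    by (intro integrable_continuous_real continuous_intros \<zeta>_cont' N1_cont F_cont P_cont)
  have "H 0 = 0" by (simp add: H_def)
  moreover have "N1 T = 0" using N1_0[of T] T'(3) by simp
  ultimately have "((\<lambda>s. \<zeta> s * (H s + A) + N1 s * P s) has_integral (- N1 0 * A)) {0..T}" using 2 by simp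
  from has_integral_add[OF this has_integral_integral[THEN iffD1, OF c1]]
  have "((\<lambda>s. - (\<zeta> s * D s)) has_integral 0) {0..T}" using 1 by (simp add: D_def algebra_simps)
  from has_integral_neg[OF this] have 3: "((\<lambda>s. \<zeta> s * D s) has_integral 0) (cbox 0 T)" by simp
  have "\<zeta> t * D t = 0"
  proof (rule has_integral_0_cbox_imp_0[OF _ _ 3])
    show "continuous_on (cbox 0 T) (\<lambda>s. \<zeta> s * D s)"
      using continuous_on_mult[OF \<zeta>_cont' D_cont] by simp
    fix s assume "s \<in> box 0 T"
    then have "\<zeta> s * D s = (D s)\<^sup>2 * max 0 (T' - s)" by (simp add: \<zeta>_def box_real power2_eq_square)
    then show "0 \<le> \<zeta> s * D s" by simp
  qed (use t in \<open>auto simp: box_real\<close>)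
  then have "D t = 0" using t T' by (simp add: \<zeta>_def)
  then show ?thesis by (simp add: D_def A_def H_def)
qed

lemma F_deriv:
  assumes t: "t \<in> {0..<T}"
  shows "(F has_real_derivative P t) (at t within {0..<T})"
proof -
  have "((\<lambda>t. (LINT x|lebesgue. v0 x * \<theta> x) + integral {0..t} P) has_real_derivative 0 + P t) (at t within {0..<T})"
  proof (intro DERIV_add DERIV_const)
    show "((\<lambda>t. integral {0..t} P) has_real_derivative P t) (at t within {0..<T})"
      using integral_has_real_derivative[OF P_cont, of t] t by (auto intro: DERIV_subset)
  qed
  then have "((\<lambda>t. (LINT x|lebesgue. v0 x * \<theta> x) + integral {0..t} P) has_real_derivative P t) (at t within {0..<T})"
    by simp
  then show ?thesis
    by (rule has_field_derivative_transform_within[of _ _ _ _ 1]) (use t F_eq_integral in auto)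
qed

lemma F_0: "F 0 = (LINT x|lebesgue. v0 x * \<theta> x)"
  using F_eq_integral[of 0] T by simp

end

section \<open>Propagation of the support and the total mass\<close>

lemma closed_ess_supp: "closed (ess_supp f)"
proof -
  have "- ess_supp f = \<Union>{U. open U \<and> (AE y in lebesgue. y \<in> U \<longrightarrow> f y = 0)}"
    by (auto simp: ess_supp_def)
  then show ?thesis by (simp add: closed_def open_Union)
qed

lemma AE_zero_outside_ess_supp: "AE x in lebesgue. x \<notin> ess_supp f \<longrightarrow> f x = 0"
proof -
  let ?F = "{U. open U \<and> (AE y in lebesgue. y \<in> U \<longrightarrow> f y = 0)}"
  obtain F' where F': "F' \<subseteq> ?F" "countable F'" "\<Union>F' = \<Union>?F"
    using Lindelof[of ?F] by blast
  have "AE x in lebesgue. \<forall>U\<in>F'. x \<in> U \<longrightarrow> f x = 0"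
    using F'(1) by (subst AE_ball_countable[OF F'(2)]) auto
  moreover have "- ess_supp f = \<Union>F'"
    unfolding F'(3) by (auto simp: ess_supp_def)
  ultimately show ?thesis by (auto elim!: eventually_mono)
qed

text \<open>Completeness of Lebesgue measure makes the product of the mutation term and a solution measurable when
  one factor vanishes almost everywhere that the other does not.\<close>

lemma lebesgue_measurable_AE_zero:
  fixes f :: "'a::euclidean_space \<Rightarrow> real"
  assumes "AE x in lebesgue. f x = 0"
  shows "f \<in> borel_measurable lebesgue"
proof -
  obtain N where N: "{x. f x \<noteq> 0} \<subseteq> N" "N \<in> null_sets lebesgue"
    using assms by (auto simp: eventually_ae_filter)
  have null: "A \<in> sets lebesgue" if "A \<subseteq> N" for A
    using N(2) that null_sets_completion_subset by blast
  show ?thesis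
  proof (rule measurableI)
    fix A :: "real set"
    have eq: "f -` A \<inter> space lebesgue = (if 0 \<in> A then UNIV - (f -` (- A)) else f -` A)" by auto
    have "f -` (- A) \<subseteq> N" if "0 \<in> A" using that N(1) by auto
    moreover have "f -` A \<subseteq> N" if "0 \<notin> A" using that N(1) by auto
    ultimately show "f -` A \<inter> space lebesgue \<in> sets lebesgue"
      unfolding eq using null by (auto intro!: sets.Diff)
  qed simp
qed

text \<open>The facts about the data that the propagation of the support rests on. \<open>avoid\<close> is the geometric
  hypothesis that keeps the mass away from the traits in \<open>Ky\<close>.\<close>

locale selection_mutation = lipschitz_flow a X L
  for a :: "'a::euclidean_space \<Rightarrow> 'a" and X :: "real \<Rightarrow> 'a \<Rightarrow> 'a" and L :: real +
  fixes k :: nat and R :: "'a \<Rightarrow> real \<Rightarrow> real" and \<psi>g \<psi>d :: "'a \<Rightarrow> 'a \<Rightarrow> real"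
    and m :: "'a \<Rightarrow> 'a \<Rightarrow> real \<Rightarrow> real" and v0 :: "'a \<Rightarrow> real" and v :: "real \<Rightarrow> 'a \<Rightarrow> real"
    and Kx Ky :: "'a set"
  assumes R_cont: "continuous_on UNIV (\<lambda>(x, I). R x I)"
    and \<psi>g: "weight_regular k \<psi>g"
    and m_x: "\<And>x y I. x \<notin> Kx \<Longrightarrow> m x y I = 0" and m_y: "\<And>x y I. y \<notin> Ky \<Longrightarrow> m x y I = 0"
    and Kx: "compact Kx"
    and sol: "weak_solution k a R \<psi>g \<psi>d m v0 v"
    and v0_int: "integrable lebesgue v0" and v0_nonneg: "AE x in lebesgue. 0 \<le> v0 x"
    and supp_compact: "compact (ess_supp v0)"
    and avoid: "\<And>s y. 0 \<le> s \<Longrightarrow> y \<in> ess_supp v0 \<union> Kx \<Longrightarrow> X s y \<notin> Ky"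
begin

lemma v_nonneg: "0 \<le> t \<Longrightarrow> AE x in lebesgue. 0 \<le> v t x"
  using sol by (simp add: weak_solution_def)

lemma v_Wk1: "0 \<le> t \<Longrightarrow> in_Wk1 k (v t)"
proof -
  assume "0 \<le> t"
  then have "t \<in> {0..t + 1}" "0 < t + 1" by auto
  then show ?thesis using sol unfolding weak_solution_def by blast
qed

lemma v_int: "0 \<le> t \<Longrightarrow> integrable lebesgue (v t)"
  using in_Wk1_D(1) v_Wk1 by blast

lemma v_L1: "0 < T \<Longrightarrow> t \<in> {0..T} \<Longrightarrow> ((\<lambda>s. LINT x|lebesgue. \<bar>v s x - v t x\<bar>) \<longlongrightarrow> 0) (at t within {0..T})"
proof -
  assume T: "0 < T" and t: "t \<in> {0..T}"
  have lim: "((\<lambda>s. norm_Wk1 k (\<lambda>x. v s x - v t x)) \<longlongrightarrow> 0) (at t within {0..T})"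
    using sol T t unfolding weak_solution_def by blast
  have "\<forall>\<^sub>F s in at t within {0..T}. s \<in> {0..T}" by (simp add: eventually_at_filter)
  then have "\<forall>\<^sub>F s in at t within {0..T}. norm (LINT x|lebesgue. \<bar>v s x - v t x\<bar>) \<le> norm_Wk1 k (\<lambda>x. v s x - v t x)"
  proof eventually_elim
    case (elim s)
    then show ?case using L1_norm_le_norm_Wk1[OF v_Wk1 v_Wk1, of s t] t by simp
  qed
  then show ?thesis by (rule Lim_null_comparison[OF _ lim])
qed

lemma nonlocal_cont:
  assumes T: "0 < T"
  shows "continuous_on ({0..T} \<times> UNIV) (\<lambda>(t, x). nonlocal \<psi>g v t x)"
  unfolding continuous_on_def
proof
  fix p :: "real \<times> 'a" assume p: "p \<in> {0..T} \<times> UNIV"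
  obtain t x where tx: "p = (t, x)" "t \<in> {0..T}" using p by auto
  let ?F = "at p within {0..T} \<times> UNIV"
  have ev: "\<forall>\<^sub>F q in ?F. fst q \<in> {0..T}"
    unfolding eventually_at_filter by (rule always_eventually) auto
  have fst: "(fst \<longlongrightarrow> t) ?F" and snd: "(snd \<longlongrightarrow> x) ?F"
    using tendsto_fst[OF tendsto_ident_at[of p "{0..T} \<times> UNIV"]] tendsto_snd[OF tendsto_ident_at[of p "{0..T} \<times> UNIV"]]
    by (simp_all add: tx)
  obtain B where B: "\<And>y. \<bar>\<psi>g x y\<bar> \<le> B" using weight_regular_bounded[OF \<psi>g] by blast
  have meas: "\<psi>g x \<in> borel_measurable lebesgue" for x
    by (rule continuous_measurable_lebesgue[OF weight_regular_continuous(2)[OF \<psi>g]])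
  have "((\<lambda>q. LINT y|lebesgue. v (fst q) y * \<psi>g (snd q) y) \<longlongrightarrow> (LINT y|lebesgue. v t y * \<psi>g x y)) ?F"
  proof (rule pairing_tendsto[OF _ _ _ _ meas B])
    show "\<forall>\<^sub>F q in ?F. integrable lebesgue (v (fst q))" using ev by eventually_elim (simp add: v_int)
    show "integrable lebesgue (v t)" using tx by (simp add: v_int)
    have "continuous (at t within {0..T}) (\<lambda>s. LINT x|lebesgue. \<bar>v s x - v t x\<bar>)"
      using v_L1[OF T tx(2)] by (simp add: continuous_within)
    from continuous_within_tendsto_compose[OF this ev fst]
    show "((\<lambda>q. LINT x|lebesgue. \<bar>v (fst q) x - v t x\<bar>) \<longlongrightarrow> 0) ?F" by simp
    show "\<forall>\<^sub>F q in ?F. \<psi>g (snd q) \<in> borel_measurable lebesgue" by (simp add: meas)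
    fix e :: real assume "e > 0"
    from eventually_compose_filterlim[OF weight_regular_uniform[OF \<psi>g this] snd]
    show "\<forall>\<^sub>F q in ?F. \<forall>y. \<bar>\<psi>g (snd q) y - \<psi>g x y\<bar> \<le> e" .
  qed
  then show "((\<lambda>(t, x). nonlocal \<psi>g v t x) \<longlongrightarrow> (case p of (t, x) \<Rightarrow> nonlocal \<psi>g v t x)) ?F"
    by (simp add: case_prod_unfold nonlocal_def tx mult.commute)
qed

definition c :: "real \<Rightarrow> 'a \<Rightarrow> real"
  where "c t x = R x (nonlocal \<psi>g v t x)"

lemma c_cont: "0 < T \<Longrightarrow> continuous_on ({0..T} \<times> UNIV) (\<lambda>(t, x). c t x)"
proof -
  assume T: "0 < T"
  have "continuous_on ({0..T} \<times> UNIV) (\<lambda>p. (snd p, (\<lambda>(t, x). nonlocal \<psi>g v t x) p))"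
    by (intro continuous_on_Pair nonlocal_cont[OF T] continuous_on_snd continuous_on_id)
  from continuous_on_compose2[OF R_cont this] show ?thesis
    by (simp add: c_def case_prod_unfold)
qed

lemma c_slice: "0 \<le> t \<Longrightarrow> continuous_on UNIV (c t)"
proof -
  assume t: "0 \<le> t"
  then have "0 < t + 1" "t \<in> {0..t + 1}" by auto
  from continuous_on_slice[OF c_cont[OF this(1)] this(2)] show ?thesis .
qed

lemma v_mult_measurable: "0 \<le> t \<Longrightarrow> continuous_on UNIV f \<Longrightarrow> (\<lambda>x. v t x * f x) \<in> borel_measurable lebesgue"
  using v_int[of t] continuous_measurable_lebesgue[of f] by (intro borel_measurable_times) auto

text \<open>The mutation term of the weak equation pairs \<open>v t x\<close> with \<open>m y x\<close> and \<open>\<phi> (t, y)\<close>, so it vanishes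
  as soon as either the test function vanishes on \<open>Kx\<close> or the solution vanishes on \<open>Ky\<close>.\<close>

lemma weak_without_mutation:
  assumes T: "0 < T" and \<phi>: "spacetime_test T \<phi>"
    and vanish: "(\<forall>t\<in>{0..T}. \<forall>y\<in>Kx. \<phi> (t, y) = 0) \<or> (\<forall>t\<in>{0..T}. AE x in lebesgue. x \<in> Ky \<longrightarrow> v t x = 0)"
  shows "(LINT t:{0..T}|lebesgue. LINT x|lebesgue. v t x *
      (- frechet_derivative \<phi> (at (t, x)) (1, 0) - frechet_derivative \<phi> (at (t, x)) (0, a x)
       - c t x * \<phi> (t, x))) = (LINT x|lebesgue. v0 x * \<phi> (0, x))"
proof -
  have eq: "(LINT x|lebesgue. v t x *
        (- frechet_derivative \<phi> (at (t, x)) (1, 0)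
         - frechet_derivative \<phi> (at (t, x)) (0, a x)
         - R x (nonlocal \<psi>g v t x) * \<phi> (t, x)
         - (LINT y|lebesgue. m y x (nonlocal \<psi>d v t y) * \<phi> (t, y)))) =
      (LINT x|lebesgue. v t x *
        (- frechet_derivative \<phi> (at (t, x)) (1, 0) - frechet_derivative \<phi> (at (t, x)) (0, a x)
         - c t x * \<phi> (t, x)))" (is "?l = ?r") if t: "t \<in> {0..T}" for t
    using vanish
  proof
    assume *: "\<forall>t\<in>{0..T}. \<forall>y\<in>Kx. \<phi> (t, y) = 0"
    have "(\<lambda>y. m y x (nonlocal \<psi>d v t y) * \<phi> (t, y)) = (\<lambda>y. 0)" for x
    proof
      fix y show "m y x (nonlocal \<psi>d v t y) * \<phi> (t, y) = 0"
        using m_x[of y] * t by (cases "y \<in> Kx") auto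
    qed
    then show ?thesis by (simp add: c_def)
  next
    assume *: "\<forall>t\<in>{0..T}. AE x in lebesgue. x \<in> Ky \<longrightarrow> v t x = 0"
    define f where "f = (\<lambda>x. v t x * (- frechet_derivative \<phi> (at (t, x)) (1, 0)
         - frechet_derivative \<phi> (at (t, x)) (0, a x) - c t x * \<phi> (t, x)))"
    define w where "w = (\<lambda>x. v t x * (LINT y|lebesgue. m y x (nonlocal \<psi>d v t y) * \<phi> (t, y)))"
    have w0: "AE x in lebesgue. w x = 0"
      using *[rule_format, OF t]
    proof eventually_elim
      case (elim x)
      show ?case
      proof (cases "x \<in> Ky")
        case False
        then have "(\<lambda>y. m y x (nonlocal \<psi>d v t y) * \<phi> (t, y)) = (\<lambda>y. 0)" using m_y by auto
        then show ?thesis by (simp add: w_def)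
      qed (use elim in \<open>simp add: w_def\<close>)
    qed
    have wm: "w \<in> borel_measurable lebesgue" by (rule lebesgue_measurable_AE_zero[OF w0])
    have "?l = (LINT x|lebesgue. f x - w x)" by (simp add: f_def w_def c_def algebra_simps)
    also have "\<dots> = (LINT x|lebesgue. f x)"
    proof (cases "f \<in> borel_measurable lebesgue")
      case True
      show ?thesis
        by (rule integral_cong_AE) (use True wm w0 in \<open>auto elim: eventually_mono\<close>)
    next
      case False
      have "(\<lambda>x. f x - w x) \<notin> borel_measurable lebesgue"
      proof
        assume "(\<lambda>x. f x - w x) \<in> borel_measurable lebesgue"
        from borel_measurable_add[OF this wm] show False using False by simp
      qed
      then have "\<not> integrable lebesgue (\<lambda>x. f x - w x)" "\<not> integrable lebesgue f"
        using False borel_measurable_integrable by blast+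
      then show ?thesis by (simp add: not_integrable_integral_eq)
    qed
    finally show ?thesis by (simp add: f_def)
  qed
  have "(LINT t:{0..T}|lebesgue. LINT x|lebesgue. v t x *
        (- frechet_derivative \<phi> (at (t, x)) (1, 0)
         - frechet_derivative \<phi> (at (t, x)) (0, a x)
         - R x (nonlocal \<psi>g v t x) * \<phi> (t, x)
         - (LINT y|lebesgue. m y x (nonlocal \<psi>d v t y) * \<phi> (t, y)))) = (LINT x|lebesgue. v0 x * \<phi> (0, x))"
    using sol T \<phi> unfolding weak_solution_def by blast
  moreover have "(LINT t:{0..T}|lebesgue. LINT x|lebesgue. v t x *
        (- frechet_derivative \<phi> (at (t, x)) (1, 0)
         - frechet_derivative \<phi> (at (t, x)) (0, a x)
         - R x (nonlocal \<psi>g v t x) * \<phi> (t, x)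
         - (LINT y|lebesgue. m y x (nonlocal \<psi>d v t y) * \<phi> (t, y)))) =
      (LINT t:{0..T}|lebesgue. LINT x|lebesgue. v t x *
      (- frechet_derivative \<phi> (at (t, x)) (1, 0) - frechet_derivative \<phi> (at (t, x)) (0, a x)
       - c t x * \<phi> (t, x)))"
    by (rule set_lebesgue_integral_cong) (use eq in auto)
  ultimately show ?thesis by simp
qed

lemma bump_transport_problem:
  assumes T: "0 < T" and r: "0 \<le> r"
    and N: "compact N" "\<And>t y. t \<in> {0..T} \<Longrightarrow> y \<in> cball q r \<Longrightarrow> X t y \<notin> N"
    and alt: "N = Kx \<or> (\<forall>t\<in>{0..T}. AE x in lebesgue. x \<in> Ky \<longrightarrow> v t x = 0)"
  obtains M where "transport_problem a X L (bump q r) (bump_grad q r) (cball q r) M v v0 c T N"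
proof -
  have out: "bump q r x = 0" if "x \<notin> cball q r" for x
    using bump_outside[OF r, of x q] that by auto
  obtain M where M: "M > 0" "\<And>x. \<bar>bump q r x\<bar> \<le> M" "\<And>x y. \<bar>bump q r x - bump q r y\<bar> \<le> M * norm (x - y)"
    by (rule bounded_lipschitz_of_compact_gradient[OF bump_has_derivative continuous_on_bump_grad
          compact_cball[of q r] out]) (assumption, rule that)
  have "transport_problem a X L (bump q r) (bump_grad q r) (cball q r) M v v0 c T N"
  proof unfold_locales
    fix \<phi> assume st: "spacetime_test T \<phi>" and 0: "\<And>t y. t \<in> {0..T} \<Longrightarrow> y \<in> N \<Longrightarrow> \<phi> (t, y) = 0"
    show "(LINT t:{0..T}|lebesgue. LINT x|lebesgue. v t x *
        (- frechet_derivative \<phi> (at (t, x)) (1, 0) - frechet_derivative \<phi> (at (t, x)) (0, a x)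
         - c t x * \<phi> (t, x))) = (LINT x|lebesgue. v0 x * \<phi> (0, x))"
      by (rule weak_without_mutation[OF T st]) (use alt 0 in blast)
  qed (use M T v_int v_L1 v0_int c_cont N bump_has_derivative continuous_on_bump_grad out in auto)
  then show ?thesis by (rule that)
qed

text \<open>Gronwall's inequality for the pairing with a transported bump: where there is no initial mass and
  no source, no mass appears along the characteristics.\<close>

lemma no_mass_along_characteristic:
  assumes T: "0 \<le> T" and y0: "y0 \<notin> ess_supp v0" and N: "compact N" "\<And>t. t \<in> {0..T} \<Longrightarrow> X t y0 \<notin> N"
    and alt: "N = Kx \<or> (\<forall>t\<ge>0. AE x in lebesgue. x \<in> Ky \<longrightarrow> v t x = 0)"
  shows "X T y0 \<notin> ess_supp (v T)"
proof -
  \<comment> \<open>The trajectory up to time \<open>T\<close> is compact, so a whole tube around it, slightly longer in time, still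
    avoids \<open>N\<close> and starts outside the support of \<open>v0\<close>.\<close>
  let ?Z = "{p. X (fst p) (snd p) \<notin> N} \<inter> UNIV \<times> (- ess_supp v0)"
  have "open ((\<lambda>p. X (fst p) (snd p)) -` (- N))"
    by (intro open_vimage continuous_X open_Compl compact_imp_closed N)
  then have "open {p. X (fst p) (snd p) \<notin> N}" by (simp add: vimage_def)
  then have Z: "open ?Z" by (intro open_Int open_Times open_Compl closed_ess_supp) auto
  have ne: "{0..T} \<times> {y0} \<noteq> {}" using T by auto
  have "compact ({0..T} \<times> {y0})" by (intro compact_Times) auto
  moreover have "{0..T} \<times> {y0} \<subseteq> ?Z" using N(2) y0 by auto
  ultimately obtain e where e: "e > 0" "{p. infdist p ({0..T} \<times> {y0}) \<le> e} \<subseteq> ?Z"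
    by (rule compact_in_open_separated[OF ne _ Z])
  define r where "r = e / 2"
  have r: "r > 0" using e by (simp add: r_def)
  have near: "(t, y) \<in> ?Z" if "t \<in> {0..T + r}" "y \<in> cball y0 r" for t y
  proof -
    have "infdist (t, y) ({0..T} \<times> {y0}) \<le> dist (t, y) (min t T, y0)"
      by (rule infdist_le) (use that T in auto)
    also have "\<dots> \<le> dist t (min t T) + dist y y0"
      by (simp add: dist_Pair_Pair sqrt_sum_squares_le_sum)
    also have "\<dots> \<le> r + r"
      using that r by (intro add_mono) (auto simp: dist_real_def min_def dist_commute)
    also have "\<dots> = e" by (simp add: r_def)
    finally show ?thesis using e(2) by blast
  qed
  have Tr: "0 < T + r" using T r by simp
  obtain M where "transport_problem a X L (bump y0 r) (bump_grad y0 r) (cball y0 r) M v v0 c (T + r) N"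
    by (rule bump_transport_problem[OF Tr less_imp_le[OF r] N(1), where q = y0]) (use near alt in auto)
  then interpret tp: transport_problem a X L "bump y0 r" "bump_grad y0 r" "cball y0 r" M v v0 c "T + r" N .
  have "continuous_on ({0..T + r} \<times> tp.swept 0 (T + r)) (\<lambda>(t, x). c t x)"
    by (rule continuous_on_subset[OF c_cont[OF Tr]]) auto
  from compact_abs_bound[OF compact_Times[OF compact_Icc tp.compact_swept] this]
  obtain B where B: "B > 0" "\<And>t x. t \<in> {0..T + r} \<Longrightarrow> x \<in> tp.swept 0 (T + r) \<Longrightarrow> \<bar>c t x\<bar> \<le> B"
    by (metis SigmaI case_prod_conv)
  have bcont: "continuous_on UNIV (\<lambda>x. bump y0 r (X (- t) x))" for t
    by (intro tp.continuous_on_\<theta> continuous_intros)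
  have int: "integrable lebesgue (\<lambda>x. v t x * bump y0 r (X (- t) x))" if "0 \<le> t" for t
    by (rule integrable_mult_bounded[OF v_int[OF that] continuous_measurable_lebesgue[OF bcont] tp.M(2)])
  have nonneg: "AE x in lebesgue. 0 \<le> v t x * bump y0 r (X (- t) x)" if "0 \<le> t" for t
    using v_nonneg[OF that] by eventually_elim (simp add: bump_range)
  have "tp.F T \<le> tp.F 0 * exp (B * T)"
  proof (rule gronwall[OF T])
    fix t assume t: "t \<in> {0..T}"
    then have t': "t \<in> {0..<T + r}" using r by auto
    show "(tp.F has_real_derivative tp.P t) (at t within {0..T})"
      by (rule DERIV_subset[OF tp.F_deriv[OF t']]) (use r in auto)
    have le: "c t x * bump y0 r (X (- t) x) \<le> B * bump y0 r (X (- t) x)"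
      "\<bar>c t x * bump y0 r (X (- t) x)\<bar> \<le> B" for x
    proof -
      have "\<bar>c t x * bump y0 r (X (- t) x)\<bar> \<le> B * bump y0 r (X (- t) x)"
      proof (cases "x \<in> tp.swept 0 (T + r)")
        case True
        then have "\<bar>c t x\<bar> \<le> B" using B(2)[of t x] t' by simp
        then show ?thesis using bump_range(1)[of y0 r "X (- t) x"]
          by (simp add: abs_mult mult_right_mono)
      next
        case False
        then show ?thesis using tp.\<theta>_X_out[of t 0 "T + r" x] t' B(1) by simp
      qed
      moreover have "B * bump y0 r (X (- t) x) \<le> B"
        using B(1) bump_range[of y0 r "X (- t) x"] by (simp add: mult_left_le)
      ultimately show "c t x * bump y0 r (X (- t) x) \<le> B * bump y0 r (X (- t) x)"
        "\<bar>c t x * bump y0 r (X (- t) x)\<bar> \<le> B" by linarith+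
    qed
    have cb: "continuous_on UNIV (\<lambda>x. c t x * bump y0 r (X (- t) x))"
      using t by (intro continuous_on_mult c_slice bcont) auto
    have i2: "integrable lebesgue (\<lambda>x. v t x * (c t x * bump y0 r (X (- t) x)))"
      by (rule integrable_mult_bounded[OF v_int continuous_measurable_lebesgue[OF cb] le(2)]) (use t in auto)
    have "tp.P t \<le> (LINT x|lebesgue. B * (v t x * bump y0 r (X (- t) x)))"
      unfolding tp.P_def
    proof (rule integral_mono_AE[OF i2])
      show "integrable lebesgue (\<lambda>x. B * (v t x * bump y0 r (X (- t) x)))" using int t by simp
      have "AE x in lebesgue. 0 \<le> v t x" using v_nonneg t by simp
      then show "AE x in lebesgue. v t x * (c t x * bump y0 r (X (- t) x)) \<le> B * (v t x * bump y0 r (X (- t) x))"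
      proof eventually_elim
        case (elim x)
        from mult_left_mono[OF le(1) elim] show ?case by (simp add: mult.left_commute)
      qed
    qed
    then show "tp.P t \<le> B * tp.F t" by (simp add: tp.F_def)
  qed
  moreover have "tp.F 0 = 0"
  proof -
    have "AE x in lebesgue. v0 x * bump y0 r x = 0"
      using AE_zero_outside_ess_supp[of v0]
    proof eventually_elim
      case (elim x)
      show ?case
      proof (cases "x \<in> cball y0 r")
        case True
        then have "x \<notin> ess_supp v0" using near[of 0 x] Tr by auto
        then show ?thesis using elim by simp
      next
        case False
        then show ?thesis using bump_outside[of r x y0] r by auto
      qed
    qed
    then show ?thesis unfolding tp.F_0 by (rule integral_eq_zero_AE)
  qed
  moreover have "0 \<le> tp.F T" unfolding tp.F_def by (rule integral_nonneg_AE[OF nonneg[OF T]])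
  ultimately have "tp.F T = 0" by simp
  then have zero: "AE x in lebesgue. v T x * bump y0 r (X (- T) x) = 0"
    unfolding tp.F_def using integral_nonneg_eq_0_iff_AE[OF int[OF T] nonneg[OF T]] by simp
  let ?U = "(\<lambda>x. X (- T) x) -` ball y0 r"
  have "open ?U" by (intro open_vimage open_ball continuous_intros)
  moreover have "X T y0 \<in> ?U" using r by simp
  moreover have "AE x in lebesgue. x \<in> ?U \<longrightarrow> v T x = 0"
    using zero
  proof eventually_elim
    case (elim x)
    show ?case
    proof
      assume "x \<in> ?U"
      then have "0 < bump y0 r (X (- T) x)" by (intro bump_pos) auto
      then show "v T x = 0" using elim by simp
    qed
  qed
  ultimately show ?thesis unfolding ess_supp_def by blast
qed

text \<open>A trajectory that ends in \<open>Ky\<close> has never met the support of \<open>v0\<close> nor \<open>Kx\<close>, so the test functions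
  along it do not see the mutation term and no mass has arrived.\<close>

lemma v_zero_on_Ky:
  assumes t: "0 \<le> t"
  shows "AE x in lebesgue. x \<in> Ky \<longrightarrow> v t x = 0"
proof -
  have "x \<notin> ess_supp (v t)" if x: "x \<in> Ky" for x
  proof -
    have *: "X s (X (- t) x) \<notin> ess_supp v0 \<union> Kx" if s: "s \<in> {0..t}" for s
    proof
      assume "X s (X (- t) x) \<in> ess_supp v0 \<union> Kx"
      then have "X (t - s) (X s (X (- t) x)) \<notin> Ky" using avoid[of "t - s"] s by auto
      moreover have "X (t - s) (X s (X (- t) x)) = x" by (simp flip: X_add)
      ultimately show False using x by simp
    qed
    have "X t (X (- t) x) \<notin> ess_supp (v t)"
      by (rule no_mass_along_characteristic[OF t _ Kx]) (use *[of 0] * t in auto)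
    then show ?thesis by simp
  qed
  then show ?thesis using AE_zero_outside_ess_supp[of "v t"] by (auto elim: eventually_mono)
qed

text \<open>Mutation is now known to vanish altogether, so trajectories may cross \<open>Kx\<close> and only the initial
  support matters.\<close>

lemma v_zero_outside_image:
  assumes t: "0 \<le> t"
  shows "AE x in lebesgue. x \<notin> X t ` ess_supp v0 \<longrightarrow> v t x = 0"
proof -
  have "x \<notin> ess_supp (v t)" if x: "x \<notin> X t ` ess_supp v0" for x
  proof -
    have "X (- t) x \<notin> ess_supp v0" using x by (metis X_inverse(2) imageI)
    from no_mass_along_characteristic[OF t this compact_empty] v_zero_on_Ky
    have "X t (X (- t) x) \<notin> ess_supp (v t)" by auto
    then show ?thesis by simp
  qed
  then show ?thesis using AE_zero_outside_ess_supp[of "v t"] by (auto elim: eventually_mono)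
qed

text \<open>A bump that equals one on the initial support equals one, once transported, on the support of \<open>v t\<close>;
  its pairing with \<open>v t\<close> is the total mass.\<close>

lemma total_mass:
  shows "(LINT x|lebesgue. v 0 x) = (LINT x|lebesgue. v0 x)"
    and "0 \<le> t \<Longrightarrow> ((\<lambda>t. LINT x|lebesgue. v t x) has_real_derivative (LINT x|lebesgue. v t x * c t x)) (at t within {0..})"
    and "0 \<le> t \<Longrightarrow> integrable lebesgue (\<lambda>x. v t x * c t x)"
proof -
  obtain b where b: "b > 0" "\<And>x. x \<in> ess_supp v0 \<Longrightarrow> norm x \<le> b"
    using compact_imp_bounded[OF supp_compact] unfolding bounded_pos by blast
  \<comment> \<open>The bump of radius \<open>r\<close> equals one where \<open>\<bar>x\<bar>\<^sup>2 \<le> r\<^sup>2 - 1\<close>.\<close>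
  define r where "r = b + 1"
  have r: "0 \<le> r" using b by (simp add: r_def)
  have one: "bump 0 r x = 1" if "x \<in> ess_supp v0" for x
  proof -
    have "(norm x)\<^sup>2 \<le> b\<^sup>2" using b(2)[OF that] by (intro power_mono) auto
    moreover have "b\<^sup>2 + 1 \<le> r\<^sup>2" using b(1) by (simp add: r_def power2_eq_square algebra_simps)
    ultimately show ?thesis by (simp add: bump_def ramp_eq_1 dot_square_norm)
  qed
  have tp: "\<exists>M. transport_problem a X L (bump 0 r) (bump_grad 0 r) (cball 0 r) M v v0 c T {}" if "0 < T" for T
    by (rule bump_transport_problem[OF that r compact_empty, where q = 0]) (use v_zero_on_Ky in auto)
  have bcont: "continuous_on UNIV (\<lambda>x. bump 0 r (X (- t) x))" for t
    by (rule continuous_on_compose2[OF continuous_on_bump]) (auto intro!: continuous_intros)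
  have v_eq: "AE x in lebesgue. v t x * (f x * bump 0 r (X (- t) x)) = v t x * f x" if "0 \<le> t" for t f
    using v_zero_outside_image[OF that]
  proof eventually_elim
    case (elim x)
    then show ?case using one[of "X (- t) x"] by (cases "x \<in> X t ` ess_supp v0") auto
  qed
  have pairing: "(LINT x|lebesgue. v t x * (f x * bump 0 r (X (- t) x))) = (LINT x|lebesgue. v t x * f x)"
    if t: "0 \<le> t" and f: "continuous_on UNIV f" for t f
    by (rule integral_cong_AE[OF _ _ v_eq[OF t]]) (intro v_mult_measurable t f continuous_on_mult bcont)+
  obtain M where "transport_problem a X L (bump 0 r) (bump_grad 0 r) (cball 0 r) M v v0 c 1 {}" using tp[of 1] by auto
  then interpret tp: transport_problem a X L "bump 0 r" "bump_grad 0 r" "cball 0 r" M v v0 c 1 "{}" .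
  have "(LINT x|lebesgue. v0 x * bump 0 r x) = (LINT x|lebesgue. v0 x)"
  proof (rule integral_cong_AE)
    show "AE x in lebesgue. v0 x * bump 0 r x = v0 x"
      using AE_zero_outside_ess_supp[of v0]
    proof eventually_elim
      case (elim x)
      then show ?case using one[of x] by (cases "x \<in> ess_supp v0") auto
    qed
  qed (use v0_int continuous_measurable_lebesgue[OF continuous_on_bump, of 0 r] in \<open>auto intro!: borel_measurable_times\<close>)
  then show "(LINT x|lebesgue. v 0 x) = (LINT x|lebesgue. v0 x)"
    using tp.F_0 pairing[of 0 "\<lambda>x. 1"] by (simp add: tp.F_def)
  show "integrable lebesgue (\<lambda>x. v t x * c t x)" if t: "0 \<le> t" for t
  proof (rule integrable_cong_AE_imp)
    have "continuous_on UNIV (\<lambda>x. c t x * bump 0 r (X (- t) x))"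
      by (intro continuous_on_mult c_slice t bcont)
    moreover have "c t x * bump 0 r (X (- t) x) = 0" if "x \<notin> (\<lambda>x. X t x) ` cball 0 r" for x
    proof -
      have "X (- t) x \<notin> cball 0 r" using that by (metis X_inverse(2) imageI)
      then show ?thesis using bump_outside[OF r, of "X (- t) x" 0] by auto
    qed
    moreover have K: "compact ((\<lambda>x. X t x) ` cball 0 r)" by (intro compact_continuous_image continuous_intros compact_cball)
    ultimately show "integrable lebesgue (\<lambda>x. v t x * (c t x * bump 0 r (X (- t) x)))"
      by (intro locally_integrable_mult in_Wk1_D(2)[OF v_Wk1[OF t]] compactly_supportedI[OF K]) blast+
    show "AE x in lebesgue. v t x * (c t x * bump 0 r (X (- t) x)) = v t x * c t x" by (rule v_eq[OF t])
    show "(\<lambda>x. v t x * c t x) \<in> borel_measurable lebesgue" by (intro v_mult_measurable c_slice t)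
  qed
  show "((\<lambda>t. LINT x|lebesgue. v t x) has_real_derivative (LINT x|lebesgue. v t x * c t x)) (at t within {0..})"
    if t: "0 \<le> t" for t
  proof -
    obtain M where "transport_problem a X L (bump 0 r) (bump_grad 0 r) (cball 0 r) M v v0 c (t + 1) {}"
      using tp[of "t + 1"] t by auto
    then interpret tq: transport_problem a X L "bump 0 r" "bump_grad 0 r" "cball 0 r" M v v0 c "t + 1" "{}" .
    have "(tq.F has_real_derivative tq.P t) (at t within {0..<t + 1})" using t by (intro tq.F_deriv) auto
    moreover have "tq.P t = (LINT x|lebesgue. v t x * c t x)"
      unfolding tq.P_def by (rule pairing[OF t c_slice[OF t]])
    ultimately have "(tq.F has_real_derivative (LINT x|lebesgue. v t x * c t x)) (at t within {0..<t + 1})" by simp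
    then have "((\<lambda>t. LINT x|lebesgue. v t x) has_real_derivative (LINT x|lebesgue. v t x * c t x)) (at t within {0..<t + 1})"
      by (rule has_field_derivative_transform_within[of _ _ _ _ 1])
        (use t pairing[of _ "\<lambda>x. 1"] in \<open>auto simp: tq.F_def\<close>)
    moreover have "at t within {0..<t + 1} = at t within {0..}"
      by (rule at_within_nhd[of _ "{..<t + 1}"]) auto
    ultimately show ?thesis by simp
  qed
qed

end

section \<open>The limit of the total mass\<close>

text \<open>Above \<open>\<kappa>\<close> the function decreases at least at speed \<open>c\<close>, so it reaches \<open>\<kappa>\<close> in finite time; it cannot cross
  back, because the square of the positive part of \<open>q - \<kappa>\<close> is nonincreasing.\<close>

lemma eventually_le_of_decreasing_above:
  fixes q q' :: "real \<Rightarrow> real"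
  assumes q: "\<And>t. 0 \<le> t \<Longrightarrow> (q has_real_derivative q' t) (at t within {0..})"
    and dec: "\<forall>\<^sub>F t in at_top. \<kappa> \<le> q t \<longrightarrow> q' t \<le> - c" and c: "c > 0"
  shows "\<forall>\<^sub>F t in at_top. q t \<le> \<kappa>"
proof -
  obtain T0 where T0: "0 \<le> T0" "\<And>t. T0 \<le> t \<Longrightarrow> \<kappa> \<le> q t \<Longrightarrow> q' t \<le> - c"
  proof -
    obtain T where "\<And>t. T \<le> t \<Longrightarrow> \<kappa> \<le> q t \<longrightarrow> q' t \<le> - c"
      using dec unfolding eventually_at_top_linorder by blast
    then show ?thesis using that[of "max 0 T"] by auto
  qed
  have "\<exists>t1\<ge>T0. q t1 \<le> \<kappa>"
  proof (rule ccontr)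
    assume "\<not> ?thesis"
    then have above: "\<kappa> < q t" if "T0 \<le> t" for t using that by (meson not_le)
    define t where "t = T0 + (q T0 - \<kappa>) / c + 1"
    have t: "T0 < t" using above[of T0] c by (simp add: t_def add_pos_pos)
    have "\<exists>z\<in>{T0<..<t}. q t - q T0 = (\<lambda>h. q' z * h) (t - T0)"
    proof (rule mvt_simple[OF t])
      fix x assume "T0 \<le> x" "x \<le> t"
      then show "(q has_derivative (\<lambda>h. q' x * h)) (at x within {T0..t})"
        using DERIV_subset[OF q[of x], of "{T0..t}"] T0(1)
        by (auto simp: has_field_derivative_def)
    qed
    then obtain z where z: "z \<in> {T0<..<t}" "q t - q T0 = q' z * (t - T0)" by auto
    have "q' z * (t - T0) \<le> - c * (t - T0)"
      using T0(2)[of z] above[of z] z t by (intro mult_right_mono) auto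
    also have "\<dots> = - (q T0 - \<kappa>) - c" using c by (simp add: t_def field_simps)
    finally show False using z(2) above[of t] t c by simp
  qed
  then obtain t1 where t1: "T0 \<le> t1" "q t1 \<le> \<kappa>" by blast
  have "q t \<le> \<kappa>" if t: "t1 \<le> t" for t
  proof -
    define f where "f = (\<lambda>s. (max 0 (q (t1 + s) - \<kappa>))\<^sup>2)"
    have "f (t - t1) \<le> f 0 * exp (0 * (t - t1))"
    proof (rule gronwall)
      fix s assume s: "s \<in> {0..t - t1}"
      have "((\<lambda>s. q (t1 + s)) has_real_derivative q' (t1 + s) * 1) (at s within {0..t - t1})"
      proof (rule DERIV_image_chain[where f = q and g = "\<lambda>s. t1 + s", unfolded o_def])
        show "(q has_real_derivative q' (t1 + s)) (at (t1 + s) within (+) t1 ` {0..t - t1})"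
          by (rule DERIV_subset[OF q]) (use s t1 T0 in auto)
        show "((\<lambda>s. t1 + s) has_real_derivative 1) (at s within {0..t - t1})"
          by (auto intro!: derivative_eq_intros)
      qed
      then have "((\<lambda>s. q (t1 + s) - \<kappa>) has_real_derivative q' (t1 + s)) (at s within {0..t - t1})"
        by (auto intro!: derivative_eq_intros)
      from DERIV_chain2[OF DERIV_pos_part_square this]
      show "(f has_real_derivative 2 * max 0 (q (t1 + s) - \<kappa>) * q' (t1 + s)) (at s within {0..t - t1})"
        unfolding f_def .
      show "2 * max 0 (q (t1 + s) - \<kappa>) * q' (t1 + s) \<le> 0 * f s"
        using T0(2)[of "t1 + s"] t1 s c by (cases "\<kappa> \<le> q (t1 + s)") (auto simp: mult_nonneg_nonpos)
    qed (use t in simp)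
    then have "(max 0 (q t - \<kappa>))\<^sup>2 \<le> 0" using t1(2) by (simp add: f_def)
    then have "max 0 (q t - \<kappa>) = 0" by (simp only: power2_less_eq_zero_iff)
    then show ?thesis by (simp add: max_def split: if_splits)
  qed
  then show ?thesis unfolding eventually_at_top_linorder by blast
qed

text \<open>A perturbed logistic equation \<open>\<rho>' = g \<rho>\<close>, where \<open>g\<close> is asymptotic to a strictly decreasing function
  of \<open>\<rho>\<close>. The logarithm of \<open>\<rho>\<close> moves towards that of the equilibrium with a speed bounded below as long
  as it stays away from it; the logarithm is needed since \<open>\<rho>\<close> may be arbitrarily small.\<close>

lemma logistic_limit:
  fixes \<rho> g r :: "real \<Rightarrow> real"
  assumes pos: "\<And>t. 0 \<le> t \<Longrightarrow> 0 < \<rho> t"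
    and d: "\<And>t. 0 \<le> t \<Longrightarrow> (\<rho> has_real_derivative g t * \<rho> t) (at t within {0..})"
    and r: "\<And>x y. x < y \<Longrightarrow> r y < r x" and r0: "r \<rho>0 = 0" and \<rho>0: "0 < \<rho>0"
    and g: "\<And>e. e > 0 \<Longrightarrow> \<forall>\<^sub>F t in at_top. \<bar>g t - r (\<rho> t)\<bar> \<le> e"
  shows "(\<rho> \<longlongrightarrow> \<rho>0) at_top"
proof (rule tendstoI)
  fix e :: real assume e: "e > 0"
  define \<kappa> where "\<kappa> = min (e / 2) (\<rho>0 / 2)"
  have \<kappa>: "0 < \<kappa>" "\<kappa> < e" "\<kappa> < \<rho>0" using e \<rho>0 by (auto simp: \<kappa>_def min_def)
  have ln: "((\<lambda>t. ln (\<rho> t)) has_real_derivative g t) (at t within {0..})" if "0 \<le> t" for t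
    using DERIV_chain2[OF DERIV_ln[OF pos[OF that]] d[OF that]] pos[OF that] by (simp add: field_simps)
  have nonneg: "\<forall>\<^sub>F t::real in at_top. 0 \<le> t" by (rule eventually_ge_at_top)
  have rle: "r y \<le> r x" if "x \<le> y" for x y using r[of x y] that by (cases "x = y") auto
  have up: "\<forall>\<^sub>F t in at_top. ln (\<rho> t) \<le> ln (\<rho>0 + \<kappa>)"
  proof (rule eventually_le_of_decreasing_above[where q' = g])
    let ?c = "- r (\<rho>0 + \<kappa>) / 2"
    show c: "0 < ?c" using r[of \<rho>0 "\<rho>0 + \<kappa>"] r0 \<kappa> by simp
    show "\<forall>\<^sub>F t in at_top. ln (\<rho>0 + \<kappa>) \<le> ln (\<rho> t) \<longrightarrow> g t \<le> - ?c"
      using g[OF c] nonneg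
    proof eventually_elim
      case (elim t)
      show ?case
      proof
        assume "ln (\<rho>0 + \<kappa>) \<le> ln (\<rho> t)"
        then have "\<rho>0 + \<kappa> \<le> \<rho> t" using pos[OF elim(2)] \<kappa> \<rho>0 by simp
        from rle[OF this] show "g t \<le> - ?c" using elim(1) by linarith
      qed
    qed
  qed (rule ln)
  have down: "\<forall>\<^sub>F t in at_top. - ln (\<rho> t) \<le> - ln (\<rho>0 - \<kappa>)"
  proof (rule eventually_le_of_decreasing_above[where q' = "\<lambda>t. - g t"])
    let ?c = "r (\<rho>0 - \<kappa>) / 2"
    show c: "0 < ?c" using r[of "\<rho>0 - \<kappa>" \<rho>0] r0 \<kappa> by simp
    show "\<forall>\<^sub>F t in at_top. - ln (\<rho>0 - \<kappa>) \<le> - ln (\<rho> t) \<longrightarrow> - g t \<le> - ?c"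
      using g[OF c] nonneg
    proof eventually_elim
      case (elim t)
      show ?case
      proof
        assume "- ln (\<rho>0 - \<kappa>) \<le> - ln (\<rho> t)"
        then have "\<rho> t \<le> \<rho>0 - \<kappa>" using pos[OF elim(2)] \<kappa> \<rho>0 by simp
        from rle[OF this] show "- g t \<le> - ?c" using elim(1) by linarith
      qed
    qed
  qed (rule DERIV_minus[OF ln])
  show "\<forall>\<^sub>F t in at_top. dist (\<rho> t) \<rho>0 < e"
    using up down nonneg
  proof eventually_elim
    case (elim t)
    then have "\<rho> t \<le> \<rho>0 + \<kappa>" "\<rho>0 - \<kappa> \<le> \<rho> t" using pos[OF elim(3)] \<kappa> \<rho>0 by simp_all
    then show ?case using \<kappa> by (simp add: dist_real_def)
  qed
qed

lemma finite_measure_average_bound: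
  fixes h :: "'i \<Rightarrow> real"
  assumes M: "finite_measure M" and h: "h \<in> borel_measurable M" and e: "AE i in M. \<bar>h i - c\<bar> \<le> e"
  shows "integrable M h" "\<bar>(LINT i|M. h i) - c * measure M (space M)\<bar> \<le> e * measure M (space M)"
proof -
  interpret finite_measure M by (rule M)
  have "AE i in M. norm (h i) \<le> \<bar>c\<bar> + e" using e by eventually_elim auto
  then show i: "integrable M h" by (rule integrable_const_bound) (rule h)
  have "(LINT i|M. h i) - c * measure M (space M) = (LINT i|M. h i - c)" using i by simp
  also have "\<bar>\<dots>\<bar> \<le> (LINT i|M. \<bar>h i - c\<bar>)" by (rule integral_abs_bound)
  also have "\<dots> \<le> (LINT i|M. e)" using i e by (intro integral_mono_AE) auto
  finally show "\<bar>(LINT i|M. h i) - c * measure M (space M)\<bar> \<le> e * measure M (space M)" by (simp add: mult.commute)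
qed

text \<open>A family of measures \<open>N t\<close>, transported to \<open>\<real>\<^sup>d\<close> by positions \<open>p t\<close> that contract to \<open>xhat\<close>, whose mass
  grows at the rate \<open>R\<close>. Both the density \<open>v t\<close> (with the identity as position) and the particle
  system (a weighted counting measure on the indices) are of this form.\<close>

locale concentrating_family =
  fixes N :: "real \<Rightarrow> 'i measure" and p :: "real \<Rightarrow> 'i \<Rightarrow> 'a::euclidean_space"
    and R :: "'a \<Rightarrow> real \<Rightarrow> real" and \<psi> :: "'a \<Rightarrow> 'a \<Rightarrow> real" and \<psi>low Istar :: real
    and xhat :: 'a and d :: "real \<Rightarrow> real" and d0 \<rho>hat :: real
  assumes fin: "\<And>t. 0 \<le> t \<Longrightarrow> finite_measure (N t)"
    and p_meas: "\<And>t. 0 \<le> t \<Longrightarrow> p t \<in> borel_measurable (N t)"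
    and near: "\<And>t. 0 \<le> t \<Longrightarrow> AE i in N t. norm (p t i - xhat) \<le> d t"
    and d: "\<And>t. 0 \<le> t \<Longrightarrow> d t \<le> d0" "(d \<longlongrightarrow> 0) at_top" and d0: "0 \<le> d0"
    and R_cont: "continuous_on UNIV (\<lambda>(x, I). R x I)"
    and \<psi>_cont: "continuous_on UNIV (\<lambda>(x, y). \<psi> x y)"
    and \<psi>low: "0 < \<psi>low" "\<And>x y. \<psi>low \<le> \<psi> x y"
    and Istar: "\<And>x I. Istar \<le> I \<Longrightarrow> R x I \<le> 0"
    and R_dec: "\<And>I J. I < J \<Longrightarrow> R xhat J < R xhat I"
    and \<rho>hat: "0 < \<rho>hat" "R xhat (\<psi> xhat xhat * \<rho>hat) = 0"
    and mass0: "0 < measure (N 0) (space (N 0))"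
    and rate_int: "\<And>t. 0 \<le> t \<Longrightarrow> integrable (N t) (\<lambda>i. R (p t i) (LINT j|N t. \<psi> (p t i) (p t j)))"
    and mass_deriv: "\<And>t. 0 \<le> t \<Longrightarrow> ((\<lambda>t. measure (N t) (space (N t))) has_real_derivative
        (LINT i|N t. R (p t i) (LINT j|N t. \<psi> (p t i) (p t j)))) (at t within {0..})"
begin

definition \<rho> :: "real \<Rightarrow> real" where "\<rho> t = measure (N t) (space (N t))"

definition G :: "real \<Rightarrow> 'a \<Rightarrow> real" where "G t x = (LINT j|N t. \<psi> x (p t j))"

definition \<rho>' :: "real \<Rightarrow> real" where "\<rho>' t = (LINT i|N t. R (p t i) (G t (p t i)))"

lemma \<rho>_deriv: "0 \<le> t \<Longrightarrow> (\<rho> has_real_derivative \<rho>' t) (at t within {0..})"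
  using mass_deriv by (simp add: \<rho>_def[abs_def] \<rho>'_def G_def)

lemma \<rho>_nonneg: "0 \<le> \<rho> t" by (simp add: \<rho>_def)

lemma near_cball: "0 \<le> t \<Longrightarrow> AE i in N t. p t i \<in> cball xhat d0"
proof -
  assume t: "0 \<le> t"
  from near[OF t] show ?thesis
    by eventually_elim (use d(1)[OF t] in \<open>auto simp: dist_norm norm_minus_commute\<close>)
qed

lemma \<psi>_meas: "0 \<le> t \<Longrightarrow> (\<lambda>j. \<psi> x (p t j)) \<in> borel_measurable (N t)"
proof -
  assume t: "0 \<le> t"
  have "continuous_on UNIV (\<psi> x)" by (rule continuous_on_slice_UNIV[OF \<psi>_cont])
  then have "\<psi> x \<in> borel_measurable borel" by (rule borel_measurable_continuous_onI)
  from measurable_compose[OF p_meas[OF t] this] show ?thesis .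
qed

lemma \<psi>_bound: obtains \<Psi> where "\<Psi> > 0" "\<And>x y. x \<in> cball xhat d0 \<Longrightarrow> y \<in> cball xhat d0 \<Longrightarrow> \<bar>\<psi> x y\<bar> \<le> \<Psi>"
proof -
  have "continuous_on (cball xhat d0 \<times> cball xhat d0) (\<lambda>(x, y). \<psi> x y)"
    by (rule continuous_on_subset[OF \<psi>_cont]) simp
  from compact_abs_bound[OF compact_Times[OF compact_cball compact_cball] this] show ?thesis
    using that by (metis SigmaI case_prod_conv)
qed

lemma G_bounds:
  assumes t: "0 \<le> t" and x: "x \<in> cball xhat d0" and \<Psi>: "\<And>y. y \<in> cball xhat d0 \<Longrightarrow> \<bar>\<psi> x y\<bar> \<le> \<Psi>"
  shows "\<psi>low * \<rho> t \<le> G t x" "G t x \<le> \<Psi> * \<rho> t"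
proof -
  interpret finite_measure "N t" by (rule fin[OF t])
  have b: "AE j in N t. \<bar>\<psi> x (p t j) - 0\<bar> \<le> \<Psi>"
    using near_cball[OF t] by eventually_elim (use \<Psi> in simp)
  note avg = finite_measure_average_bound[OF fin[OF t] \<psi>_meas[OF t] b]
  show "G t x \<le> \<Psi> * \<rho> t" using avg(2) by (simp add: G_def \<rho>_def)
  have "(LINT j|N t. \<psi>low) \<le> (LINT j|N t. \<psi> x (p t j))"
    by (intro integral_mono avg(1) \<psi>low) simp
  then show "\<psi>low * \<rho> t \<le> G t x" by (simp add: G_def \<rho>_def mult.commute)
qed

text \<open>A mass above \<open>Istar / \<psi>low\<close> forces the nonlocal term up to at least \<open>Istar\<close>, where the growth rate is not positive.\<close>

lemma \<rho>'_nonpos: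
  assumes t: "0 \<le> t" and large: "Istar / \<psi>low \<le> \<rho> t"
  shows "\<rho>' t \<le> 0"
proof -
  obtain \<Psi> where \<Psi>: "\<Psi> > 0" "\<And>x y. x \<in> cball xhat d0 \<Longrightarrow> y \<in> cball xhat d0 \<Longrightarrow> \<bar>\<psi> x y\<bar> \<le> \<Psi>"
    using \<psi>_bound by blast
  have "\<rho>' t \<le> (LINT i|N t. 0)"
    unfolding \<rho>'_def
  proof (rule integral_mono_AE)
    show "AE i in N t. R (p t i) (G t (p t i)) \<le> 0"
      using near_cball[OF t]
    proof eventually_elim
      case (elim i)
      have "Istar \<le> \<psi>low * \<rho> t" using large \<psi>low(1) by (simp add: field_simps)
      also have "\<dots> \<le> G t (p t i)" by (rule G_bounds(1)[OF t elim \<Psi>(2)[OF elim]])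
      finally show ?case by (rule Istar)
    qed
  qed (use rate_int[OF t] in \<open>auto simp: G_def\<close>)
  then show ?thesis by simp
qed

lemma \<rho>_bounded: obtains Mmax where "Mmax > 0" "\<And>t. 0 \<le> t \<Longrightarrow> \<rho> t \<le> Mmax"
proof -
  define Mm where "Mm = max (\<rho> 0) (Istar / \<psi>low)"
  have "\<rho> t \<le> Mm" if t: "0 \<le> t" for t
  proof -
    define f where "f = (\<lambda>s. (max 0 (\<rho> s - Mm))\<^sup>2)"
    have "f t \<le> f 0 * exp (0 * t)"
    proof (rule gronwall[OF t])
      fix s assume s: "s \<in> {0..t}"
      have "(\<rho> has_real_derivative \<rho>' s) (at s within {0..t})"
        by (rule DERIV_subset[OF \<rho>_deriv]) (use s in auto)
      then have "((\<lambda>s. \<rho> s - Mm) has_real_derivative \<rho>' s) (at s within {0..t})"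
        by (auto intro!: derivative_eq_intros)
      from DERIV_chain2[OF DERIV_pos_part_square this]
      show "(f has_real_derivative 2 * max 0 (\<rho> s - Mm) * \<rho>' s) (at s within {0..t})"
        unfolding f_def .
      show "2 * max 0 (\<rho> s - Mm) * \<rho>' s \<le> 0 * f s"
        using \<rho>'_nonpos[of s] s by (cases "Mm \<le> \<rho> s") (auto simp: mult_nonneg_nonpos Mm_def)
    qed
    moreover have "f 0 = 0" by (simp add: f_def Mm_def)
    ultimately have "(max 0 (\<rho> t - Mm))\<^sup>2 \<le> 0" by (simp add: f_def)
    then have "max 0 (\<rho> t - Mm) = 0" by (simp only: power2_less_eq_zero_iff)
    then show ?thesis by (simp add: max_def split: if_splits)
  qed
  moreover have "Mm > 0" using mass0 by (simp add: Mm_def \<rho>_def less_max_iff_disj)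
  ultimately show ?thesis by (rule that[rotated])
qed

lemma \<rho>_pos: assumes t: "0 \<le> t" shows "0 < \<rho> t"
proof -
  obtain \<Psi> where \<Psi>: "\<Psi> > 0" "\<And>x y. x \<in> cball xhat d0 \<Longrightarrow> y \<in> cball xhat d0 \<Longrightarrow> \<bar>\<psi> x y\<bar> \<le> \<Psi>"
    using \<psi>_bound by blast
  obtain Mm where Mm: "Mm > 0" "\<And>t. 0 \<le> t \<Longrightarrow> \<rho> t \<le> Mm" using \<rho>_bounded by blast
  have "continuous_on (cball xhat d0 \<times> {0..\<Psi> * Mm}) (\<lambda>(x, I). R x I)"
    by (rule continuous_on_subset[OF R_cont]) simp
  from compact_abs_bound[OF compact_Times[OF compact_cball compact_Icc] this]
  obtain B where B: "B > 0" "\<And>x I. x \<in> cball xhat d0 \<Longrightarrow> I \<in> {0..\<Psi> * Mm} \<Longrightarrow> \<bar>R x I\<bar> \<le> B"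
    by (metis SigmaI case_prod_conv)
  have rate: "- \<rho>' s \<le> B * \<rho> s" if s: "0 \<le> s" for s
  proof -
    have "AE i in N s. \<bar>R (p s i) (G s (p s i)) - 0\<bar> \<le> B"
      using near_cball[OF s]
    proof eventually_elim
      case (elim i)
      note Gb = G_bounds[OF s elim \<Psi>(2)[OF elim]]
      have "0 \<le> \<psi>low * \<rho> s" using \<psi>low(1) \<rho>_nonneg by simp
      moreover have "\<Psi> * \<rho> s \<le> \<Psi> * Mm" using \<Psi>(1) Mm(2)[OF s] by simp
      ultimately have "G s (p s i) \<in> {0..\<Psi> * Mm}" using Gb by auto
      then show ?case using B(2)[OF elim] by simp
    qed
    from finite_measure_average_bound(2)[OF fin[OF s] _ this] rate_int[OF s]
    show ?thesis by (simp add: \<rho>'_def \<rho>_def G_def borel_measurable_integrable abs_le_iff)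
  qed
  have "- \<rho> t \<le> - \<rho> 0 * exp ((- B) * t)"
  proof (rule gronwall[OF t, where f = "\<lambda>t. - \<rho> t" and f' = "\<lambda>t. - \<rho>' t"])
    fix s assume s: "s \<in> {0..t}"
    show "((\<lambda>t. - \<rho> t) has_real_derivative - \<rho>' s) (at s within {0..t})"
      by (rule DERIV_minus, rule DERIV_subset[OF \<rho>_deriv]) (use s in auto)
    show "- \<rho>' s \<le> - B * - \<rho> s" using rate s by simp
  qed
  moreover have "0 < \<rho> 0 * exp ((- B) * t)" using mass0 by (simp add: \<rho>_def)
  ultimately show ?thesis by simp
qed

lemma eventually_near:
  assumes e: "e > 0"
  shows "\<forall>\<^sub>F t in at_top. 0 \<le> t \<and> (AE i in N t. norm (p t i - xhat) < e)"
  using order_tendstoD(2)[OF d(2) e] eventually_ge_at_top[of 0]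
proof eventually_elim
  case (elim t)
  from near[OF elim(2)] have "AE i in N t. norm (p t i - xhat) < e"
    by eventually_elim (use elim in auto)
  then show ?case using elim by simp
qed

text \<open>All positions and all weights \<open>\<psi>\<close> between them are eventually close to their values at \<open>xhat\<close>, and the
  masses are bounded, so that uniform continuity of \<open>R\<close> on a compact set applies.\<close>

lemma mean_rate_limit:
  assumes e: "e > 0"
  shows "\<forall>\<^sub>F t in at_top. \<bar>\<rho>' t / \<rho> t - R xhat (\<psi> xhat xhat * \<rho> t)\<bar> \<le> e"
proof -
  obtain \<Psi> where \<Psi>: "\<Psi> > 0" "\<And>x y. x \<in> cball xhat d0 \<Longrightarrow> y \<in> cball xhat d0 \<Longrightarrow> \<bar>\<psi> x y\<bar> \<le> \<Psi>"
    using \<psi>_bound by blast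
  obtain Mm where Mm: "Mm > 0" "\<And>t. 0 \<le> t \<Longrightarrow> \<rho> t \<le> Mm" using \<rho>_bounded by blast
  let ?K = "cball xhat d0 \<times> {0..\<Psi> * Mm}"
  have "continuous_on ?K (\<lambda>(x, I). R x I)" by (rule continuous_on_subset[OF R_cont]) simp
  then have "uniformly_continuous_on ?K (\<lambda>(x, I). R x I)"
    by (intro compact_uniformly_continuous compact_Times compact_cball compact_Icc)
  then obtain \<delta> where \<delta>: "\<delta> > 0"
    "\<And>q q'. q \<in> ?K \<Longrightarrow> q' \<in> ?K \<Longrightarrow> dist q' q < \<delta> \<Longrightarrow> dist ((\<lambda>(x, I). R x I) q') ((\<lambda>(x, I). R x I) q) < e"
    using e unfolding uniformly_continuous_on_def by metis
  define e2 where "e2 = \<delta> / (4 * Mm)"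
  have e2: "e2 > 0" using \<delta>(1) Mm(1) by (simp add: e2_def)
  have "isCont (\<lambda>(x, y). \<psi> x y) (xhat, xhat)" using \<psi>_cont by (simp add: continuous_on_eq_continuous_at)
  then obtain \<delta>' where \<delta>': "\<delta>' > 0"
    "\<And>q. dist q (xhat, xhat) < \<delta>' \<Longrightarrow> dist ((\<lambda>(x, y). \<psi> x y) q) (\<psi> xhat xhat) < e2"
    using e2 unfolding continuous_at_eps_delta by fastforce
  have \<psi>_close: "\<bar>\<psi> x y - \<psi> xhat xhat\<bar> \<le> e2" if "norm (x - xhat) < \<delta>' / 2" "norm (y - xhat) < \<delta>' / 2" for x y
  proof -
    have "dist (x, y) (xhat, xhat) \<le> dist x xhat + dist y xhat"
      by (simp add: dist_Pair_Pair sqrt_sum_squares_le_sum)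
    also have "\<dots> < \<delta>'" using that by (simp add: dist_norm)
    finally show ?thesis using \<delta>'(2)[of "(x, y)"] by (simp add: dist_real_def)
  qed
  have "0 < min (\<delta>' / 2) (\<delta> / 2)" using \<delta> \<delta>' by simp
  from eventually_near[OF this] show ?thesis
  proof eventually_elim
    case (elim t)
    then have t: "0 \<le> t" and nr: "AE i in N t. norm (p t i - xhat) < min (\<delta>' / 2) (\<delta> / 2)" by auto
    have xh: "xhat \<in> cball xhat d0" using d0 by simp
    have "AE i in N t. \<bar>R (p t i) (G t (p t i)) - R xhat (\<psi> xhat xhat * \<rho> t)\<bar> \<le> e"
      using nr near_cball[OF t]
    proof eventually_elim
      case (elim i)
      have "AE j in N t. \<bar>\<psi> (p t i) (p t j) - \<psi> xhat xhat\<bar> \<le> e2"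
        using nr by eventually_elim (use elim in \<open>auto intro: \<psi>_close\<close>)
      from finite_measure_average_bound(2)[OF fin[OF t] \<psi>_meas[OF t] this]
      have "\<bar>G t (p t i) - \<psi> xhat xhat * \<rho> t\<bar> \<le> e2 * \<rho> t" by (simp add: G_def \<rho>_def)
      also have "\<dots> \<le> e2 * Mm" using e2 Mm(2)[OF t] by simp
      also have "\<dots> < \<delta> / 2" using Mm(1) \<delta>(1) by (simp add: e2_def)
      finally have close: "\<bar>G t (p t i) - \<psi> xhat xhat * \<rho> t\<bar> < \<delta> / 2" .
      have inK: "(p t i, G t (p t i)) \<in> ?K" "(xhat, \<psi> xhat xhat * \<rho> t) \<in> ?K"
      proof -
        have "0 \<le> \<psi>low * \<rho> t" "\<Psi> * \<rho> t \<le> \<Psi> * Mm"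
          using \<psi>low(1) \<rho>_nonneg \<Psi>(1) Mm(2)[OF t] by simp_all
        then show "(p t i, G t (p t i)) \<in> ?K"
          using G_bounds[OF t elim(2) \<Psi>(2)[OF elim(2)]] elim(2) by auto
        have "\<psi> xhat xhat * \<rho> t \<le> \<Psi> * Mm"
          using \<Psi>(2)[OF xh xh] Mm(2)[OF t] \<rho>_nonneg \<Psi>(1) by (intro mult_mono) auto
        moreover have "0 \<le> \<psi> xhat xhat * \<rho> t"
          using \<psi>low(2)[of xhat xhat] \<psi>low(1) \<rho>_nonneg by simp
        ultimately show "(xhat, \<psi> xhat xhat * \<rho> t) \<in> ?K" using xh by auto
      qed
      have "dist (p t i, G t (p t i)) (xhat, \<psi> xhat xhat * \<rho> t) \<le>
          dist (p t i) xhat + dist (G t (p t i)) (\<psi> xhat xhat * \<rho> t)"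
        by (simp add: dist_Pair_Pair sqrt_sum_squares_le_sum)
      also have "\<dots> < \<delta>" using close elim(1) by (simp add: dist_norm dist_real_def)
      finally show ?case using \<delta>(2)[OF inK(2,1)] by (simp add: dist_real_def)
    qed
    from finite_measure_average_bound(2)[OF fin[OF t] _ this] rate_int[OF t]
    have *: "\<bar>\<rho>' t - R xhat (\<psi> xhat xhat * \<rho> t) * \<rho> t\<bar> \<le> e * \<rho> t"
      by (simp add: \<rho>'_def \<rho>_def G_def borel_measurable_integrable)
    have "\<rho>' t / \<rho> t - R xhat (\<psi> xhat xhat * \<rho> t) = (\<rho>' t - R xhat (\<psi> xhat xhat * \<rho> t) * \<rho> t) / \<rho> t"
      using \<rho>_pos[OF t] by (simp add: field_simps)
    then have "\<bar>\<rho>' t / \<rho> t - R xhat (\<psi> xhat xhat * \<rho> t)\<bar> = \<bar>\<rho>' t - R xhat (\<psi> xhat xhat * \<rho> t) * \<rho> t\<bar> / \<rho> t"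
      using \<rho>_pos[OF t] by (simp add: abs_divide)
    also have "\<dots> \<le> e" using * \<rho>_pos[OF t] by (simp add: divide_le_eq)
    finally show ?case .
  qed
qed

lemma mass_limit: "(\<rho> \<longlongrightarrow> \<rho>hat) at_top"
proof (rule logistic_limit[OF \<rho>_pos _ _ \<rho>hat(2,1) mean_rate_limit])
  show "(\<rho> has_real_derivative \<rho>' t / \<rho> t * \<rho> t) (at t within {0..})" if "0 \<le> t" for t
    using \<rho>_deriv[OF that] \<rho>_pos[OF that] by simp
  have "0 < \<psi> xhat xhat" using \<psi>low(1) \<psi>low(2)[of xhat xhat] by linarith
  then show "R xhat (\<psi> xhat xhat * y) < R xhat (\<psi> xhat xhat * x)" if "x < y" for x y
    using that by (intro R_dec) simp
qed

theorem concentration: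
  fixes f :: "'a \<Rightarrow> real"
  assumes f: "continuous_on UNIV f"
  shows "((\<lambda>t. LINT i|N t. f (p t i)) \<longlongrightarrow> \<rho>hat * f xhat) at_top"
proof -
  obtain Mm where Mm: "Mm > 0" "\<And>t. 0 \<le> t \<Longrightarrow> \<rho> t \<le> Mm" using \<rho>_bounded by blast
  have "((\<lambda>t. (LINT i|N t. f (p t i)) - f xhat * \<rho> t) \<longlongrightarrow> 0) at_top"
  proof (rule tendstoI)
    fix e :: real assume e: "e > 0"
    define e2 where "e2 = e / (2 * Mm)"
    have e2: "e2 > 0" using e Mm by (simp add: e2_def)
    have "isCont f xhat" using f by (simp add: continuous_on_eq_continuous_at)
    then obtain \<delta> where \<delta>: "\<delta> > 0" "\<And>x. dist x xhat < \<delta> \<Longrightarrow> dist (f x) (f xhat) < e2"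
      using e2 unfolding continuous_at_eps_delta by metis
    from eventually_near[OF \<delta>(1)]
    show "\<forall>\<^sub>F t in at_top. dist ((LINT i|N t. f (p t i)) - f xhat * \<rho> t) 0 < e"
    proof eventually_elim
      case (elim t)
      then have t: "0 \<le> t" and nr: "AE i in N t. norm (p t i - xhat) < \<delta>" by auto
      have m: "(\<lambda>i. f (p t i)) \<in> borel_measurable (N t)"
        by (rule measurable_compose[OF p_meas[OF t] borel_measurable_continuous_onI[OF f]])
      have "AE i in N t. \<bar>f (p t i) - f xhat\<bar> \<le> e2"
        using nr
      proof eventually_elim
        case (elim i)
        then show ?case using \<delta>(2)[of "p t i"] by (simp add: dist_norm)
      qed
      from finite_measure_average_bound(2)[OF fin[OF t] m this]
      have "\<bar>(LINT i|N t. f (p t i)) - f xhat * \<rho> t\<bar> \<le> e2 * \<rho> t" by (simp add: \<rho>_def)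
      also have "\<dots> \<le> e2 * Mm" using e2 Mm(2)[OF t] by simp
      also have "\<dots> < e" using e Mm(1) by (simp add: e2_def)
      finally show ?case by (simp add: dist_real_def)
    qed
  qed
  from tendsto_add[OF this tendsto_mult_left[OF mass_limit, of "f xhat"]]
  show ?thesis by (simp add: mult.commute)
qed

end

section \<open>Concentration of the solution\<close>

lemma (in selection_mutation) density_properties:
  assumes t: "0 \<le> t"
  shows "finite_measure (density lebesgue (\<lambda>x. ennreal (v t x)))"
    and "measure (density lebesgue (\<lambda>x. ennreal (v t x))) (space (density lebesgue (\<lambda>x. ennreal (v t x)))) =
      (LINT x|lebesgue. v t x)"
    and "f \<in> borel_measurable lebesgue \<Longrightarrow>
      (LINT x|density lebesgue (\<lambda>x. ennreal (v t x)). f x) = (LINT x|lebesgue. v t x * f x)"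
    and "f \<in> borel_measurable lebesgue \<Longrightarrow> integrable lebesgue (\<lambda>x. v t x * f x) \<Longrightarrow>
      integrable (density lebesgue (\<lambda>x. ennreal (v t x))) f"
proof -
  let ?N = "density lebesgue (\<lambda>x. ennreal (v t x))"
  have vm: "v t \<in> borel_measurable lebesgue" using v_int[OF t] by simp
  have "emeasure ?N (space ?N) = (\<integral>\<^sup>+ x. ennreal (v t x) \<partial>lebesgue)"
    using vm by (simp add: emeasure_density)
  also have "\<dots> = ennreal (LINT x|lebesgue. v t x)" by (rule nn_integral_eq_integral[OF v_int[OF t] v_nonneg[OF t]])
  finally have em: "emeasure ?N (space ?N) = ennreal (LINT x|lebesgue. v t x)" .
  then show "finite_measure ?N" by (intro finite_measureI) simp
  have "0 \<le> (LINT x|lebesgue. v t x)" by (rule integral_nonneg_AE[OF v_nonneg[OF t]])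
  then show "measure ?N (space ?N) = (LINT x|lebesgue. v t x)" using em by (simp add: Sigma_Algebra.measure_def)
  show "(LINT x|?N. f x) = (LINT x|lebesgue. v t x * f x)" if "f \<in> borel_measurable lebesgue"
    using integral_density[OF that vm v_nonneg[OF t]] by simp
  show "integrable ?N f" if "f \<in> borel_measurable lebesgue" "integrable lebesgue (\<lambda>x. v t x * f x)"
    using that(2) integrable_density[OF that(1) vm v_nonneg[OF t]] by simp
qed

text \<open>The assumptions of the limit theorem on the growth rate at the equilibrium, shared by the
  solution and its particle approximation.\<close>

locale concentration_problem = selection_mutation a X L k R \<psi>g \<psi>d m v0 v Kx Ky
  for a :: "'a::euclidean_space \<Rightarrow> 'a" and X :: "real \<Rightarrow> 'a \<Rightarrow> 'a" and L :: real
    and k :: nat and R :: "'a \<Rightarrow> real \<Rightarrow> real" and \<psi>g \<psi>d :: "'a \<Rightarrow> 'a \<Rightarrow> real"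
    and m :: "'a \<Rightarrow> 'a \<Rightarrow> real \<Rightarrow> real" and v0 :: "'a \<Rightarrow> real" and v :: "real \<Rightarrow> 'a \<Rightarrow> real"
    and Kx Ky :: "'a set" +
  fixes \<psi>low Istar :: real and xhat :: 'a and Cd \<delta>d \<rho>hat :: real
  assumes Cd: "0 < Cd" and \<delta>d: "0 < \<delta>d"
    and decay: "\<And>y t. y \<in> ess_supp v0 \<Longrightarrow> 0 \<le> t \<Longrightarrow> norm (X t y - xhat) \<le> Cd * exp (- \<delta>d * t)"
    and \<psi>low: "0 < \<psi>low" "\<And>x y. \<psi>low \<le> \<psi>g x y"
    and Istar: "\<And>x I. Istar \<le> I \<Longrightarrow> R x I \<le> 0"
    and R_dec: "\<And>I J. I < J \<Longrightarrow> R xhat J < R xhat I"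
    and \<rho>hat: "0 < \<rho>hat" "R xhat (\<psi>g xhat xhat * \<rho>hat) = 0"
    and v0_nonzero: "\<not> (AE x in lebesgue. v0 x = 0)"
begin

lemma decay_rate:
  "0 \<le> t \<Longrightarrow> Cd * exp (- \<delta>d * t) \<le> Cd" "((\<lambda>t. Cd * exp (- \<delta>d * t)) \<longlongrightarrow> 0) at_top"
proof -
  show "0 \<le> t \<Longrightarrow> Cd * exp (- \<delta>d * t) \<le> Cd" using Cd \<delta>d by simp
  have "filterlim (\<lambda>t. \<delta>d * t) at_top at_top"
    by (rule filterlim_tendsto_pos_mult_at_top[OF tendsto_const \<delta>d filterlim_ident])
  then have "filterlim (\<lambda>t. - \<delta>d * t) at_bot at_top"
    by (simp add: filterlim_uminus_at_bot)
  from tendsto_mult_right_zero[OF filterlim_compose[OF exp_at_bot this], of Cd]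
  show "((\<lambda>t. Cd * exp (- \<delta>d * t)) \<longlongrightarrow> 0) at_top" .
qed

lemma solution_concentrating:
  "concentrating_family (\<lambda>t. density lebesgue (\<lambda>x. ennreal (v t x))) (\<lambda>t x. x) R \<psi>g \<psi>low Istar
    xhat (\<lambda>t. Cd * exp (- \<delta>d * t)) Cd \<rho>hat"
proof (rule concentrating_family.intro)
  let ?N = "\<lambda>t. density lebesgue (\<lambda>x. ennreal (v t x))"
  note dp = density_properties
  show "finite_measure (?N t)" if "0 \<le> t" for t by (rule dp(1)[OF that])
  show "(\<lambda>x. x) \<in> borel_measurable (?N t)" for t
    using continuous_measurable_lebesgue[OF continuous_on_id] by simp
  show "AE x in ?N t. norm (x - xhat) \<le> Cd * exp (- \<delta>d * t)" if t: "0 \<le> t" for t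
  proof (subst AE_density)
    show "(\<lambda>x. ennreal (v t x)) \<in> borel_measurable lebesgue" using v_int[OF t] by simp
    show "AE x in lebesgue. 0 < ennreal (v t x) \<longrightarrow> norm (x - xhat) \<le> Cd * exp (- \<delta>d * t)"
      using v_zero_outside_image[OF t]
    proof eventually_elim
      case (elim x)
      show ?case using elim decay[OF _ t] by (cases "x \<in> X t ` ess_supp v0") auto
    qed
  qed
  have G: "(LINT y|?N t. \<psi>g x y) = nonlocal \<psi>g v t x" if "0 \<le> t" for t x
    using dp(3)[OF that continuous_measurable_lebesgue[OF weight_regular_continuous(2)[OF \<psi>g]]]
    by (simp add: nonlocal_def mult.commute)
  have cm: "c t \<in> borel_measurable lebesgue" if "0 \<le> t" for t
    by (rule continuous_measurable_lebesgue[OF c_slice[OF that]])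
  have Req: "(\<lambda>x. R x (LINT y|?N t. \<psi>g x y)) = c t" if "0 \<le> t" for t
    using G[OF that] by (simp add: c_def fun_eq_iff)
  show "integrable (?N t) (\<lambda>x. R x (LINT y|?N t. \<psi>g x y))" if t: "0 \<le> t" for t
    unfolding Req[OF t] by (rule dp(4)[OF t cm[OF t] total_mass(3)[OF t]])
  show "((\<lambda>t. measure (?N t) (space (?N t))) has_real_derivative
      (LINT x|?N t. R x (LINT y|?N t. \<psi>g x y))) (at t within {0..})" if t: "0 \<le> t" for t
    unfolding Req[OF t] dp(3)[OF t cm[OF t]]
    by (rule has_field_derivative_transform_within[OF total_mass(2)[OF t], of 1]) (use t dp(2) in auto)
  have "0 < (LINT x|lebesgue. v0 x)"
    using integral_nonneg_eq_0_iff_AE[OF v0_int v0_nonneg] v0_nonzero integral_nonneg_AE[OF v0_nonneg]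
    by (simp add: less_le)
  then show "0 < measure (?N 0) (space (?N 0))" using dp(2)[of 0] total_mass(1) by simp
  show "continuous_on UNIV (\<lambda>(x, y). \<psi>g x y)" by (rule weight_regular_continuous(1)[OF \<psi>g])
qed (use decay_rate Cd R_cont \<psi>low Istar R_dec \<rho>hat in auto)

theorem solution_concentrates:
  assumes f: "continuous_on UNIV f"
  shows "((\<lambda>t. LINT x|density lebesgue (\<lambda>x. ennreal (v t x)). f x) \<longlongrightarrow> \<rho>hat * f xhat) at_top"
    and "((\<lambda>t. LINT x|lebesgue. f x * v t x) \<longlongrightarrow> \<rho>hat * f xhat) at_top"
proof -
  interpret concentrating_family "\<lambda>t. density lebesgue (\<lambda>x. ennreal (v t x))" "\<lambda>t x. x" R \<psi>g \<psi>low Istar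
    xhat "\<lambda>t. Cd * exp (- \<delta>d * t)" Cd \<rho>hat by (rule solution_concentrating)
  show 1: "((\<lambda>t. LINT x|density lebesgue (\<lambda>x. ennreal (v t x)). f x) \<longlongrightarrow> \<rho>hat * f xhat) at_top"
    by (rule concentration[OF f])
  show "((\<lambda>t. LINT x|lebesgue. f x * v t x) \<longlongrightarrow> \<rho>hat * f xhat) at_top"
  proof (rule Lim_transform_eventually[OF 1])
    show "\<forall>\<^sub>F t in at_top. (LINT x|density lebesgue (\<lambda>x. ennreal (v t x)). f x) = (LINT x|lebesgue. f x * v t x)"
      using eventually_ge_at_top[of 0]
      by eventually_elim (simp add: density_properties(3) continuous_measurable_lebesgue[OF f] mult.commute)
  qed
qed

end

section \<open>The particle system\<close>

text \<open>Two distinct points of an infinite subset of \<open>K\<close> near one of its limit points would violate the separation.\<close>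

lemma finite_separated_in_compact:
  fixes f :: "'i \<Rightarrow> 'a::heine_borel"
  assumes r: "0 < r" and sep: "\<And>i j. i \<in> I \<Longrightarrow> j \<in> I \<Longrightarrow> i \<noteq> j \<Longrightarrow> r \<le> dist (f i) (f j)"
    and K: "compact K" "f ` I \<subseteq> K"
  shows "finite I"
proof (rule ccontr)
  assume "infinite I"
  have "inj_on f I"
  proof (rule inj_onI)
    fix i j assume "i \<in> I" "j \<in> I" "f i = f j"
    then show "i = j" using sep[of i j] r by (cases "i = j") auto
  qed
  with \<open>infinite I\<close> have "infinite (f ` I)" by (simp add: finite_image_iff)
  then obtain y where y: "y islimpt (f ` I)"
    using Heine_Borel_imp_Bolzano_Weierstrass[OF K(1)] K(2) by metis
  have r2: "r / 2 > 0" using r by simp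
  have "infinite (f ` I \<inter> ball y (r / 2))"
    using y r2 unfolding islimpt_eq_infinite_ball by blast
  then obtain p q where pq: "p \<in> f ` I \<inter> ball y (r / 2)" "q \<in> f ` I \<inter> ball y (r / 2)" "p \<noteq> q"
    by (metis finite.emptyI finite.insertI finite_subset insertCI subsetI)
  then obtain i j where ij: "i \<in> I" "j \<in> I" "p = f i" "q = f j" by auto
  then have "r \<le> dist p q" using sep[of i j] pq(3) by auto
  moreover have "dist p q < r" using pq(1,2) dist_triangle_less_add[of p y "r/2" q "r/2"]
    by (auto simp: dist_commute)
  ultimately show False by simp
qed

text \<open>The square of the negative part of \<open>n\<close> satisfies the hypothesis of Gronwall's inequality and starts at zero.\<close>

lemma nonneg_of_linear_ode:
  fixes n g :: "real \<Rightarrow> real"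
  assumes t: "0 \<le> t" and d: "\<And>s. s \<in> {0..t} \<Longrightarrow> (n has_real_derivative g s * n s) (at s within {0..t})"
    and B: "\<And>s. s \<in> {0..t} \<Longrightarrow> \<bar>g s\<bar> \<le> B" and n0: "0 \<le> n 0"
  shows "0 \<le> n t"
proof -
  define f where "f = (\<lambda>s. (max 0 (- n s))\<^sup>2)"
  have "f t \<le> f 0 * exp ((2 * B) * t)"
  proof (rule gronwall[OF t])
    fix s assume s: "s \<in> {0..t}"
    from DERIV_chain2[OF DERIV_pos_part_square DERIV_minus[OF d[OF s]]]
    show "(f has_real_derivative 2 * max 0 (- n s) * - (g s * n s)) (at s within {0..t})"
      unfolding f_def .
    have sq: "max 0 (- n s) * - n s = f s"
      unfolding f_def by (cases "n s \<le> 0") (simp_all add: max_def power2_eq_square)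
    have "2 * max 0 (- n s) * - (g s * n s) = 2 * (g s * (max 0 (- n s) * - n s))"
      by (simp add: mult_ac)
    also have "\<dots> = 2 * (g s * f s)" by (simp only: sq)
    also have "\<dots> \<le> 2 * (B * f s)"
      using B[OF s] by (intro mult_left_mono mult_right_mono) (auto simp: f_def)
    finally show "2 * max 0 (- n s) * - (g s * n s) \<le> (2 * B) * f s" by (simp only: mult.assoc)
  qed
  moreover have "f 0 = 0" using n0 by (simp add: f_def)
  ultimately have "(max 0 (- n t))\<^sup>2 \<le> 0" by (simp add: f_def)
  then have "max 0 (- n t) = 0" by (simp only: power2_less_eq_zero_iff)
  then show ?thesis by (simp add: max_def split: if_splits)
qed

lemma weight_regular_locally_bounded:
  fixes \<psi> :: "'a::euclidean_space \<Rightarrow> 'a \<Rightarrow> real"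
  assumes \<psi>: "weight_regular k \<psi>" and K: "compact K"
  obtains B where "B > 0" "\<And>x y. x \<in> K \<Longrightarrow> \<bar>\<psi> x y\<bar> \<le> B"
proof -
  have "\<exists>U B. open U \<and> z \<in> U \<and> (\<forall>x\<in>U. \<forall>y. \<bar>\<psi> x y\<bar> \<le> B)" for z
  proof -
    obtain B where B: "\<And>y. \<bar>\<psi> z y\<bar> \<le> B" using weight_regular_bounded[OF \<psi>] by blast
    obtain U where U: "open U" "z \<in> U" "\<And>x. x \<in> U \<Longrightarrow> \<forall>y. \<bar>\<psi> x y - \<psi> z y\<bar> \<le> 1"
      using weight_regular_uniform[OF \<psi>, of 1 z] unfolding eventually_nhds by auto
    have "\<bar>\<psi> x y\<bar> \<le> B + 1" if "x \<in> U" for x y using U(3)[OF that] B[of y] by (smt (verit))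
    then show ?thesis using U by blast
  qed
  then obtain U B where UB: "\<And>z. open (U z)" "\<And>z. z \<in> U z" "\<And>z x y. x \<in> U z \<Longrightarrow> \<bar>\<psi> x y\<bar> \<le> B z"
    by metis
  obtain D where D: "finite D" "K \<subseteq> (\<Union>z\<in>D. U z)"
    by (rule compactE_image[OF K, of K U]) (use UB(1,2) in auto)
  have "\<bar>\<psi> x y\<bar> \<le> (\<Sum>z\<in>D. \<bar>B z\<bar>) + 1" if xK: "x \<in> K" for x y
  proof -
    obtain z where z: "z \<in> D" "x \<in> U z" using D(2) xK by blast
    have "\<bar>\<psi> x y\<bar> \<le> \<bar>B z\<bar>" using UB(3)[OF z(2), of y] by linarith
    also have "\<dots> \<le> (\<Sum>z\<in>D. \<bar>B z\<bar>)" by (rule member_le_sum[OF z(1)]) (use D in auto)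
    finally show ?thesis by simp
  qed
  moreover have "(\<Sum>z\<in>D. \<bar>B z\<bar>) + 1 > 0" by (simp add: add_nonneg_pos sum_nonneg)
  ultimately show ?thesis using that by blast
qed

lemma continuous_support_in_ess_supp:
  fixes f :: "'a::euclidean_space \<Rightarrow> real"
  assumes f: "continuous_on UNIV f" and y: "f y \<noteq> 0"
  shows "y \<in> ess_supp f"
proof (rule ccontr)
  assume "y \<notin> ess_supp f"
  then obtain U where U: "open U" "y \<in> U" "AE z in lebesgue. z \<in> U \<longrightarrow> f z = 0"
    unfolding ess_supp_def by blast
  obtain r where r: "r > 0" "cball y r \<subseteq> U" using U open_contains_cball by blast
  have "AE z in lebesgue. \<bar>f z\<bar> * bump y r z \<le> 0"
    using U(3)
  proof eventually_elim
    case (elim z)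
    show ?case
    proof (cases "z \<in> ball y r")
      case True
      then have "z \<in> U" using r(2) ball_subset_cball by blast
      then show ?thesis using elim by simp
    next
      case False
      then show ?thesis using r(1) by (simp add: bump_outside)
    qed
  qed
  then have "\<bar>f y\<bar> * bump y r y \<le> 0"
    by (rule AE_le_continuous) (intro continuous_intros f continuous_on_bump)
  moreover have "0 < bump y r y" using r by (intro bump_pos) simp
  ultimately show False using y by (simp add: mult_le_0_iff)
qed

locale particle_system = concentration_problem a X L k R \<psi>g \<psi>d m v0 v Kx Ky \<psi>low Istar xhat Cd \<delta>d \<rho>hat
  for a :: "'a::euclidean_space \<Rightarrow> 'a" and X :: "real \<Rightarrow> 'a \<Rightarrow> 'a" and L :: real
    and k :: nat and R :: "'a \<Rightarrow> real \<Rightarrow> real" and \<psi>g \<psi>d :: "'a \<Rightarrow> 'a \<Rightarrow> real"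
    and m :: "'a \<Rightarrow> 'a \<Rightarrow> real \<Rightarrow> real" and v0 :: "'a \<Rightarrow> real" and v :: "real \<Rightarrow> 'a \<Rightarrow> real"
    and Kx Ky :: "'a set" and \<psi>low Istar :: real and xhat :: 'a and Cd \<delta>d \<rho>hat :: real +
  fixes J :: "'i set" and \<Omega> :: "'i \<Rightarrow> 'a set" and x0 :: "'i \<Rightarrow> 'a" and w0 :: "'i \<Rightarrow> real"
    and x :: "'i \<Rightarrow> real \<Rightarrow> 'a" and w \<nu> :: "'i \<Rightarrow> real \<Rightarrow> real" and c0 C0 h :: real
  assumes v0_cont: "continuous_on UNIV v0" and c0: "0 < c0" and h: "0 < h"
    and mesh: "particle_mesh c0 C0 h J \<Omega> x0 w0"
    and psol: "particle_solution a R \<psi>g \<psi>d m v0 J x0 w0 x w \<nu>"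
    and some_mass: "\<exists>i\<in>J. 0 < v0 (x0 i)"
begin

text \<open>The mass of a particle. Its equation is free of the divergence of the velocity, which enters \<open>\<nu>\<close> and
  \<open>w\<close> with opposite signs.\<close>

definition n :: "'i \<Rightarrow> real \<Rightarrow> real" where "n i t = \<nu> i t * w i t"

definition rate :: "'i \<Rightarrow> real \<Rightarrow> real"
  where "rate i t = R (x i t) (discrete_nonlocal \<psi>g J x w \<nu> t (x i t))"

lemma v0_nonneg': "0 \<le> v0 y"
proof -
  have "AE y in lebesgue. - v0 y \<le> 0" using v0_nonneg by eventually_elim simp
  from AE_le_continuous[OF this, of y] show ?thesis by (simp add: v0_cont continuous_on_minus)
qed

lemma w0_pos: "i \<in> J \<Longrightarrow> 0 < w0 i"
proof -
  assume "i \<in> J"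
  then have "c0 * h ^ DIM('a) \<le> w0 i" using mesh by (simp add: particle_mesh_def)
  moreover have "0 < c0 * h ^ DIM('a)" using c0 h by simp
  ultimately show ?thesis by linarith
qed

lemma initial: "i \<in> J \<Longrightarrow> x i 0 = x0 i" "i \<in> J \<Longrightarrow> n i 0 = v0 (x0 i) * w0 i"
  using psol by (simp_all add: particle_solution_def n_def)

lemma x_eq: "i \<in> J \<Longrightarrow> 0 \<le> t \<Longrightarrow> x i t = X t (x0 i)"
  using solution_eq_X[of "x i" t] psol initial(1)[of i] by (simp add: particle_solution_def)

lemma n_deriv_mutation:
  assumes i: "i \<in> J" and t: "0 \<le> t"
  shows "(n i has_real_derivative rate i t * n i t + w i t * (\<Sum>\<^sub>\<infinity>j\<in>J. w j t * \<nu> j t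
      * m (x i t) (x j t) (discrete_nonlocal \<psi>d J x w \<nu> t (x i t)))) (at t within {0..})"
proof -
  define S where "S = (\<Sum>\<^sub>\<infinity>j\<in>J. w j t * \<nu> j t * m (x i t) (x j t) (discrete_nonlocal \<psi>d J x w \<nu> t (x i t)))"
  have \<nu>: "(\<nu> i has_real_derivative (- divergence a (x i t) + rate i t) * \<nu> i t + S) (at t within {0..})"
    using psol i t unfolding particle_solution_def rate_def S_def by blast
  have w: "(w i has_real_derivative divergence a (x i t) * w i t) (at t within {0..})"
    using psol i t unfolding particle_solution_def by blast
  have "(n i has_real_derivative ((- divergence a (x i t) + rate i t) * \<nu> i t + S) * w i t
      + (divergence a (x i t) * w i t) * \<nu> i t) (at t within {0..})"
    unfolding n_def[abs_def] by (rule DERIV_mult[OF \<nu> w])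
  then show ?thesis unfolding S_def[symmetric] by (simp add: n_def algebra_simps)
qed

lemma l1_bounded:
  assumes T: "0 \<le> T"
  obtains V where "V > 0" "\<And>t. t \<in> {0..T} \<Longrightarrow> (\<Sum>\<^sub>\<infinity>i\<in>J. \<bar>n i t\<bar>) \<le> V"
proof -
  have sm: "(\<lambda>i. \<bar>n i t\<bar>) summable_on J" if "0 \<le> t" for t
    using psol that by (simp add: particle_solution_def n_def)
  have "continuous_on {0..T} (\<lambda>t. \<Sum>\<^sub>\<infinity>i\<in>J. \<bar>n i t\<bar>)"
    unfolding continuous_on_def
  proof
    fix t assume t: "t \<in> {0..T}"
    have lim: "((\<lambda>s. \<Sum>\<^sub>\<infinity>i\<in>J. \<bar>n i s - n i t\<bar>) \<longlongrightarrow> 0) (at t within {0..T})"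
      using psol t by (auto simp: particle_solution_def n_def intro: tendsto_within_subset)
    show "((\<lambda>t. \<Sum>\<^sub>\<infinity>i\<in>J. \<bar>n i t\<bar>) \<longlongrightarrow> (\<Sum>\<^sub>\<infinity>i\<in>J. \<bar>n i t\<bar>)) (at t within {0..T})"
    proof (rule LIM_zero_cancel, rule Lim_null_comparison[OF _ lim])
      have "\<forall>\<^sub>F s in at t within {0..T}. s \<in> {0..T}" by (simp add: eventually_at_filter)
      then show "\<forall>\<^sub>F s in at t within {0..T}.
          norm ((\<Sum>\<^sub>\<infinity>i\<in>J. \<bar>n i s\<bar>) - (\<Sum>\<^sub>\<infinity>i\<in>J. \<bar>n i t\<bar>)) \<le> (\<Sum>\<^sub>\<infinity>i\<in>J. \<bar>n i s - n i t\<bar>)"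
      proof eventually_elim
        case (elim s)
        have s1: "(\<lambda>i. \<bar>n i s\<bar>) summable_on J" and s2: "(\<lambda>i. \<bar>n i t\<bar>) summable_on J"
          using sm elim t by auto
        have s3: "(\<lambda>i. \<bar>n i s - n i t\<bar>) summable_on J"
          by (rule summable_on_comparison_test[OF summable_on_add[OF s1 s2]]) (auto intro: abs_triangle_ineq4)
        have "(\<Sum>\<^sub>\<infinity>i\<in>J. \<bar>n i s\<bar>) \<le> (\<Sum>\<^sub>\<infinity>i\<in>J. \<bar>n i t\<bar> + \<bar>n i s - n i t\<bar>)"
          by (rule infsum_mono[OF s1 summable_on_add[OF s2 s3]]) auto
        moreover have "(\<Sum>\<^sub>\<infinity>i\<in>J. \<bar>n i t\<bar>) \<le> (\<Sum>\<^sub>\<infinity>i\<in>J. \<bar>n i s\<bar> + \<bar>n i s - n i t\<bar>)"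
          by (rule infsum_mono[OF s2 summable_on_add[OF s1 s3]]) auto
        ultimately show ?case using infsum_add[OF s2 s3] infsum_add[OF s1 s3] by (simp add: abs_le_iff)
      qed
    qed
  qed
  from compact_abs_bound[OF compact_Icc this] show ?thesis
    using that by (metis abs_ge_self order_trans)
qed

text \<open>At this stage infinitely many particles may carry mass, so the nonlocal term is controlled by the
  \<open>\<ell>\<^sup>1\<close> norm of the masses, which is continuous and hence bounded on compact time intervals.\<close>

lemma rate_bounded:
  assumes i: "i \<in> J" and T: "0 \<le> T"
  obtains B where "\<And>t. t \<in> {0..T} \<Longrightarrow> \<bar>rate i t\<bar> \<le> B"
proof -
  obtain V where V: "V > 0" "\<And>t. t \<in> {0..T} \<Longrightarrow> (\<Sum>\<^sub>\<infinity>i\<in>J. \<bar>n i t\<bar>) \<le> V" using l1_bounded[OF T] by blast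
  define K where "K = (\<lambda>t. X t (x0 i)) ` {0..T}"
  have K: "compact K" unfolding K_def by (intro compact_continuous_image continuous_intros compact_Icc)
  obtain \<Psi> where \<Psi>: "\<Psi> > 0" "\<And>z y. z \<in> K \<Longrightarrow> \<bar>\<psi>g z y\<bar> \<le> \<Psi>"
    using weight_regular_locally_bounded[OF \<psi>g K] by blast
  have "continuous_on (K \<times> {- (\<Psi> * V)..\<Psi> * V}) (\<lambda>(x, I). R x I)" by (rule continuous_on_subset[OF R_cont]) simp
  from compact_abs_bound[OF compact_Times[OF K compact_Icc] this]
  obtain B where B: "B > 0" "\<And>z I. z \<in> K \<Longrightarrow> I \<in> {- (\<Psi> * V)..\<Psi> * V} \<Longrightarrow> \<bar>R z I\<bar> \<le> B"
    by (metis SigmaI case_prod_conv)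
  have "\<bar>rate i t\<bar> \<le> B" if t: "t \<in> {0..T}" for t
  proof -
    have xK: "x i t \<in> K" using x_eq[OF i] t by (auto simp: K_def)
    have s1: "(\<lambda>j. \<bar>n j t\<bar>) summable_on J"
      using psol t by (simp add: particle_solution_def n_def)
    have s2: "(\<lambda>j. \<Psi> * \<bar>n j t\<bar>) summable_on J" by (rule summable_on_cmult_right[OF s1])
    have le: "norm (n j t * \<psi>g (x i t) (x j t)) \<le> \<Psi> * \<bar>n j t\<bar>" for j
      using mult_left_mono[OF \<Psi>(2)[OF xK, of "x j t"] abs_ge_zero[of "n j t"]] by (simp add: abs_mult mult.commute)
    have s3: "(\<lambda>j. norm (n j t * \<psi>g (x i t) (x j t))) summable_on J"
      by (rule summable_on_comparison_test[OF s2 le]) auto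
    have "norm (\<Sum>\<^sub>\<infinity>j\<in>J. n j t * \<psi>g (x i t) (x j t)) \<le> (\<Sum>\<^sub>\<infinity>j\<in>J. norm (n j t * \<psi>g (x i t) (x j t)))"
      by (rule norm_infsum_bound[OF s3])
    also have "\<dots> \<le> (\<Sum>\<^sub>\<infinity>j\<in>J. \<Psi> * \<bar>n j t\<bar>)" by (rule infsum_mono[OF s3 s2 le])
    also have "\<dots> = \<Psi> * (\<Sum>\<^sub>\<infinity>j\<in>J. \<bar>n j t\<bar>)" by (rule infsum_cmult_right'[of \<Psi>])
    also have "\<dots> \<le> \<Psi> * V" using V(2)[OF t] \<Psi>(1) by simp
    finally have "discrete_nonlocal \<psi>g J x w \<nu> t (x i t) \<in> {- (\<Psi> * V)..\<Psi> * V}"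
      by (simp add: discrete_nonlocal_def n_def abs_le_iff)
    then show ?thesis unfolding rate_def by (rule B(2)[OF xK])
  qed
  then show ?thesis by (rule that)
qed

text \<open>Where the mutation term is absent, the mass of a particle solves a linear equation, so it keeps its
  sign, and it remains zero if it vanishes initially.\<close>

lemma n_sign:
  assumes i: "i \<in> J" and t: "0 \<le> t"
    and lin: "\<And>s. s \<in> {0..t} \<Longrightarrow> (n i has_real_derivative rate i s * n i s) (at s within {0..})"
  shows "0 \<le> n i t" "v0 (x0 i) = 0 \<Longrightarrow> n i t = 0"
proof -
  obtain B where B: "\<And>s. s \<in> {0..t} \<Longrightarrow> \<bar>rate i s\<bar> \<le> B" using rate_bounded[OF i t] by blast
  have d: "(n i has_real_derivative rate i s * n i s) (at s within {0..t})" if "s \<in> {0..t}" for s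
    by (rule DERIV_subset[OF lin[OF that]]) auto
  have "0 \<le> n i 0" using initial(2)[OF i] v0_nonneg' w0_pos[OF i] by simp
  from nonneg_of_linear_ode[OF t d B this] show pos: "0 \<le> n i t" by simp
  assume "v0 (x0 i) = 0"
  then have n0: "0 \<le> - n i 0" using initial(2)[OF i] by simp
  have "0 \<le> - n i t"
  proof (rule nonneg_of_linear_ode[where n = "\<lambda>s. - n i s" and g = "rate i" and B = B, OF t])
    show "0 \<le> - n i 0" by (rule n0)
    show "\<bar>rate i s\<bar> \<le> B" if "s \<in> {0..t}" for s by (rule B[OF that])
    show "((\<lambda>s. - n i s) has_real_derivative rate i s * - n i s) (at s within {0..t})" if "s \<in> {0..t}" for s
      using DERIV_minus[OF d[OF that]] by simp
  qed
  then show "n i t = 0" using pos by simp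
qed

text \<open>A particle that sits in \<open>Ky\<close> has avoided \<open>Kx\<close> and the support of \<open>v0\<close> on its whole way, so it started
  without mass and has received none.\<close>

lemma mutation_vanishes:
  assumes j: "j \<in> J" and t: "0 \<le> t"
  shows "n j t * m y (x j t) I = 0"
proof (cases "x j t \<in> Ky")
  case True
  have out: "x j s \<notin> ess_supp v0 \<union> Kx" if s: "s \<in> {0..t}" for s
  proof
    assume "x j s \<in> ess_supp v0 \<union> Kx"
    then have "X (t - s) (x j s) \<notin> Ky" using avoid[of "t - s"] s by auto
    moreover have "X (t - s) (x j s) = x j t" using x_eq[OF j] s t by (simp flip: X_add)
    ultimately show False using True by simp
  qed
  have "n j t = 0"
  proof (rule n_sign(2)[OF j t])
    show "(n j has_real_derivative rate j s * n j s) (at s within {0..})" if s: "s \<in> {0..t}" for s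
      using n_deriv_mutation[OF j, of s] out[OF s] m_x[of "x j s"] s by simp
    have "x0 j \<notin> ess_supp v0" using out[of 0] t initial(1)[OF j] by auto
    then show "v0 (x0 j) = 0" using continuous_support_in_ess_supp[OF v0_cont] by blast
  qed
  then show ?thesis by simp
next
  case False
  then show ?thesis using m_y by simp
qed

lemma n_deriv: "i \<in> J \<Longrightarrow> 0 \<le> t \<Longrightarrow> (n i has_real_derivative rate i t * n i t) (at t within {0..})"
proof -
  assume i: "i \<in> J" and t: "0 \<le> t"
  have "(\<Sum>\<^sub>\<infinity>j\<in>J. w j t * \<nu> j t * m (x i t) (x j t) (discrete_nonlocal \<psi>d J x w \<nu> t (x i t))) = 0"
  proof (rule infsum_0)
    fix j assume "j \<in> J"
    from mutation_vanishes[OF this t]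
    have "n j t * m (x i t) (x j t) (discrete_nonlocal \<psi>d J x w \<nu> t (x i t)) = 0" .
    then show "w j t * \<nu> j t * m (x i t) (x j t) (discrete_nonlocal \<psi>d J x w \<nu> t (x i t)) = 0"
      unfolding n_def by (simp only: mult.commute[of "w j t"])
  qed
  then show ?thesis using n_deriv_mutation[OF i t] by simp
qed

lemma n_nonneg: "i \<in> J \<Longrightarrow> 0 \<le> t \<Longrightarrow> 0 \<le> n i t"
  and n_zero: "i \<in> J \<Longrightarrow> 0 \<le> t \<Longrightarrow> v0 (x0 i) = 0 \<Longrightarrow> n i t = 0"
  using n_sign n_deriv by auto

definition J0 :: "'i set" where "J0 = {i \<in> J. v0 (x0 i) \<noteq> 0}"

lemma J0_supp: "i \<in> J0 \<Longrightarrow> x0 i \<in> ess_supp v0"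
  using continuous_support_in_ess_supp[OF v0_cont] by (auto simp: J0_def)

lemma finite_J0: "finite J0"
proof (rule finite_separated_in_compact[OF _ _ supp_compact])
  show "0 < c0 * h" using c0 h by simp
  show "c0 * h \<le> dist (x0 i) (x0 j)" if "i \<in> J0" "j \<in> J0" "i \<noteq> j" for i j
    using mesh that by (simp add: particle_mesh_def J0_def)
qed (use J0_supp in auto)

lemma infsum_J0:
  assumes t: "0 \<le> t"
  shows "(\<Sum>\<^sub>\<infinity>i\<in>J. \<nu> i t * w i t * f i) = (\<Sum>i\<in>J0. n i t * f i)"
proof -
  have "(\<Sum>\<^sub>\<infinity>i\<in>J. \<nu> i t * w i t * f i) = (\<Sum>\<^sub>\<infinity>i\<in>J0. n i t * f i)"
    by (rule infsum_cong_neutral) (use n_zero t in \<open>auto simp: J0_def n_def\<close>)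
  then show ?thesis using finite_J0 by simp
qed

lemma particles_concentrating:
  "concentrating_family (\<lambda>t. point_measure J0 (\<lambda>i. ennreal (n i t))) (\<lambda>t i. x i t) R \<psi>g \<psi>low Istar
    xhat (\<lambda>t. Cd * exp (- \<delta>d * t)) Cd \<rho>hat"
proof (rule concentrating_family.intro)
  let ?N = "\<lambda>t. point_measure J0 (\<lambda>i. ennreal (n i t))"
  have J0J: "i \<in> J" if "i \<in> J0" for i using that by (simp add: J0_def)
  have int: "(LINT i|?N t. f i) = (\<Sum>i\<in>J0. n i t * f i)" if "0 \<le> t" for t and f :: "'i \<Rightarrow> real"
    using lebesgue_integral_point_measure_finite[OF finite_J0, of "\<lambda>i. n i t" f] n_nonneg[OF J0J that] by simp
  have mass: "measure (?N t) (space (?N t)) = (\<Sum>i\<in>J0. n i t)" if "0 \<le> t" for t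
    using measure_point_measure_finite_if[OF finite_J0, of "\<lambda>i. n i t" J0] n_nonneg[OF J0J that]
    by (simp add: space_point_measure)
  show "finite_measure (?N t)" if t: "0 \<le> t" for t
  proof (rule finite_measureI)
    have "(\<Sum>i\<in>J0. ennreal (n i t)) = ennreal (\<Sum>i\<in>J0. n i t)"
      using n_nonneg[OF J0J t] by (intro sum_ennreal) auto
    then show "emeasure (?N t) (space (?N t)) \<noteq> \<infinity>"
      by (simp add: space_point_measure emeasure_point_measure_finite[OF finite_J0])
  qed
  show "(\<lambda>i. x i t) \<in> borel_measurable (?N t)" for t by simp
  show "AE i in ?N t. norm (x i t - xhat) \<le> Cd * exp (- \<delta>d * t)" if t: "0 \<le> t" for t
  proof (rule AE_I2)
    fix i assume "i \<in> space (?N t)"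
    then have "i \<in> J0" by (simp add: space_point_measure)
    then show "norm (x i t - xhat) \<le> Cd * exp (- \<delta>d * t)"
      using decay[OF J0_supp t] x_eq[OF J0J t] by simp
  qed
  have rate: "R (x i t) (LINT j|?N t. \<psi>g (x i t) (x j t)) = rate i t" if "0 \<le> t" for i t
    using int[OF that] infsum_J0[OF that] by (simp add: rate_def discrete_nonlocal_def)
  show "integrable (?N t) (\<lambda>i. R (x i t) (LINT j|?N t. \<psi>g (x i t) (x j t)))" for t
    by (rule integrable_point_measure_finite[OF finite_J0])
  show "((\<lambda>t. measure (?N t) (space (?N t))) has_real_derivative
      (LINT i|?N t. R (x i t) (LINT j|?N t. \<psi>g (x i t) (x j t)))) (at t within {0..})" if t: "0 \<le> t" for t
  proof -
    have "((\<lambda>t. \<Sum>i\<in>J0. n i t) has_real_derivative (\<Sum>i\<in>J0. rate i t * n i t)) (at t within {0..})"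
      by (intro DERIV_sum n_deriv J0J t)
    then have "((\<lambda>t. \<Sum>i\<in>J0. n i t) has_real_derivative
        (LINT i|?N t. R (x i t) (LINT j|?N t. \<psi>g (x i t) (x j t)))) (at t within {0..})"
      unfolding rate[OF t] unfolding int[OF t] by (simp add: mult.commute)
    then show ?thesis
      by (rule has_field_derivative_transform_within[of _ _ _ _ 1]) (use t mass in auto)
  qed
  obtain i where i: "i \<in> J" "0 < v0 (x0 i)" using some_mass by blast
  have "0 < (\<Sum>i\<in>J0. n i 0)"
  proof (rule sum_pos2[OF finite_J0])
    show "i \<in> J0" using i by (simp add: J0_def)
    show "0 < n i 0" using i initial(2)[OF i(1)] w0_pos[OF i(1)] by simp
  qed (use n_nonneg[OF J0J] in auto)
  then show "0 < measure (?N 0) (space (?N 0))" using mass[of 0] by simp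
  show "continuous_on UNIV (\<lambda>(x, y). \<psi>g x y)" by (rule weight_regular_continuous(1)[OF \<psi>g])
qed (use decay_rate Cd R_cont \<psi>low Istar R_dec \<rho>hat in auto)

theorem particles_concentrate:
  fixes f :: "'a \<Rightarrow> real"
  assumes f: "continuous_on UNIV f"
  shows "((\<lambda>t. \<Sum>i\<in>J0. n i t * f (x i t)) \<longlongrightarrow> \<rho>hat * f xhat) at_top"
proof -
  interpret cf: concentrating_family "\<lambda>t. point_measure J0 (\<lambda>i. ennreal (n i t))" "\<lambda>t i. x i t" R \<psi>g \<psi>low Istar
    xhat "\<lambda>t. Cd * exp (- \<delta>d * t)" Cd \<rho>hat by (rule particles_concentrating)
  show ?thesis
  proof (rule Lim_transform_eventually[OF cf.concentration[OF f]])
    show "\<forall>\<^sub>F t in at_top. (LINT i|point_measure J0 (\<lambda>i. ennreal (n i t)). f (x i t)) = (\<Sum>i\<in>J0. n i t * f (x i t))"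
      using eventually_ge_at_top[of 0]
    proof eventually_elim
      case (elim t)
      then show ?case
        using lebesgue_integral_point_measure_finite[OF finite_J0, of "\<lambda>i. n i t" "\<lambda>i. f (x i t)"] n_nonneg
        by (simp add: J0_def)
    qed
  qed
qed

end

section \<open>Pairing with regularised particles\<close>

text \<open>The pairing of \<open>\<phi>\<close> with the kernel \<open>\<zeta>\<close> rescaled around \<open>y\<close>, after the substitution that removes the
  scaling. In this form \<open>\<epsilon> = 0\<close> is allowed, and the limit \<open>\<epsilon> \<rightarrow> 0\<close> becomes an instance of continuity.\<close>

definition scaled_average :: "('a::euclidean_space \<Rightarrow> real) \<Rightarrow> ('a \<Rightarrow> real) \<Rightarrow> real \<Rightarrow> 'a \<Rightarrow> real"
  where "scaled_average \<phi> \<zeta> \<epsilon> y = (LINT z|lebesgue. \<phi> (y + \<epsilon> *\<^sub>R z) * \<zeta> z)"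

lemma LINT_rescaled:
  fixes \<phi> \<zeta> :: "'a::euclidean_space \<Rightarrow> real"
  assumes "continuous_on UNIV \<phi>" "continuous_on UNIV \<zeta>" "\<epsilon> > 0"
  shows "(LINT z|lebesgue. \<phi> z * rescaled \<zeta> \<epsilon> (z - y)) = scaled_average \<phi> \<zeta> \<epsilon> y"
proof -
  have "continuous_on UNIV (\<lambda>z. \<phi> z * rescaled \<zeta> \<epsilon> (z - y))"
    unfolding rescaled_def using assms
    by (intro continuous_intros continuous_on_compose2[OF assms(2)]) auto
  from LINT_affine[OF this, of \<epsilon> y] show ?thesis
    using assms(3) by (simp add: rescaled_def scaled_average_def)
qed

lemma continuous_on_scaled_average:
  fixes \<phi> \<zeta> :: "'a::euclidean_space \<Rightarrow> real"
  assumes \<phi>: "continuous_on UNIV \<phi>" and \<zeta>: "continuous_on UNIV \<zeta>" "compactly_supported \<zeta>"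
  shows "continuous_on UNIV (\<lambda>p. scaled_average \<phi> \<zeta> (fst p) (snd p))"
proof -
  obtain c d where Q: "supp \<zeta> \<subseteq> cbox c d"
    using bounded_subset_cbox_symmetric[OF compact_imp_bounded] \<zeta>(2) unfolding compactly_supported_def by metis
  have \<phi>c: "continuous_on A (\<lambda>p. \<phi> (f p))" if "continuous_on A f" for f :: "'b::topological_space \<Rightarrow> 'a" and A
    using that by (rule continuous_on_compose2[OF \<phi>]) auto
  have \<zeta>c: "continuous_on A (\<lambda>p. \<zeta> (f p))" if "continuous_on A f" for f :: "'b::topological_space \<Rightarrow> 'a" and A
    using that by (rule continuous_on_compose2[OF \<zeta>(1)]) auto
  have "scaled_average \<phi> \<zeta> \<epsilon> y = integral (cbox c d) (\<lambda>z. \<phi> (y + \<epsilon> *\<^sub>R z) * \<zeta> z)" for \<epsilon> y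
    unfolding scaled_average_def
  proof (rule integral_cbox_eq_LINT[symmetric])
    show "continuous_on UNIV (\<lambda>z. \<phi> (y + \<epsilon> *\<^sub>R z) * \<zeta> z)" by (intro continuous_intros \<phi>c \<zeta>)
    show "\<phi> (y + \<epsilon> *\<^sub>R z) * \<zeta> z = 0" if "z \<notin> cbox c d" for z
      using supp_outside[of z \<zeta>] Q that by auto
  qed
  moreover have "continuous_on UNIV (\<lambda>p. integral (cbox c d) (\<lambda>z. \<phi> (snd p + fst p *\<^sub>R z) * \<zeta> z))"
    by (rule integral_continuous_on_param)
      (unfold case_prod_unfold, intro continuous_intros \<phi>c \<zeta>c)
  ultimately show ?thesis by simp
qed

lemma scaled_average_limits:
  fixes \<phi> \<zeta> :: "'a::euclidean_space \<Rightarrow> real"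
  assumes \<phi>: "continuous_on UNIV \<phi>" and \<zeta>: "continuous_on UNIV \<zeta>" "compactly_supported \<zeta>"
  shows "continuous_on UNIV (scaled_average \<phi> \<zeta> \<epsilon>)"
    and "((\<lambda>\<epsilon>. scaled_average \<phi> \<zeta> \<epsilon> y) \<longlongrightarrow> \<phi> y * (LINT z|lebesgue. \<zeta> z)) (nhds 0)"
proof -
  note c = continuous_on_scaled_average[OF assms]
  show "continuous_on UNIV (scaled_average \<phi> \<zeta> \<epsilon>)"
    using continuous_on_compose2[OF c continuous_on_Pair[OF continuous_on_const[of UNIV \<epsilon>] continuous_on_id]] by simp
  have "continuous_on UNIV (\<lambda>\<epsilon>. scaled_average \<phi> \<zeta> \<epsilon> y)"
    using continuous_on_compose2[OF c continuous_on_Pair[OF continuous_on_id continuous_on_const[of UNIV y]]] by simp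
  then have "isCont (\<lambda>\<epsilon>. scaled_average \<phi> \<zeta> \<epsilon> y) 0" by (simp add: continuous_on_eq_continuous_at)
  then have "((\<lambda>\<epsilon>. scaled_average \<phi> \<zeta> \<epsilon> y) \<longlongrightarrow> scaled_average \<phi> \<zeta> 0 y) (nhds 0)"
    unfolding isCont_def by (rule tendsto_at_iff_tendsto_nhds[THEN iffD1])
  then show "((\<lambda>\<epsilon>. scaled_average \<phi> \<zeta> \<epsilon> y) \<longlongrightarrow> \<phi> y * (LINT z|lebesgue. \<zeta> z)) (nhds 0)"
    by (simp add: scaled_average_def)
qed

lemma (in particle_system) particle_density_limit:
  fixes \<phi> \<zeta> :: "'a \<Rightarrow> real"
  assumes \<phi>: "continuous_on UNIV \<phi>" "compactly_supported \<phi>"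
    and \<zeta>: "continuous_on UNIV \<zeta>" "compactly_supported \<zeta>" and \<epsilon>: "\<epsilon> > 0"
  shows "((\<lambda>t. LINT z|lebesgue. \<phi> z * particle_density \<zeta> J x w \<nu> \<epsilon> t z) \<longlongrightarrow> \<rho>hat * scaled_average \<phi> \<zeta> \<epsilon> xhat) at_top"
proof (rule Lim_transform_eventually[OF particles_concentrate[OF scaled_average_limits(1)[OF \<phi>(1) \<zeta>]]])
  show "\<forall>\<^sub>F t in at_top. (\<Sum>i\<in>J0. n i t * scaled_average \<phi> \<zeta> \<epsilon> (x i t)) =
      (LINT z|lebesgue. \<phi> z * particle_density \<zeta> J x w \<nu> \<epsilon> t z)"
    using eventually_ge_at_top[of 0]
  proof eventually_elim
    case (elim t)
    have rc: "continuous_on UNIV (\<lambda>z. rescaled \<zeta> \<epsilon> (z - y))" for y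
      unfolding rescaled_def using \<epsilon> by (intro continuous_intros continuous_on_compose2[OF \<zeta>(1)]) auto
    have int: "integrable lebesgue (\<lambda>z. n i t * (\<phi> z * rescaled \<zeta> \<epsilon> (z - x i t)))" for i
    proof (rule integrable_mult_right)
      have "integrable lebesgue (\<lambda>z. rescaled \<zeta> \<epsilon> (z - x i t) * \<phi> z)"
        by (rule locally_integrable_mult[OF locally_integrable_continuous[OF rc] \<phi>])
      then show "integrable lebesgue (\<lambda>z. \<phi> z * rescaled \<zeta> \<epsilon> (z - x i t))" by (simp add: mult.commute)
    qed
    have "\<phi> z * particle_density \<zeta> J x w \<nu> \<epsilon> t z = (\<Sum>i\<in>J0. n i t * (\<phi> z * rescaled \<zeta> \<epsilon> (z - x i t)))" for z
      unfolding particle_density_def infsum_J0[OF elim] by (simp add: sum_distrib_left mult.left_commute)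
    then have "(LINT z|lebesgue. \<phi> z * particle_density \<zeta> J x w \<nu> \<epsilon> t z) =
        (\<Sum>i\<in>J0. LINT z|lebesgue. n i t * (\<phi> z * rescaled \<zeta> \<epsilon> (z - x i t)))"
      using int by (simp add: Bochner_Integration.integral_sum)
    also have "\<dots> = (\<Sum>i\<in>J0. n i t * scaled_average \<phi> \<zeta> \<epsilon> (x i t))"
      using LINT_rescaled[OF \<phi>(1) \<zeta>(1) \<epsilon>] by simp
    finally show ?case by simp
  qed
qed

text \<open>On a fine mesh some particle starts with positive mass; without it the particle system would be
  identically zero and miss the limit.\<close>

lemma mesh_meets_positive_set:
  fixes v0 :: "'a::euclidean_space \<Rightarrow> real"
  assumes v0: "continuous_on UNIV v0" "0 < v0 y" and C0: "0 < C0"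
  shows "\<exists>h0>0. \<forall>h J \<Omega> x0 w0 c. 0 < h \<and> h < h0 \<and> particle_mesh c C0 h (J :: 'i set) \<Omega> x0 w0 \<longrightarrow> (\<exists>i\<in>J. 0 < v0 (x0 i))"
proof -
  have "isCont v0 y" using v0(1) by (simp add: continuous_on_eq_continuous_at)
  then obtain \<delta> where \<delta>: "\<delta> > 0" "\<And>z. dist z y < \<delta> \<Longrightarrow> dist (v0 z) (v0 y) < v0 y"
    using v0(2) unfolding continuous_at_eps_delta by metis
  have "\<exists>i\<in>J. 0 < v0 (x0 i)"
    if h: "0 < h" "h < \<delta> / C0" and mesh: "particle_mesh c C0 h (J :: 'i set) \<Omega> x0 w0" for h J \<Omega> x0 w0 c
  proof -
    have "y \<in> (\<Union>i\<in>J. \<Omega> i)" using mesh by (simp add: particle_mesh_def)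
    then obtain i where i: "i \<in> J" "y \<in> \<Omega> i" by blast
    then have "y \<in> cball (x0 i) (C0 * h)" using mesh unfolding particle_mesh_def by blast
    moreover have "C0 * h < \<delta>" using h C0 by (simp add: field_simps)
    ultimately have "dist (x0 i) y < \<delta>" by simp
    from \<delta>(2)[OF this] have "0 < v0 (x0 i)" by (simp add: dist_real_def)
    then show ?thesis using i by blast
  qed
  then show ?thesis using \<delta>(1) C0 by (intro exI[of _ "\<delta> / C0"]) auto
qed

section \<open>The theorem\<close>

theorem theorem11:
  fixes k r :: nat
    and a :: "real ^ 'n \<Rightarrow> real ^ 'n"
    and R :: "real ^ 'n \<Rightarrow> real \<Rightarrow> real"
    and \<psi>g \<psi>d :: "real ^ 'n \<Rightarrow> real ^ 'n \<Rightarrow> real"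
    and m :: "real ^ 'n \<Rightarrow> real ^ 'n \<Rightarrow> real \<Rightarrow> real"
    and dm :: "(real ^ 'n \<Rightarrow> nat) \<Rightarrow> nat \<Rightarrow> real ^ 'n \<Rightarrow> real ^ 'n \<Rightarrow> real \<Rightarrow> real"
    and v0 :: "real ^ 'n \<Rightarrow> real" and v :: "real \<Rightarrow> real ^ 'n \<Rightarrow> real"
    and X :: "real \<Rightarrow> real ^ 'n \<Rightarrow> real ^ 'n"
    and Kx Ky Kc :: "(real ^ 'n) set"
    and \<psi>low \<mu> Mbar K Istar rstar :: real
    and xhat :: "real ^ 'n"
  assumes k: "1 \<le> k"
    and a: "velocity_regular k a"
    and R: "growth_regular k R"
    and psi_g: "weight_regular k \<psi>g" and psi_d: "weight_regular k \<psi>d"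
    and psi_low: "0 < \<psi>low" "\<forall>x y. \<psi>low \<le> \<psi>g x y"
    and psi_d_supp: "\<forall>x. compactly_supported (\<lambda>y. \<psi>d x y)"
    and m: "mutation_regular k m" and m_nonneg: "\<forall>x y I. 0 \<le> m x y I"
    and dm: "mixed_derivatives k m dm"
    and mu: "0 < \<mu>"
      "\<forall>x y I J. mixed_sum k (\<lambda>\<alpha> j. dm \<alpha> j x y I - dm \<alpha> j x y J) \<le> \<mu> * \<bar>I - J\<bar>"
    and Kc: "compact Kc" "\<forall>x. mixed_sup k dm x \<noteq> 0 \<longrightarrow> x \<in> Kc"
    and Mbar: "AE x in lebesgue. mixed_sup k dm x \<le> ereal Mbar"
    and K: "K = measure lebesgue Kc * Mbar"
    and Kx: "compact Kx" "\<forall>x. x \<notin> Kx \<longrightarrow> (\<forall>y I. m x y I = 0)"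
    and Ky: "compact Ky" "\<forall>y. y \<notin> Ky \<longrightarrow> (\<forall>x I. m x y I = 0)"
    and Istar: "0 \<le> Istar" "0 \<le> rstar" "\<forall>x. \<forall>I\<ge>Istar. R x I + K < - rstar"
    and v0: "in_Wk1 k v0" "AE x in lebesgue. 0 \<le> v0 x"
    and v0_nonzero: "\<not> (AE x in lebesgue. v0 x = 0)"
    and X: "is_flow a X"
    and v: "weak_solution k a R \<psi>g \<psi>d m v0 v"
    and xhat: "asymptotically_stable_equilibrium a X xhat"
    and decay: "\<exists>C>0. \<exists>\<delta>>0. \<forall>y\<in>ess_supp v0. \<forall>t\<ge>0. norm (X t y - xhat) \<le> C * exp (- \<delta> * t)"
    and supp_compact: "compact (ess_supp v0 \<union> Kx)"
    and decay': "\<exists>C'>0. \<exists>\<delta>'>0. \<forall>y\<in>ess_supp v0 \<union> Kx. \<forall>t\<ge>0.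
      norm (X t y - xhat) \<le> C' * exp (- \<delta>' * t)"
    and avoid: "(\<Union>s\<in>{0..}. X s ` (ess_supp v0 \<union> Kx)) \<inter> Ky = {}"
    and growth: "\<exists>D>0. \<exists>Im>0. \<exists>IM>0. \<forall>x\<in>insert xhat (ess_supp v0).
      0 \<le> R x Im \<and> R x IM \<le> 0 \<and> (AE I in lebesgue. wderiv (unit_index 1) (R x) I \<le> - D)"
  shows "(\<exists>\<rho>\<ge>0. (\<forall>s. R xhat (\<psi>g xhat xhat * s) = 0 \<longleftrightarrow> s = \<rho>) \<and>
      weakly_converges (\<lambda>t. density lebesgue (\<lambda>x. ennreal (v t x)))
        (scale_measure (ennreal \<rho>) (return borel xhat))) \<and>
    (\<forall>(J :: real \<Rightarrow> (int ^ 'n) set) \<Omega> x0 w0 x w \<nu> c C0 \<phi>.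
      continuous_on UNIV v0 \<and> 0 < c \<and> 0 < C0 \<and> 1 \<le> r \<and> cutoff r \<phi> \<and>
      (\<forall>\<^sub>F h in at_right 0.
        particle_mesh c C0 h (J h) (\<Omega> h) (x0 h) (w0 h) \<and>
        particle_solution a R \<psi>g \<psi>d m v0 (J h) (x0 h) (w0 h) (x h) (w h) (\<nu> h) \<and>
        (\<forall>t\<ge>0. \<forall>y. (\<Sum>\<^sub>\<infinity>i\<in>J h. w h i t * m (x h i t) y
            (discrete_nonlocal \<psi>d (J h) (x h) (w h) (\<nu> h) t (x h i t))) < K + rstar / 2)) \<longrightarrow>
      asymptotic_preserving
        (\<lambda>h \<epsilon>. particle_density \<phi> (J h) (x h) (w h) (\<nu> h) \<epsilon>) v)"
proof -
  obtain L where L: "L > 0" "\<And>p q. norm (a p - a q) \<le> L * norm (p - q)"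
    using velocity_regular_lipschitz[OF a] by blast
  obtain Cd \<delta>d where Cd: "Cd > 0" "\<delta>d > 0"
    "\<And>y t. y \<in> ess_supp v0 \<Longrightarrow> 0 \<le> t \<Longrightarrow> norm (X t y - xhat) \<le> Cd * exp (- \<delta>d * t)"
    using decay by blast
  obtain D Im IM where D: "D > 0" "Im > 0" "IM > 0" "0 \<le> R xhat Im" "R xhat IM \<le> 0"
    "AE I in lebesgue. wderiv (unit_index 1) (R xhat) I \<le> - D"
    using growth by blast
  have R_dec: "R xhat J < R xhat I" if "I < J" for I J
  proof -
    have "R xhat (I + (J - I)) - R xhat I \<le> - D * (J - I)"
      by (rule growth_regular_increment[OF R k D(6)]) (use that in simp)
    moreover have "D * (J - I) > 0" using D(1) that by simp
    ultimately show ?thesis by simp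
  qed
  have pos: "0 < \<psi>g xhat xhat" using psi_low by (metis less_le_trans)
  obtain I0 where I0: "Im \<le> I0" "R xhat I0 = 0"
  proof -
    have "continuous_on UNIV (R xhat)"
      by (rule continuous_on_slice_UNIV[OF growth_regular_continuous[OF R]])
    then have "isCont (R xhat) I" for I by (simp add: continuous_on_eq_continuous_at)
    moreover have "Im \<le> IM"
      using R_dec[of IM Im] D(4,5) by (cases "Im \<le> IM") auto
    ultimately show ?thesis using IVT2[of "R xhat" IM 0 Im] D(4,5) that by blast
  qed
  define \<rho> where "\<rho> = I0 / \<psi>g xhat xhat"
  have \<rho>: "0 < \<rho>" "R xhat (\<psi>g xhat xhat * \<rho>) = 0" using I0 D(2) pos by (simp_all add: \<rho>_def)
  have unique: "R xhat (\<psi>g xhat xhat * s) = 0 \<longleftrightarrow> s = \<rho>" for s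
  proof
    assume 0: "R xhat (\<psi>g xhat xhat * s) = 0"
    have "\<not> \<psi>g xhat xhat * s < \<psi>g xhat xhat * \<rho>" "\<not> \<psi>g xhat xhat * \<rho> < \<psi>g xhat xhat * s"
      using R_dec 0 \<rho>(2) by (metis less_irrefl)+
    then show "s = \<rho>" using pos by simp
  qed (use \<rho> in simp)
  have "0 \<le> Mbar"
  proof -
    have nonneg: "0 \<le> mixed_sup k dm x" for x
    proof -
      have "0 \<le> ereal (mixed_sum k (\<lambda>\<alpha> j. dm \<alpha> j x 0 0))" by (simp add: mixed_sum_def sum_nonneg)
      also have "\<dots> \<le> mixed_sup k dm x"
        unfolding mixed_sup_def by (intro SUP_upper2[of 0] UNIV_I order_refl)
      finally show ?thesis .
    qed
    have "AE x::real ^ 'n in lebesgue. 0 \<le> Mbar"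
    proof (rule AE_mp[OF Mbar], intro AE_I2 impI)
      fix x :: "real ^ 'n" assume "mixed_sup k dm x \<le> ereal Mbar"
      with nonneg[of x] have "0 \<le> ereal Mbar" by (rule order_trans)
      then show "0 \<le> Mbar" by simp
    qed
    from AE_le_continuous[OF this] show ?thesis by simp
  qed
  then have "0 \<le> K" unfolding K by simp
  have R_neg: "R x I \<le> 0" if "Istar \<le> I" for x I
  proof -
    have "R x I + K < - rstar" using Istar(3) that by blast
    then show ?thesis using \<open>0 \<le> K\<close> Istar(2) by linarith
  qed
  have supp: "compact (ess_supp v0)"
  proof -
    have "ess_supp v0 = (ess_supp v0 \<union> Kx) \<inter> ess_supp v0" by blast
    then show ?thesis using compact_Int_closed[OF supp_compact closed_ess_supp] by metis
  qed
  interpret concentration_problem a X L k R \<psi>g \<psi>d m v0 v Kx Ky \<psi>low Istar xhat Cd \<delta>d \<rho>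
  proof unfold_locales
    show "X s y \<notin> Ky" if "0 \<le> s" "y \<in> ess_supp v0 \<union> Kx" for s y
      using avoid that by fastforce
  qed (use L X growth_regular_continuous[OF R] psi_g Kx Ky v in_Wk1_D[OF v0(1)] v0 supp Cd psi_low R_neg R_dec \<rho> v0_nonzero
      in auto)
  have wc: "weakly_converges (\<lambda>t. density lebesgue (\<lambda>x. ennreal (v t x))) (scale_measure (ennreal \<rho>) (return borel xhat))"
    unfolding weakly_converges_def
  proof (intro allI impI)
    fix \<phi> :: "real ^ 'n \<Rightarrow> real" assume \<phi>: "continuous_on UNIV \<phi> \<and> compactly_supported \<phi>"
    have m: "\<phi> \<in> borel_measurable borel" using \<phi> by (simp add: borel_measurable_continuous_onI)
    have eq: "scale_measure (ennreal \<rho>) (return borel xhat) = density (return borel xhat) (\<lambda>_. ennreal \<rho>)"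
      by (rule measure_eqI) (auto simp: emeasure_density nn_integral_cmult_indicator)
    have "(LINT x|scale_measure (ennreal \<rho>) (return borel xhat). \<phi> x) = (LINT x|return borel xhat. \<rho> * \<phi> x)"
      unfolding eq using m \<rho>(1) by (subst integral_density) auto
    also have "\<dots> = \<rho> * \<phi> xhat" using m by (simp add: integral_return)
    finally show "((\<lambda>t. LINT x|density lebesgue (\<lambda>x. ennreal (v t x)). \<phi> x) \<longlongrightarrow>
        (LINT x|scale_measure (ennreal \<rho>) (return borel xhat). \<phi> x)) at_top"
      using solution_concentrates(1) \<phi> by simp
  qed
  have ap: "asymptotic_preserving (\<lambda>h \<epsilon>. particle_density \<zeta> (J h) (x h) (w h) (\<nu> h) \<epsilon>) v"
    if v0c: "continuous_on UNIV v0" and c: "0 < c" and C0: "0 < C0" and \<zeta>: "cutoff r \<zeta>"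
      and ev: "\<forall>\<^sub>F h in at_right 0. particle_mesh c C0 h (J h) (\<Omega> h) (x0 h) (w0 h) \<and>
        particle_solution a R \<psi>g \<psi>d m v0 (J h) (x0 h) (w0 h) (x h) (w h) (\<nu> h)"
    for J :: "real \<Rightarrow> (int ^ 'n) set" and \<Omega> x0 w0 x w \<nu> c C0 \<zeta>
    unfolding asymptotic_preserving_def
  proof (intro allI impI)
    fix \<epsilon> :: "real \<Rightarrow> real" and \<phi> :: "real ^ 'n \<Rightarrow> real"
    assume \<epsilon>: "(\<forall>h. 0 < h \<and> h \<le> 1 \<longrightarrow> 0 < \<epsilon> h) \<and> (\<epsilon> \<longlongrightarrow> 0) (at_right 0)"
      and \<phi>: "continuous_on UNIV \<phi> \<and> compactly_supported \<phi>"
    have \<zeta>': "continuous_on UNIV \<zeta>" "compactly_supported \<zeta>" "(LINT z|lebesgue. \<zeta> z) = 1"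
      using \<zeta> by (auto simp: cutoff_def)
    \<comment> \<open>For each small \<open>h\<close> the discrepancy \<open>?d h\<close> converges to \<open>?l h\<close> as time tends to infinity, so its upper limit
      is \<open>?l h\<close>, and this depends on \<open>h\<close> through the regularisation scale only.\<close>
    let ?d = "\<lambda>h t. ereal \<bar>(LINT z|lebesgue. \<phi> z * particle_density \<zeta> (J h) (x h) (w h) (\<nu> h) (\<epsilon> h) t z)
        - (LINT z|lebesgue. \<phi> z * v t z)\<bar>"
    let ?l = "\<lambda>h. \<bar>\<rho> * scaled_average \<phi> \<zeta> (\<epsilon> h) xhat - \<rho> * \<phi> xhat\<bar>"
    obtain y where y: "0 < v0 y"
    proof (rule ccontr)
      assume "\<not> thesis"
      then have le: "v0 y \<le> 0" for y using that by (meson not_le)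
      have "AE x in lebesgue. v0 x = 0" using v0(2) by eventually_elim (use le in \<open>simp add: antisym\<close>)
      then show False using v0_nonzero by blast
    qed
    obtain h0 where h0: "h0 > 0" "\<And>h J \<Omega> x0 w0 c. 0 < h \<Longrightarrow> h < h0 \<Longrightarrow>
        particle_mesh c C0 h (J :: (int ^ 'n) set) \<Omega> x0 w0 \<Longrightarrow> \<exists>i\<in>J. 0 < v0 (x0 i)"
      using mesh_meets_positive_set[OF v0c y C0] by blast
    have small: "\<forall>\<^sub>F h in at_right (0::real). 0 < h \<and> h < min h0 1"
      using h0(1) unfolding eventually_at_right_field by (intro exI[of _ "min h0 1"]) auto
    have lim: "\<forall>\<^sub>F h in at_right 0. Limsup at_top (?d h) = ereal (?l h)"
      using ev small
    proof eventually_elim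
      case (elim h)
      have \<epsilon>h: "0 < \<epsilon> h" using \<epsilon> elim(2) by simp
      interpret ps: particle_system a X L k R \<psi>g \<psi>d m v0 v Kx Ky \<psi>low Istar xhat Cd \<delta>d \<rho>
        "J h" "\<Omega> h" "x0 h" "w0 h" "x h" "w h" "\<nu> h" c C0 h
        by unfold_locales (use v0c c elim h0(2)[of h c "J h" "\<Omega> h" "x0 h" "w0 h"] in auto)
      have "(?d h \<longlongrightarrow> ereal (?l h)) at_top"
        using ps.particle_density_limit[of \<phi> \<zeta> "\<epsilon> h"] \<phi> \<zeta>' \<epsilon>h solution_concentrates(2)[of \<phi>]
        by (intro tendsto_ereal tendsto_rabs tendsto_diff) auto
      then show ?case by (rule lim_imp_Limsup[OF trivial_limit_at_top_linorder])
    qed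
    have "((\<lambda>h. ereal (?l h)) \<longlongrightarrow> ereal \<bar>\<rho> * (\<phi> xhat * 1) - \<rho> * \<phi> xhat\<bar>) (at_right 0)"
    proof (intro tendsto_ereal tendsto_rabs tendsto_diff tendsto_mult tendsto_const)
      show "((\<lambda>h. scaled_average \<phi> \<zeta> (\<epsilon> h) xhat) \<longlongrightarrow> \<phi> xhat * 1) (at_right 0)"
      proof (rule filterlim_compose[OF _ conjunct2[OF \<epsilon>]])
        show "((\<lambda>\<epsilon>. scaled_average \<phi> \<zeta> \<epsilon> xhat) \<longlongrightarrow> \<phi> xhat * 1) (nhds 0)"
          using scaled_average_limits(2)[of \<phi> \<zeta> xhat] \<phi> \<zeta>' by simp
      qed
    qed
    then have "((\<lambda>h. Limsup at_top (?d h)) \<longlongrightarrow> ereal \<bar>\<rho> * (\<phi> xhat * 1) - \<rho> * \<phi> xhat\<bar>) (at_right 0)"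
      by (rule iffD2[OF tendsto_cong[OF lim]])
    then show "((\<lambda>h. Limsup at_top (?d h)) \<longlongrightarrow> 0) (at_right 0)" by (simp add: zero_ereal_def)
  qed
  show ?thesis
  proof (intro conjI allI impI)
    show "\<exists>\<rho>\<ge>0. (\<forall>s. R xhat (\<psi>g xhat xhat * s) = 0 \<longleftrightarrow> s = \<rho>) \<and>
      weakly_converges (\<lambda>t. density lebesgue (\<lambda>x. ennreal (v t x)))
        (scale_measure (ennreal \<rho>) (return borel xhat))"
      using \<rho>(1) unique wc by (intro exI[of _ \<rho>]) auto
    fix J :: "real \<Rightarrow> (int ^ 'n) set" and \<Omega> x0 w0 x w \<nu> c C0 and \<phi> :: "real ^ 'n \<Rightarrow> real"
    assume *: "continuous_on UNIV v0 \<and> 0 < c \<and> 0 < C0 \<and> 1 \<le> r \<and> cutoff r \<phi> \<and>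
      (\<forall>\<^sub>F h in at_right 0.
        particle_mesh c C0 h (J h) (\<Omega> h) (x0 h) (w0 h) \<and>
        particle_solution a R \<psi>g \<psi>d m v0 (J h) (x0 h) (w0 h) (x h) (w h) (\<nu> h) \<and>
        (\<forall>t\<ge>0. \<forall>y. (\<Sum>\<^sub>\<infinity>i\<in>J h. w h i t * m (x h i t) y
            (discrete_nonlocal \<psi>d (J h) (x h) (w h) (\<nu> h) t (x h i t))) < K + rstar / 2))"
    show "asymptotic_preserving (\<lambda>h \<epsilon>. particle_density \<phi> (J h) (x h) (w h) (\<nu> h) \<epsilon>) v"
      by (rule ap[of c C0 \<phi> J \<Omega> x0 w0 x w \<nu>]) (use * in \<open>auto elim: eventually_mono\<close>)
  qed
qed

end
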